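(* Let $K$ be an algebraically closed field, let $\Lambda$ be a finite-dimensional $K$-algebra, let $E$ be a generator in $\Lambda\text{-}\mathrm{mod}$, and let $\Gamma=(\mathrm{End}_\Lambda E)^{op}$. Then there is a bijection between $\mathcal{EG}(E)$, the set of isomorphism classes of indecomposable $E$-Gorenstein projective $E$-rigid modules in $\Lambda\text{-}\mathrm{mod}$, and $\mathcal{TG}(\Gamma)$, the set of isomorphism classes of indecomposable Gorenstein projective $\tau$-rigid modules in $\Gamma\text{-}\mathrm{mod}$.
   Context: All algebras are finite-dimensional over an algebraically closed field $K$ and all modules are finitely generated left modules; $A\text{-}\mathrm{mod}$ denotes the category of finitely generated left $A$-modules. $\mathrm{add}\,E$ is the full subcategory of direct summands of finite direct sums of copies of $E$. $E$ is a generator in $\Lambda\text{-}\mathrm{mod}$ if $\Lambda\in\mathrm{add}\,E$. $E$-Gorenstein projective: a module $M\in\Lambda\text{-}\mathrm{mod}$ is $E$-Gorenstein projective if there is an exact sequence $\cdots\to E_{-1}\xrightarrow{d_{-1}}E_0\xrightarrow{d_0}E_1\to\cdots$ with all $E_i\in\mathrm{add}\,E$ which stays exact after applying each of the functors $\mathrm{Hom}_\Lambda(-,E)$ and $\mathrm{Hom}_\Lambda(E,-)$, and such that $M\simeq\mathrm{Im}\,d_0$. $E$-rigid: for $M\in\Lambda\text{-}\mathrm{mod}$, let $E_1\xrightarrow{f_1}E_0\xrightarrow{f_0}M\to 0$ be a minimal $\mathrm{add}\,E$-presentation of $M$, i.e. an exact sequence such that for $i=0,1$ the map $E_i\to\mathrm{Im}\,f_i$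 induced by $f_i$ is a minimal right $\mathrm{add}\,E$-approximation of $\mathrm{Im}\,f_i$. $M$ is $E$-rigid if the map $\mathrm{Hom}_\Lambda(f_1,M):\mathrm{Hom}_\Lambda(E_0,M)\to\mathrm{Hom}_\Lambda(E_1,M)$ is surjective. A module is $E$-Gorenstein projective $E$-rigid if it is both $E$-Gorenstein projective and $E$-rigid. For an algebra $A$, a module $N\in A\text{-}\mathrm{mod}$ is Gorenstein projective if there is an exact sequence $\cdots\to P_{-1}\to P_0\to P_1\to\cdots$ of finitely generated projective left $A$-modules which stays exact under $\mathrm{Hom}_A(-,A)$ and such that $N\simeq\mathrm{Im}(P_{-1}\to P_0)$. $N$ is $\tau$-rigid if $\mathrm{Hom}_A(N,\tau N)=0$, where $\tau$ is the Auslander-Reiten translation. $N$ is Gorenstein projective $\tau$-rigid if it is both. *)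

theory Defs
  imports "HOL-Algebra.Algebraic_Closure" "HOL-Algebra.Module"
begin

section \<open>Algebras and left modules\<close>

text \<open>
  The locale \<^locale>\<open>module\<close> of the library is restricted to commutative base rings.  Modules over
  a noncommutative ring use the same record \<open>('a, 'm) module\<close>; its fields
  \<open>mult\<close> and \<open>one\<close> play no role for modules.
\<close>

locale left_module = R?: ring R + M?: abelian_group M
  for R :: "('a, 'x) ring_scheme" (structure) and M :: "('a, 'm) module" (structure) +
  assumes smult_closed:
      "\<lbrakk>a \<in> carrier R; x \<in> carrier M\<rbrakk> \<Longrightarrow> a \<odot>\<^bsub>M\<^esub> x \<in> carrier M"
    and smult_l_distr:
      "\<lbrakk>a \<in> carrier R; b \<in> carrier R; x \<in> carrier M\<rbrakk> \<Longrightarrow>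
        (a \<oplus>\<^bsub>R\<^esub> b) \<odot>\<^bsub>M\<^esub> x = a \<odot>\<^bsub>M\<^esub> x \<oplus>\<^bsub>M\<^esub> b \<odot>\<^bsub>M\<^esub> x"
    and smult_r_distr:
      "\<lbrakk>a \<in> carrier R; x \<in> carrier M; y \<in> carrier M\<rbrakk> \<Longrightarrow>
        a \<odot>\<^bsub>M\<^esub> (x \<oplus>\<^bsub>M\<^esub> y) = a \<odot>\<^bsub>M\<^esub> x \<oplus>\<^bsub>M\<^esub> a \<odot>\<^bsub>M\<^esub> y"
    and smult_assoc1:
      "\<lbrakk>a \<in> carrier R; b \<in> carrier R; x \<in> carrier M\<rbrakk> \<Longrightarrow>
        (a \<otimes>\<^bsub>R\<^esub> b) \<odot>\<^bsub>M\<^esub> x = a \<odot>\<^bsub>M\<^esub> (b \<odot>\<^bsub>M\<^esub> x)"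
    and smult_one:
      "x \<in> carrier M \<Longrightarrow> \<one>\<^bsub>R\<^esub> \<odot>\<^bsub>M\<^esub> x = x"

definition finitely_generated :: "('a, 'x) ring_scheme \<Rightarrow> ('a, 'm) module \<Rightarrow> bool" where
  "finitely_generated R M \<longleftrightarrow>
    (\<exists>S. finite S \<and> S \<subseteq> carrier M \<and> (\<forall>H. submodule H R M \<and> S \<subseteq> H \<longrightarrow> H = carrier M))"

definition fg_module :: "('a, 'x) ring_scheme \<Rightarrow> ('a, 'm) module \<Rightarrow> bool" where
  "fg_module R M \<longleftrightarrow> left_module R M \<and> finitely_generated R M"

text \<open>
  A (possibly noncommutative) algebra \<open>A\<close> over \<open>K\<close> carries its ring structure and the scalar
  multiplication by \<open>K\<close> in one record \<open>('k, 'a) module\<close>.  (The locale \<^locale>\<open>algebra\<close> of the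
  library is restricted to commutative algebras.)
\<close>

locale fd_algebra = module K A + ring A
  for K :: "('k, 'z) ring_scheme" (structure) and A :: "('k, 'a) module" (structure) +
  assumes base_field: "field K"
    and smult_assoc2:
      "\<lbrakk>c \<in> carrier K; x \<in> carrier A; y \<in> carrier A\<rbrakk> \<Longrightarrow>
        (c \<odot>\<^bsub>A\<^esub> x) \<otimes>\<^bsub>A\<^esub> y = c \<odot>\<^bsub>A\<^esub> (x \<otimes>\<^bsub>A\<^esub> y)"
    and smult_assoc3:
      "\<lbrakk>c \<in> carrier K; x \<in> carrier A; y \<in> carrier A\<rbrakk> \<Longrightarrow>
        x \<otimes>\<^bsub>A\<^esub> (c \<odot>\<^bsub>A\<^esub> y) = c \<odot>\<^bsub>A\<^esub> (x \<otimes>\<^bsub>A\<^esub> y)"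
    and finite_dim: "finitely_generated K A"

definition op_alg :: "('k, 'a) module \<Rightarrow> ('k, 'a) module" where
  "op_alg A = A\<lparr>monoid.mult := (\<lambda>x y. y \<otimes>\<^bsub>A\<^esub> x)\<rparr>"

definition with_smult ::
  "('m, 'x) ring_scheme \<Rightarrow> ('r \<Rightarrow> 'm \<Rightarrow> 'm) \<Rightarrow> ('r, 'm) module" where
  "with_smult G s = \<lparr>carrier = carrier G, monoid.mult = monoid.mult G, one = one G,
     zero = zero G, add = add G, smult = s\<rparr>"

definition regular_module :: "('a, 'x) ring_scheme \<Rightarrow> ('a, 'a) module" where
  "regular_module R = with_smult R (monoid.mult R)"

text \<open>The \<open>K\<close>-space underlying a module over the \<open>K\<close>-algebra \<open>A\<close>: \<open>c x = (c 1\<^sub>A) x\<close>.\<close>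

definition underlying_space :: "('k, 'a) module \<Rightarrow> ('a, 'm) module \<Rightarrow> ('k, 'm) module" where
  "underlying_space A M = with_smult M (\<lambda>c x. (c \<odot>\<^bsub>A\<^esub> \<one>\<^bsub>A\<^esub>) \<odot>\<^bsub>M\<^esub> x)"

definition quotient_module ::
  "('a, 'x) ring_scheme \<Rightarrow> ('a, 'm) module \<Rightarrow> 'm set \<Rightarrow> ('a, 'm set) module" where
  "quotient_module R M U = \<lparr>carrier = A_RCOSETS M U, monoid.mult = undefined, one = undefined,
     zero = U, add = set_add M, smult = (\<lambda>r C. \<Union>x\<in>C. U +>\<^bsub>M\<^esub> (r \<odot>\<^bsub>M\<^esub> x))\<rparr>"


section \<open>Homomorphisms\<close>

text \<open>Linear maps are extensional, so that equal maps are equal as HOL functions.\<close>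

definition linear_maps ::
  "('a, 'x) ring_scheme \<Rightarrow> ('a, 'm) module \<Rightarrow> ('a, 'n) module \<Rightarrow> ('m \<Rightarrow> 'n) set" where
  "linear_maps R M N = {f \<in> carrier M \<rightarrow>\<^sub>E carrier N.
     (\<forall>x\<in>carrier M. \<forall>y\<in>carrier M. f (x \<oplus>\<^bsub>M\<^esub> y) = f x \<oplus>\<^bsub>N\<^esub> f y) \<and>
     (\<forall>r\<in>carrier R. \<forall>x\<in>carrier M. f (r \<odot>\<^bsub>M\<^esub> x) = r \<odot>\<^bsub>N\<^esub> f x)}"

text \<open>The abelian group \<open>Hom\<^sub>R(M, N)\<close>; the multiplicative fields of the record are not used.\<close>

definition Hom ::
  "('a, 'x) ring_scheme \<Rightarrow> ('a, 'm) module \<Rightarrow> ('a, 'n) module \<Rightarrow> ('m \<Rightarrow> 'n) ring" where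
  "Hom R M N = \<lparr>carrier = linear_maps R M N, monoid.mult = undefined, one = undefined,
     zero = (\<lambda>x\<in>carrier M. \<zero>\<^bsub>N\<^esub>), add = (\<lambda>f g. \<lambda>x\<in>carrier M. f x \<oplus>\<^bsub>N\<^esub> g x)\<rparr>"

text \<open>
  \<open>precomp M f\<close> is \<open>Hom(f, Q) : Hom(N, Q) \<rightarrow> Hom(M, Q)\<close> for \<open>f : M \<rightarrow> N\<close>, and
  \<open>postcomp Q f\<close> is \<open>Hom(Q, f) : Hom(Q, M) \<rightarrow> Hom(Q, N)\<close>.
\<close>

definition precomp ::
  "('a, 'm) module \<Rightarrow> ('m \<Rightarrow> 'n) \<Rightarrow> ('n \<Rightarrow> 'x) \<Rightarrow> ('m \<Rightarrow> 'x)" where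
  "precomp M f = (\<lambda>g. compose (carrier M) g f)"

definition postcomp ::
  "('a, 'x) module \<Rightarrow> ('m \<Rightarrow> 'n) \<Rightarrow> ('x \<Rightarrow> 'm) \<Rightarrow> ('x \<Rightarrow> 'n)" where
  "postcomp Q f = (\<lambda>g. compose (carrier Q) f g)"

definition exact_at ::
  "('a, 'x) ring_scheme \<Rightarrow> ('b, 'y) ring_scheme \<Rightarrow> ('c, 'z) ring_scheme \<Rightarrow>
    ('a \<Rightarrow> 'b) \<Rightarrow> ('b \<Rightarrow> 'c) \<Rightarrow> bool" where
  "exact_at Q Y Z f g \<longleftrightarrow> f ` carrier Q = a_kernel Y Z g"

definition image_module :: "('a, 'm) module \<Rightarrow> ('a, 'n) module \<Rightarrow> ('m \<Rightarrow> 'n) \<Rightarrow> ('a, 'n) module" where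
  "image_module M N f = N\<lparr>carrier := f ` carrier M\<rparr>"

definition mod_iso :: "('a, 'x) ring_scheme \<Rightarrow> ('a, 'm) module \<Rightarrow> ('a, 'n) module \<Rightarrow> bool" where
  "mod_iso R M N \<longleftrightarrow> (\<exists>f\<in>linear_maps R M N. bij_betw f (carrier M) (carrier N))"

definition iso_classes :: "('a, 'x) ring_scheme \<Rightarrow> ('a, 'm) module set \<Rightarrow> ('a, 'm) module set set" where
  "iso_classes R \<C> = \<C> // {(M, N). M \<in> \<C> \<and> N \<in> \<C> \<and> mod_iso R M N}"

text \<open>
  \<open>(End\<^sub>\<Lambda> E)\<^sup>o\<^sup>p\<close> as a \<open>K\<close>-algebra: the product of \<open>f\<close> and \<open>g\<close> is \<open>g \<circ> f\<close>.
\<close>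

definition End_op :: "('k, 'a) module \<Rightarrow> ('a, 'e) module \<Rightarrow> ('k, 'e \<Rightarrow> 'e) module" where
  "End_op \<Lambda> E = op_alg
     ((with_smult (Hom \<Lambda> E E) (\<lambda>c f. \<lambda>x\<in>carrier E. (c \<odot>\<^bsub>\<Lambda>\<^esub> \<one>\<^bsub>\<Lambda>\<^esub>) \<odot>\<^bsub>E\<^esub> f x))
      \<lparr>monoid.mult := (\<lambda>f g. compose (carrier E) f g), one := (\<lambda>x\<in>carrier E. x)\<rparr>)"


section \<open>Direct sums and \<open>add E\<close>\<close>

definition internal_direct_sum ::
  "('a, 'x) ring_scheme \<Rightarrow> ('a, 'm) module \<Rightarrow> 'm set \<Rightarrow> 'm set \<Rightarrow> bool" where
  "internal_direct_sum R M U V \<longleftrightarrow>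
     submodule U R M \<and> submodule V R M \<and> U \<inter> V = {\<zero>\<^bsub>M\<^esub>} \<and> U <+>\<^bsub>M\<^esub> V = carrier M"

definition indecomposable :: "('a, 'x) ring_scheme \<Rightarrow> ('a, 'm) module \<Rightarrow> bool" where
  "indecomposable R M \<longleftrightarrow> carrier M \<noteq> {\<zero>\<^bsub>M\<^esub>} \<and>
     (\<forall>U V. internal_direct_sum R M U V \<longrightarrow> U = {\<zero>\<^bsub>M\<^esub>} \<or> V = {\<zero>\<^bsub>M\<^esub>})"

definition copies :: "nat \<Rightarrow> ('a, 'e) module \<Rightarrow> ('a, nat \<Rightarrow> 'e) module" where
  "copies n E = \<lparr>carrier = {..<n} \<rightarrow>\<^sub>E carrier E, monoid.mult = undefined, one = undefined,
     zero = (\<lambda>i\<in>{..<n}. \<zero>\<^bsub>E\<^esub>), add = (\<lambda>u v. \<lambda>i\<in>{..<n}. u i \<oplus>\<^bsub>E\<^esub> v i),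
     smult = (\<lambda>r u. \<lambda>i\<in>{..<n}. r \<odot>\<^bsub>E\<^esub> u i)\<rparr>"

definition in_add ::
  "('a, 'x) ring_scheme \<Rightarrow> ('a, 'e) module \<Rightarrow> ('a, 'm) module \<Rightarrow> bool" where
  "in_add R E M \<longleftrightarrow> fg_module R M \<and>
     (\<exists>n U V. internal_direct_sum R (copies n E) U V \<and> mod_iso R M ((copies n E)\<lparr>carrier := U\<rparr>))"

definition generator :: "('a, 'x) ring_scheme \<Rightarrow> ('a, 'e) module \<Rightarrow> bool" where
  "generator R E \<longleftrightarrow> fg_module R E \<and> in_add R E (regular_module R)"


section \<open>Relative Gorenstein projective and rigid modules\<close>

text \<open>
  Below, objects of \<open>A-mod\<close> that are quantified over have carriers in the fixed type
  \<open>nat \<Rightarrow> 'k\<close>, where \<open>'k\<close> is the type of the scalars.  If \<open>A\<close> is finite-dimensional over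
  a field with elements in \<open>'k\<close>, every finitely generated \<open>A\<close>-module is isomorphic to such a
  module (transport the structure to the tuples \<open>{..<n} \<rightarrow>\<^sub>E carrier K\<close>), so this is
  all of \<open>A-mod\<close> up to isomorphism.
\<close>

definition E_gorenstein_projective ::
  "('a, 'x) ring_scheme \<Rightarrow> ('a, 'e) module \<Rightarrow> ('a, nat \<Rightarrow> 'k) module \<Rightarrow> bool" where
  "E_gorenstein_projective R E M \<longleftrightarrow> fg_module R M \<and>
    (\<exists>(Q :: int \<Rightarrow> ('a, nat \<Rightarrow> 'k) module) d.
       (\<forall>i. in_add R E (Q i) \<and> d i \<in> linear_maps R (Q i) (Q (i + 1))) \<and>
       (\<forall>i. exact_at (Q i) (Q (i + 1)) (Q (i + 2)) (d i) (d (i + 1))) \<and>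
       (\<forall>i. exact_at (Hom R (Q (i + 2)) E) (Hom R (Q (i + 1)) E) (Hom R (Q i) E)
              (precomp (Q (i + 1)) (d (i + 1))) (precomp (Q i) (d i))) \<and>
       (\<forall>i. exact_at (Hom R E (Q i)) (Hom R E (Q (i + 1))) (Hom R E (Q (i + 2)))
              (postcomp E (d i)) (postcomp E (d (i + 1)))) \<and>
       mod_iso R M (image_module (Q 0) (Q 1) (d 0)))"

definition right_add_approx ::
  "('a, 'x) ring_scheme \<Rightarrow> ('a, 'e) module \<Rightarrow>
    ('a, nat \<Rightarrow> 'k) module \<Rightarrow> ('a, nat \<Rightarrow> 'k) module \<Rightarrow> ((nat \<Rightarrow> 'k) \<Rightarrow> (nat \<Rightarrow> 'k)) \<Rightarrow> bool" where
  "right_add_approx R E Q Y f \<longleftrightarrow> in_add R E Q \<and> f \<in> linear_maps R Q Y \<and>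
     (\<forall>Q' :: ('a, nat \<Rightarrow> 'k) module. in_add R E Q' \<longrightarrow>
        postcomp Q' f ` linear_maps R Q' Q = linear_maps R Q' Y)"

definition right_minimal ::
  "('a, 'x) ring_scheme \<Rightarrow> ('a, 'm) module \<Rightarrow> ('m \<Rightarrow> 'n) \<Rightarrow> bool" where
  "right_minimal R Q f \<longleftrightarrow>
     (\<forall>h\<in>linear_maps R Q Q. compose (carrier Q) f h = f \<longrightarrow> bij_betw h (carrier Q) (carrier Q))"

definition minimal_right_add_approx ::
  "('a, 'x) ring_scheme \<Rightarrow> ('a, 'e) module \<Rightarrow>
    ('a, nat \<Rightarrow> 'k) module \<Rightarrow> ('a, nat \<Rightarrow> 'k) module \<Rightarrow> ((nat \<Rightarrow> 'k) \<Rightarrow> (nat \<Rightarrow> 'k)) \<Rightarrow> bool" where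
  "minimal_right_add_approx R E Q Y f \<longleftrightarrow> right_add_approx R E Q Y f \<and> right_minimal R Q f"

definition minimal_add_presentation ::
  "('a, 'x) ring_scheme \<Rightarrow> ('a, 'e) module \<Rightarrow>
    ('a, nat \<Rightarrow> 'k) module \<Rightarrow> ('a, nat \<Rightarrow> 'k) module \<Rightarrow> ('a, nat \<Rightarrow> 'k) module \<Rightarrow>
    ((nat \<Rightarrow> 'k) \<Rightarrow> (nat \<Rightarrow> 'k)) \<Rightarrow> ((nat \<Rightarrow> 'k) \<Rightarrow> (nat \<Rightarrow> 'k)) \<Rightarrow> bool" where
  "minimal_add_presentation R E X1 X0 M f1 f0 \<longleftrightarrow>
     f1 \<in> linear_maps R X1 X0 \<and> f0 \<in> linear_maps R X0 M \<and>
     exact_at X1 X0 M f1 f0 \<and> f0 ` carrier X0 = carrier M \<and>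
     minimal_right_add_approx R E X1 (image_module X1 X0 f1) f1 \<and>
     minimal_right_add_approx R E X0 (image_module X0 M f0) f0"

text \<open>
  Minimal presentations are unique up to isomorphism, and exist when \<open>E\<close> is a generator; hence
  the choice of the presentation is immaterial.  The same remark applies to \<open>tau_rigid\<close> below.
\<close>

definition E_rigid ::
  "('a, 'x) ring_scheme \<Rightarrow> ('a, 'e) module \<Rightarrow> ('a, nat \<Rightarrow> 'k) module \<Rightarrow> bool" where
  "E_rigid R E M \<longleftrightarrow> fg_module R M \<and>
     (\<exists>X1 X0 f1 f0. minimal_add_presentation R E X1 X0 M f1 f0 \<and>
        precomp X1 f1 ` linear_maps R X0 M = linear_maps R X1 M)"


section \<open>Gorenstein projective and \<open>\<tau>\<close>-rigid modules\<close>

definition projective :: "('a, 'x) ring_scheme \<Rightarrow> ('a, nat \<Rightarrow> 'k) module \<Rightarrow> bool" where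
  "projective R P \<longleftrightarrow> fg_module R P \<and>
     (\<forall>(Q :: ('a, nat \<Rightarrow> 'k) module) (Y :: ('a, nat \<Rightarrow> 'k) module). \<forall>g\<in>linear_maps R Q Y.
        fg_module R Q \<and> fg_module R Y \<and> g ` carrier Q = carrier Y \<longrightarrow>
        (\<forall>h\<in>linear_maps R P Y. \<exists>h'\<in>linear_maps R P Q. compose (carrier P) g h' = h))"

definition gorenstein_projective ::
  "('a, 'x) ring_scheme \<Rightarrow> ('a, nat \<Rightarrow> 'k) module \<Rightarrow> bool" where
  "gorenstein_projective A N \<longleftrightarrow> fg_module A N \<and>
    (\<exists>(P :: int \<Rightarrow> ('a, nat \<Rightarrow> 'k) module) d.
       (\<forall>i. projective A (P i) \<and> d i \<in> linear_maps A (P i) (P (i + 1))) \<and>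
       (\<forall>i. exact_at (P i) (P (i + 1)) (P (i + 2)) (d i) (d (i + 1))) \<and>
       (\<forall>i. exact_at (Hom A (P (i + 2)) (regular_module A)) (Hom A (P (i + 1)) (regular_module A))
              (Hom A (P i) (regular_module A))
              (precomp (P (i + 1)) (d (i + 1))) (precomp (P i) (d i))) \<and>
       mod_iso A N (image_module (P (-1)) (P 0) (d (-1))))"

definition projective_cover ::
  "('a, 'x) ring_scheme \<Rightarrow> ('a, nat \<Rightarrow> 'k) module \<Rightarrow> ('a, nat \<Rightarrow> 'k) module \<Rightarrow>
    ((nat \<Rightarrow> 'k) \<Rightarrow> (nat \<Rightarrow> 'k)) \<Rightarrow> bool" where
  "projective_cover R P Y f \<longleftrightarrow> projective R P \<and> f \<in> linear_maps R P Y \<and>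
     f ` carrier P = carrier Y \<and>
     (\<forall>U. submodule U R P \<and> U <+>\<^bsub>P\<^esub> a_kernel P Y f = carrier P \<longrightarrow> U = carrier P)"

definition minimal_projective_presentation ::
  "('a, 'x) ring_scheme \<Rightarrow>
    ('a, nat \<Rightarrow> 'k) module \<Rightarrow> ('a, nat \<Rightarrow> 'k) module \<Rightarrow> ('a, nat \<Rightarrow> 'k) module \<Rightarrow>
    ((nat \<Rightarrow> 'k) \<Rightarrow> (nat \<Rightarrow> 'k)) \<Rightarrow> ((nat \<Rightarrow> 'k) \<Rightarrow> (nat \<Rightarrow> 'k)) \<Rightarrow> bool" where
  "minimal_projective_presentation A P1 P0 N f1 f0 \<longleftrightarrow>
     f1 \<in> linear_maps A P1 P0 \<and> exact_at P1 P0 N f1 f0 \<and>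
     projective_cover A P1 (image_module P1 P0 f1) f1 \<and> projective_cover A P0 N f0"

text \<open>
  Right \<open>A\<close>-modules are left \<open>op_alg A\<close>-modules.  \<open>star_dual A P\<close> is the right module
  \<open>Hom\<^sub>A(P, A)\<close> with \<open>(f a)(p) = f(p) a\<close>, and \<open>K_dual K B Q\<close>, for a left
  \<open>B\<close>-module \<open>Q\<close>, is \<open>D Q = Hom\<^sub>K(Q, K)\<close> with
  the \<open>op_alg B\<close>-action \<open>(b \<phi>)(x) = \<phi>(b x)\<close>.
\<close>

definition star_dual :: "('a, 'x) ring_scheme \<Rightarrow> ('a, 'm) module \<Rightarrow> ('a, 'm \<Rightarrow> 'a) module" where
  "star_dual A P = with_smult (Hom A P (regular_module A)) (\<lambda>a f. \<lambda>p\<in>carrier P. f p \<otimes>\<^bsub>A\<^esub> a)"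

definition K_dual ::
  "('k, 'z) ring_scheme \<Rightarrow> ('k, 'b) module \<Rightarrow> ('b, 'm) module \<Rightarrow> ('b, 'm \<Rightarrow> 'k) module" where
  "K_dual K B Q = with_smult (Hom K (underlying_space B Q) (regular_module K))
     (\<lambda>b \<phi>. \<lambda>x\<in>carrier Q. \<phi> (b \<odot>\<^bsub>Q\<^esub> x))"

text \<open>
  For a minimal projective presentation \<open>P1 \<rightarrow> P0 \<rightarrow> N \<rightarrow> 0\<close> with first map \<open>f1\<close>, the transpose
  of \<open>N\<close> is the cokernel of \<open>Hom\<^sub>A(f1, A)\<close>, and \<open>\<tau> N = D Tr N\<close>.
\<close>

definition transpose_module ::
  "('k, 'a) module \<Rightarrow> ('a, 'm) module \<Rightarrow> ('a, 'n) module \<Rightarrow> ('m \<Rightarrow> 'n) \<Rightarrow>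
    ('a, ('m \<Rightarrow> 'a) set) module" where
  "transpose_module A P1 P0 f1 =
     quotient_module (op_alg A) (star_dual A P1) (precomp P1 f1 ` carrier (star_dual A P0))"

definition is_AR_translate ::
  "('k, 'z) ring_scheme \<Rightarrow> ('k, 'a) module \<Rightarrow> ('a, nat \<Rightarrow> 'k) module \<Rightarrow>
    ('a, ((nat \<Rightarrow> 'k) \<Rightarrow> 'a) set \<Rightarrow> 'k) module \<Rightarrow> bool" where
  "is_AR_translate K A N T \<longleftrightarrow>
     (\<exists>P1 P0 f1 f0. minimal_projective_presentation A P1 P0 N f1 f0 \<and>
        T = K_dual K (op_alg A) (transpose_module A P1 P0 f1))"

definition tau_rigid ::
  "('k, 'z) ring_scheme \<Rightarrow> ('k, 'a) module \<Rightarrow> ('a, nat \<Rightarrow> 'k) module \<Rightarrow> bool" where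
  "tau_rigid K A N \<longleftrightarrow> fg_module A N \<and>
     (\<exists>T. is_AR_translate K A N T \<and> carrier (Hom A N T) = {\<zero>\<^bsub>Hom A N T\<^esub>})"


section \<open>The two sets of isomorphism classes\<close>

definition EG :: "('k, 'a) module \<Rightarrow> ('a, 'e) module \<Rightarrow> ('a, nat \<Rightarrow> 'k) module set set" where
  "EG \<Lambda> E = iso_classes \<Lambda>
     {M. indecomposable \<Lambda> M \<and> E_gorenstein_projective \<Lambda> E M \<and> E_rigid \<Lambda> E M}"

definition TG :: "('k, 'z) ring_scheme \<Rightarrow> ('k, 'a) module \<Rightarrow> ('a, nat \<Rightarrow> 'k) module set set" where
  "TG K \<Gamma> = iso_classes \<Gamma>
     {N. indecomposable \<Gamma> N \<and> gorenstein_projective \<Gamma> N \<and> tau_rigid K \<Gamma> N}"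

end

theory Submission
  imports Defs "HOL-Library.Nat_Bijection"
begin

text \<open>
  The bijection is induced by the functor \<open>Hom(E, -)\<close> from \<open>\<Lambda>\<close>-modules to modules over
  \<open>\<Gamma> = End(E)\<^sup>o\<^sup>p\<close>.  As \<open>E\<close> is a generator, the identity of \<open>\<Lambda>\<close> is a finite sum of elements
  \<open>\<pi>\<^sub>j(u\<^sub>j)\<close> with maps \<open>\<pi>\<^sub>j : E \<rightarrow> \<Lambda>\<close> and \<open>u\<^sub>j \<in> E\<close>, so every \<open>x\<close> in a module is the sum of the
  \<open>\<pi>\<^sub>j(u\<^sub>j) x\<close>, that is, of values of the maps \<open>e \<mapsto> \<pi>\<^sub>j(e) x\<close> from \<open>E\<close>.  This elementary formula shows that
  the functor is fully faithful on all modules (\<open>F_faithful\<close>, \<open>F_full\<close>) and reflects exactness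
  (\<open>exact_at_reflect\<close>).  Hence it preserves and reflects isomorphisms and indecomposability.

  The functor sends \<open>E\<close> to the regular module, and it sends a summand of \<open>E\<^sup>n\<close> to a summand of \<open>\<Gamma>\<^sup>n\<close>.  Every
  finitely generated projective \<open>\<Gamma>\<close>-module arises in this way, from the idempotent matrix over \<open>\<Gamma>\<close>
  that defines it (\<open>summand_of_regular_representable\<close>).  So \<open>add E\<close> corresponds to the projective modules, and
  \<open>Hom(-, E)\<close> on \<open>add E\<close> to \<open>Hom(-, \<Gamma>)\<close> on the projectives.  A complex over \<open>add E\<close> as in the definition of \<open>E\<close>-Gorenstein
  projective modules therefore corresponds to a complex as in the definition of Gorenstein
  projective \<open>\<Gamma>\<close>-modules; in one direction, exactness of the complex of \<open>\<Lambda>\<close>-modules follows from its exactness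
  under \<open>Hom(E, -)\<close>.  In particular every Gorenstein projective \<open>\<Gamma>\<close>-module is in the image of the functor.

  Minimal \<open>add E\<close>-presentations correspond to minimal projective presentations, because on both sides
  minimality means that endomorphisms compatible with the given map are automorphisms
  (\<open>superfluous_kernel_iff_right_minimal\<close>).  It remains to see that, for a minimal projective presentation
  with first map \<open>f1 : P1 \<rightarrow> P0\<close>, the group \<open>Hom(N, \<tau> N)\<close> vanishes if and only if \<open>Hom(f1, N)\<close> is surjective
  (\<open>Hom_translate_zero_iff\<close>).  With \<open>\<tau> N = D Tr N\<close>, a map \<open>N \<rightarrow> \<tau> N\<close> is a balanced pairing of
  \<open>Hom(P1, \<Gamma>)\<close> with \<open>N\<close>, that is, a functional on \<open>Hom(P1, N)\<close>, and it has to vanish on the image of \<open>Hom(P0, N)\<close>;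
  such functionals are all zero exactly when that image is everything.

  The modules on the two sides range over fixed carrier types, in which \<open>Hom(E, W)\<close> itself does
  not live.  The functor is therefore replaced by the relation \<open>represents\<close>, which says that a \<open>\<Gamma>\<close>-module
  is isomorphic to \<open>Hom(E, W)\<close>, and the bijection of isomorphism classes is obtained from this
  relation (\<open>iso_classes_bij\<close>).
\<close>

section \<open>Modules and linear maps\<close>

lemma left_module_group: "left_module R M \<Longrightarrow> abelian_group M"
  by (auto simp: left_module_def)

lemma (in abelian_group) minus_zero_right [simp]: "\<ominus> \<zero> = \<zero>"
  by (rule minus_equality) auto

lemma (in abelian_group) minus_eq_zero_iff:
  assumes "x \<in> carrier G" "y \<in> carrier G"
  shows "x \<ominus> y = \<zero> \<longleftrightarrow> x = y"
proof
  assume "x \<ominus> y = \<zero>"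
  then have "(x \<ominus> y) \<oplus> y = y" using assms by simp
  then show "x = y" using assms by (simp add: a_minus_def a_assoc l_neg)
qed (use assms in \<open>simp add: a_minus_def r_neg\<close>)

lemma left_module_smult_zero:
  assumes "left_module R M" "a \<in> carrier R"
  shows "a \<odot>\<^bsub>M\<^esub> \<zero>\<^bsub>M\<^esub> = \<zero>\<^bsub>M\<^esub>"
proof -
  interpret M: left_module R M by fact
  have "a \<odot>\<^bsub>M\<^esub> \<zero>\<^bsub>M\<^esub> \<oplus>\<^bsub>M\<^esub> a \<odot>\<^bsub>M\<^esub> \<zero>\<^bsub>M\<^esub> = a \<odot>\<^bsub>M\<^esub> \<zero>\<^bsub>M\<^esub> \<oplus>\<^bsub>M\<^esub> \<zero>\<^bsub>M\<^esub>"
    using assms(2) M.smult_r_distr[of a "\<zero>\<^bsub>M\<^esub>" "\<zero>\<^bsub>M\<^esub>"] by (simp add: M.smult_closed)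
  then show ?thesis
    using assms(2) by (simp add: M.smult_closed)
qed

lemma left_module_zero_smult:
  assumes "left_module R M" "x \<in> carrier M"
  shows "\<zero>\<^bsub>R\<^esub> \<odot>\<^bsub>M\<^esub> x = \<zero>\<^bsub>M\<^esub>"
proof -
  interpret M: left_module R M by fact
  have "\<zero>\<^bsub>R\<^esub> \<odot>\<^bsub>M\<^esub> x \<oplus>\<^bsub>M\<^esub> \<zero>\<^bsub>R\<^esub> \<odot>\<^bsub>M\<^esub> x = \<zero>\<^bsub>R\<^esub> \<odot>\<^bsub>M\<^esub> x \<oplus>\<^bsub>M\<^esub> \<zero>\<^bsub>M\<^esub>"
    using assms(2) M.smult_l_distr[of "\<zero>\<^bsub>R\<^esub>" "\<zero>\<^bsub>R\<^esub>" x] by (simp add: M.smult_closed)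
  then show ?thesis
    using assms(2) by (simp add: M.smult_closed)
qed

lemma left_module_smult_minus:
  assumes "left_module R M" "a \<in> carrier R" "x \<in> carrier M"
  shows "a \<odot>\<^bsub>M\<^esub> (\<ominus>\<^bsub>M\<^esub> x) = \<ominus>\<^bsub>M\<^esub> (a \<odot>\<^bsub>M\<^esub> x)"
proof -
  interpret M: left_module R M by fact
  have "a \<odot>\<^bsub>M\<^esub> (\<ominus>\<^bsub>M\<^esub> x) \<oplus>\<^bsub>M\<^esub> a \<odot>\<^bsub>M\<^esub> x = \<zero>\<^bsub>M\<^esub>"
    using assms M.smult_r_distr[of a "\<ominus>\<^bsub>M\<^esub> x" x] left_module_smult_zero[of R M]
    by (simp add: M.M.l_neg)
  then show ?thesis
    using assms by (simp add: M.smult_closed M.M.minus_equality)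
qed

lemma left_moduleI:
  assumes "ring R" "abelian_group M"
    and "\<And>a x. a \<in> carrier R \<Longrightarrow> x \<in> carrier M \<Longrightarrow> a \<odot>\<^bsub>M\<^esub> x \<in> carrier M"
    and "\<And>a b x. a \<in> carrier R \<Longrightarrow> b \<in> carrier R \<Longrightarrow> x \<in> carrier M \<Longrightarrow>
        (a \<oplus>\<^bsub>R\<^esub> b) \<odot>\<^bsub>M\<^esub> x = a \<odot>\<^bsub>M\<^esub> x \<oplus>\<^bsub>M\<^esub> b \<odot>\<^bsub>M\<^esub> x"
    and "\<And>a x y. a \<in> carrier R \<Longrightarrow> x \<in> carrier M \<Longrightarrow> y \<in> carrier M \<Longrightarrow>
        a \<odot>\<^bsub>M\<^esub> (x \<oplus>\<^bsub>M\<^esub> y) = a \<odot>\<^bsub>M\<^esub> x \<oplus>\<^bsub>M\<^esub> a \<odot>\<^bsub>M\<^esub> y"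
    and "\<And>a b x. a \<in> carrier R \<Longrightarrow> b \<in> carrier R \<Longrightarrow> x \<in> carrier M \<Longrightarrow>
        (a \<otimes>\<^bsub>R\<^esub> b) \<odot>\<^bsub>M\<^esub> x = a \<odot>\<^bsub>M\<^esub> (b \<odot>\<^bsub>M\<^esub> x)"
    and "\<And>x. x \<in> carrier M \<Longrightarrow> \<one>\<^bsub>R\<^esub> \<odot>\<^bsub>M\<^esub> x = x"
  shows "left_module R M"
  using assms by (simp add: left_module_def left_module_axioms_def)

lemma with_smult_simps [simp]:
  "carrier (with_smult G s) = carrier G" "zero (with_smult G s) = zero G"
  "add (with_smult G s) = add G" "smult (with_smult G s) = s"
  by (simp_all add: with_smult_def)

lemma abelian_group_cong:
  assumes "abelian_group G" "carrier H = carrier G" "zero H = zero G" "add H = add G"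
  shows "abelian_group H"
  using abelian_groupE[OF assms(1)] by (intro abelian_groupI) (simp_all only: assms(2-4))

lemma abelian_group_with_smult: "abelian_group G \<Longrightarrow> abelian_group (with_smult G s)"
  by (rule abelian_group_cong) simp_all

lemma regular_module_simps [simp]:
  "carrier (regular_module R) = carrier R" "zero (regular_module R) = zero R"
  "add (regular_module R) = add R" "smult (regular_module R) = monoid.mult R"
  by (simp_all add: regular_module_def)

lemma left_module_regular: "ring R \<Longrightarrow> left_module R (regular_module R)"
proof -
  assume "ring R"
  then interpret ring R .
  show ?thesis
    by (rule left_moduleI)
      (auto simp: l_distr r_distr m_assoc ring_axioms
        abelian_group_with_smult[OF abelian_group_axioms] regular_module_def)
qed

lemma linear_mapsI:
  assumes "f \<in> extensional (carrier M)"
    and "\<And>x. x \<in> carrier M \<Longrightarrow> f x \<in> carrier N"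
    and "\<And>x y. x \<in> carrier M \<Longrightarrow> y \<in> carrier M \<Longrightarrow> f (x \<oplus>\<^bsub>M\<^esub> y) = f x \<oplus>\<^bsub>N\<^esub> f y"
    and "\<And>r x. r \<in> carrier R \<Longrightarrow> x \<in> carrier M \<Longrightarrow> f (r \<odot>\<^bsub>M\<^esub> x) = r \<odot>\<^bsub>N\<^esub> f x"
  shows "f \<in> linear_maps R M N"
  using assms by (auto simp: linear_maps_def PiE_def)

lemma linear_maps_restrictI:
  assumes "left_module R M"
    and "\<And>x. x \<in> carrier M \<Longrightarrow> f x \<in> carrier N"
    and "\<And>x y. x \<in> carrier M \<Longrightarrow> y \<in> carrier M \<Longrightarrow> f (x \<oplus>\<^bsub>M\<^esub> y) = f x \<oplus>\<^bsub>N\<^esub> f y"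
    and "\<And>r x. r \<in> carrier R \<Longrightarrow> x \<in> carrier M \<Longrightarrow> f (r \<odot>\<^bsub>M\<^esub> x) = r \<odot>\<^bsub>N\<^esub> f x"
  shows "(\<lambda>x\<in>carrier M. f x) \<in> linear_maps R M N"
proof -
  interpret M: left_module R M by fact
  show ?thesis
    using assms by (intro linear_mapsI) (auto simp: M.smult_closed)
qed

lemma linear_maps_extensional: "f \<in> linear_maps R M N \<Longrightarrow> f \<in> extensional (carrier M)"
  and linear_maps_closed: "f \<in> linear_maps R M N \<Longrightarrow> x \<in> carrier M \<Longrightarrow> f x \<in> carrier N"
  and linear_maps_add: "f \<in> linear_maps R M N \<Longrightarrow> x \<in> carrier M \<Longrightarrow> y \<in> carrier M \<Longrightarrow>
    f (x \<oplus>\<^bsub>M\<^esub> y) = f x \<oplus>\<^bsub>N\<^esub> f y"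
  and linear_maps_smult: "f \<in> linear_maps R M N \<Longrightarrow> r \<in> carrier R \<Longrightarrow> x \<in> carrier M \<Longrightarrow>
    f (r \<odot>\<^bsub>M\<^esub> x) = r \<odot>\<^bsub>N\<^esub> f x"
  by (auto simp: linear_maps_def PiE_iff)

lemma linear_maps_ext:
  assumes "f \<in> linear_maps R M N" "g \<in> linear_maps R M N'"
    and "\<And>x. x \<in> carrier M \<Longrightarrow> f x = g x"
  shows "f = g"
  using assms by (metis extensionalityI linear_maps_extensional)

text \<open>
  Stated for additive maps rather than linear ones, so that it also covers evaluation at a point,
  multiplication by a fixed element, and the bilinear pairings used for the translate.
\<close>

lemma additive_finsum:
  assumes "abelian_group G" "abelian_group H"
    and "\<And>x. x \<in> carrier G \<Longrightarrow> f x \<in> carrier H"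
    and "\<And>x y. x \<in> carrier G \<Longrightarrow> y \<in> carrier G \<Longrightarrow> f (x \<oplus>\<^bsub>G\<^esub> y) = f x \<oplus>\<^bsub>H\<^esub> f y"
    and "s \<in> A \<rightarrow> carrier G"
  shows "f (finsum G s A) = finsum H (\<lambda>i. f (s i)) A"
proof -
  interpret G: abelian_group G by fact
  interpret H: abelian_group H by fact
  interpret abelian_group_hom G H f
    by (intro abelian_group_homI group_hom.intro group_hom_axioms.intro homI)
      (auto simp: assms G.a_group H.a_group G.abelian_group_axioms H.abelian_group_axioms)
  show ?thesis using assms(5)
  proof (induction A rule: infinite_finite_induct)
    case (insert i A)
    have "(\<lambda>i. f (s i)) \<in> A \<rightarrow> carrier H" "f (s i) \<in> carrier H"
      using insert.prems assms(3) by (auto simp: Pi_iff)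
    with insert show ?case by (simp add: Pi_iff)
  qed auto
qed

lemma linear_maps_zero:
  assumes "abelian_group M" "abelian_group N" "f \<in> linear_maps R M N"
  shows "f \<zero>\<^bsub>M\<^esub> = \<zero>\<^bsub>N\<^esub>"
proof -
  interpret M: abelian_group M by fact
  interpret N: abelian_group N by fact
  have "f \<zero>\<^bsub>M\<^esub> \<oplus>\<^bsub>N\<^esub> f \<zero>\<^bsub>M\<^esub> = f \<zero>\<^bsub>M\<^esub> \<oplus>\<^bsub>N\<^esub> \<zero>\<^bsub>N\<^esub>"
    using linear_maps_add[OF assms(3), of "\<zero>\<^bsub>M\<^esub>" "\<zero>\<^bsub>M\<^esub>"] by (simp add: linear_maps_closed[OF assms(3)])
  then show ?thesis by (simp add: linear_maps_closed[OF assms(3)])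
qed

lemma linear_maps_finsum:
  assumes "f \<in> linear_maps R M N" "abelian_group M" "abelian_group N" "s \<in> A \<rightarrow> carrier M"
  shows "f (finsum M s A) = finsum N (\<lambda>i. f (s i)) A"
  by (rule additive_finsum)
    (auto simp: assms linear_maps_closed[OF assms(1)] linear_maps_add[OF assms(1)] intro: assms(4)[THEN funcset_mem])

lemma linear_maps_minus:
  assumes "abelian_group M" "abelian_group N" "f \<in> linear_maps R M N" "x \<in> carrier M"
  shows "f (\<ominus>\<^bsub>M\<^esub> x) = \<ominus>\<^bsub>N\<^esub> f x"
proof -
  interpret M: abelian_group M by fact
  interpret N: abelian_group N by fact
  have "f (\<ominus>\<^bsub>M\<^esub> x) \<oplus>\<^bsub>N\<^esub> f x = \<zero>\<^bsub>N\<^esub>"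
    using linear_maps_add[OF assms(3), of "\<ominus>\<^bsub>M\<^esub> x" x] assms(4) linear_maps_zero[OF assms(1-3)]
    by (simp add: M.l_neg)
  then show ?thesis
    using assms(4) by (simp add: N.minus_equality linear_maps_closed[OF assms(3)])
qed

lemma linear_maps_compose:
  assumes "left_module R L" "f \<in> linear_maps R L M" "g \<in> linear_maps R M N"
  shows "compose (carrier L) g f \<in> linear_maps R L N"
  unfolding compose_def
  by (rule linear_maps_restrictI)
    (auto simp: assms linear_maps_closed[OF assms(2)] linear_maps_closed[OF assms(3)]
      linear_maps_add[OF assms(2)] linear_maps_add[OF assms(3)]
      linear_maps_smult[OF assms(2)] linear_maps_smult[OF assms(3)])

lemma linear_maps_id:
  assumes "left_module R M"
  shows "(\<lambda>x\<in>carrier M. x) \<in> linear_maps R M M"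
  by (rule linear_maps_restrictI[OF assms]) auto

lemma linear_maps_const_zero:
  assumes "left_module R M" "left_module R N"
  shows "(\<lambda>x\<in>carrier M. \<zero>\<^bsub>N\<^esub>) \<in> linear_maps R M N"
proof -
  interpret N: left_module R N by fact
  show ?thesis
    by (rule linear_maps_restrictI[OF assms(1)]) (auto simp: left_module_smult_zero[OF assms(2)])
qed

lemma linear_maps_inverse:
  assumes "left_module R M" "left_module R N" "f \<in> linear_maps R M N"
    and "bij_betw f (carrier M) (carrier N)"
  shows "(\<lambda>y\<in>carrier N. inv_into (carrier M) f y) \<in> linear_maps R N M"
proof -
  interpret M: left_module R M by fact
  interpret N: left_module R N by fact
  let ?i = "inv_into (carrier M) f"
  have i: "?i y \<in> carrier M" "f (?i y) = y" if "y \<in> carrier N" for y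
    using assms(4) that by (auto simp: bij_betw_def f_inv_into_f inv_into_into)
  have fi: "?i (f x) = x" if "x \<in> carrier M" for x
    using assms(4) that by (simp add: bij_betw_def)
  show ?thesis
  proof (rule linear_maps_restrictI[OF assms(2)])
    fix x y assume "x \<in> carrier N" "y \<in> carrier N"
    then show "?i (x \<oplus>\<^bsub>N\<^esub> y) = ?i x \<oplus>\<^bsub>M\<^esub> ?i y"
      using fi[of "?i x \<oplus>\<^bsub>M\<^esub> ?i y"] by (simp add: i linear_maps_add[OF assms(3)])
  next
    fix r x assume "r \<in> carrier R" "x \<in> carrier N"
    then show "?i (r \<odot>\<^bsub>N\<^esub> x) = r \<odot>\<^bsub>M\<^esub> ?i x"
      using fi[of "r \<odot>\<^bsub>M\<^esub> ?i x"] by (simp add: i linear_maps_smult[OF assms(3)] M.smult_closed)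
  qed (use i in auto)
qed

lemma mod_iso_refl: "left_module R M \<Longrightarrow> mod_iso R M M"
  unfolding mod_iso_def by (rule bexI[OF _ linear_maps_id]) (auto simp: bij_betw_def inj_on_def)

lemma mod_iso_sym:
  assumes "left_module R M" "left_module R N" "mod_iso R M N"
  shows "mod_iso R N M"
proof -
  obtain f where f: "f \<in> linear_maps R M N" "bij_betw f (carrier M) (carrier N)"
    using assms(3) by (auto simp: mod_iso_def)
  have "bij_betw (\<lambda>y\<in>carrier N. inv_into (carrier M) f y) (carrier N) (carrier M)"
    using bij_betw_inv_into[OF f(2)] by (simp cong: bij_betw_cong)
  then show ?thesis
    using linear_maps_inverse[OF assms(1,2) f] unfolding mod_iso_def by blast
qed

lemma bij_betw_compose:
  assumes "bij_betw f A B" "bij_betw g B C"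
  shows "bij_betw (compose A g f) A C"
  using bij_betw_trans[OF assms] by (auto simp: compose_def cong: bij_betw_cong)

lemma mod_iso_trans:
  assumes "left_module R L" "mod_iso R L M" "mod_iso R M N"
  shows "mod_iso R L N"
  using assms by (meson linear_maps_compose bij_betw_compose mod_iso_def)

lemma bij_iff_inverse:
  assumes "left_module R M" "left_module R N" "f \<in> linear_maps R M N"
  shows "bij_betw f (carrier M) (carrier N) \<longleftrightarrow>
    (\<exists>g\<in>linear_maps R N M. compose (carrier M) g f = (\<lambda>x\<in>carrier M. x) \<and>
       compose (carrier N) f g = (\<lambda>y\<in>carrier N. y))"
proof
  assume f: "bij_betw f (carrier M) (carrier N)"
  then show "\<exists>g\<in>linear_maps R N M. compose (carrier M) g f = (\<lambda>x\<in>carrier M. x) \<and>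
       compose (carrier N) f g = (\<lambda>y\<in>carrier N. y)"
    by (intro bexI[OF _ linear_maps_inverse[OF assms f]])
      (auto simp: compose_def bij_betw_inv_into_left[OF f] bij_betw_inv_into_right[OF f]
        linear_maps_closed[OF assms(3)] intro!: restrict_ext)
next
  assume "\<exists>g\<in>linear_maps R N M. compose (carrier M) g f = (\<lambda>x\<in>carrier M. x) \<and>
       compose (carrier N) f g = (\<lambda>y\<in>carrier N. y)"
  then obtain g where g: "g \<in> linear_maps R N M" "compose (carrier M) g f = (\<lambda>x\<in>carrier M. x)"
    "compose (carrier N) f g = (\<lambda>y\<in>carrier N. y)" by blast
  have "g (f x) = x" if "x \<in> carrier M" for x using fun_cong[OF g(2), of x] that by (simp add: compose_eq)
  moreover have "f (g y) = y" if "y \<in> carrier N" for y using fun_cong[OF g(3), of y] that by (simp add: compose_eq)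
  ultimately show "bij_betw f (carrier M) (carrier N)"
    using linear_maps_closed[OF assms(3)] linear_maps_closed[OF g(1)]
    by (intro bij_betw_byWitness[of _ g]) auto
qed

lemma Hom_simps [simp]:
  "carrier (Hom R M N) = linear_maps R M N"
  "\<zero>\<^bsub>Hom R M N\<^esub> = (\<lambda>x\<in>carrier M. \<zero>\<^bsub>N\<^esub>)"
  "f \<oplus>\<^bsub>Hom R M N\<^esub> g = (\<lambda>x\<in>carrier M. f x \<oplus>\<^bsub>N\<^esub> g x)"
  by (simp_all add: Hom_def)

lemma left_module_Hom:
  assumes "left_module R M" "left_module R N"
  shows "abelian_group (Hom R M N)"
proof -
  interpret M: left_module R M by fact
  interpret N: left_module R N by fact
  note c = linear_maps_closed linear_maps_add linear_maps_smult linear_maps_extensional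
  show ?thesis
  proof (rule abelian_groupI)
    fix f g assume fg: "f \<in> carrier (Hom R M N)" "g \<in> carrier (Hom R M N)"
    show "f \<oplus>\<^bsub>Hom R M N\<^esub> g \<in> carrier (Hom R M N)"
      using fg unfolding Hom_def
      by (simp, intro linear_maps_restrictI[OF assms(1)])
        (auto simp: c[where M=M and N=N and R=R] N.M.a_ac N.smult_r_distr)
    show "f \<oplus>\<^bsub>Hom R M N\<^esub> g = g \<oplus>\<^bsub>Hom R M N\<^esub> f"
      using fg by (auto simp: Hom_def c intro!: restrict_ext N.M.a_comm)
  next
    fix f g h assume fg: "f \<in> carrier (Hom R M N)" "g \<in> carrier (Hom R M N)" "h \<in> carrier (Hom R M N)"
    then show "f \<oplus>\<^bsub>Hom R M N\<^esub> g \<oplus>\<^bsub>Hom R M N\<^esub> h = f \<oplus>\<^bsub>Hom R M N\<^esub> (g \<oplus>\<^bsub>Hom R M N\<^esub> h)"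
      by (auto simp: Hom_def c intro!: restrict_ext N.M.a_assoc)
  next
    show "\<zero>\<^bsub>Hom R M N\<^esub> \<in> carrier (Hom R M N)"
      using linear_maps_const_zero[OF assms] by (simp add: Hom_def)
  next
    fix f assume f: "f \<in> carrier (Hom R M N)"
    then show "\<zero>\<^bsub>Hom R M N\<^esub> \<oplus>\<^bsub>Hom R M N\<^esub> f = f"
      by (auto simp: Hom_def c intro!: extensionalityI[OF restrict_extensional])
    have "(\<lambda>x\<in>carrier M. \<ominus>\<^bsub>N\<^esub> f x) \<in> linear_maps R M N"
      using f unfolding Hom_def
      by (intro linear_maps_restrictI[OF assms(1)])
        (auto simp: c[where M=M and N=N and R=R] N.M.minus_add left_module_smult_minus[OF assms(2)])
    then show "\<exists>g\<in>carrier (Hom R M N). g \<oplus>\<^bsub>Hom R M N\<^esub> f = \<zero>\<^bsub>Hom R M N\<^esub>"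
      using f by (intro bexI[of _ "\<lambda>x\<in>carrier M. \<ominus>\<^bsub>N\<^esub> f x"])
        (auto simp: Hom_def c N.M.l_neg intro!: restrict_ext)
  qed
qed

lemma Hom_finsum_apply:
  assumes "left_module R M" "left_module R N" "s \<in> A \<rightarrow> linear_maps R M N" "x \<in> carrier M"
  shows "finsum (Hom R M N) s A x = (\<Oplus>\<^bsub>N\<^esub>i\<in>A. s i x)"
  by (rule additive_finsum[where f = "\<lambda>f. f x"])
    (use assms in \<open>auto simp: left_module_Hom left_module_group linear_maps_closed\<close>)

section \<open>Submodules, images and finite generation\<close>

text \<open>Closure under negation is automatic, as \<open>-x = (-1) x\<close>.\<close>

lemma submoduleI_left:
  assumes "left_module R M" "H \<subseteq> carrier M" "\<zero>\<^bsub>M\<^esub> \<in> H"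
    and "\<And>x y. x \<in> H \<Longrightarrow> y \<in> H \<Longrightarrow> x \<oplus>\<^bsub>M\<^esub> y \<in> H"
    and "\<And>a x. a \<in> carrier R \<Longrightarrow> x \<in> H \<Longrightarrow> a \<odot>\<^bsub>M\<^esub> x \<in> H"
  shows "submodule H R M"
proof -
  interpret M: left_module R M by fact
  have "\<ominus>\<^bsub>M\<^esub> x \<in> H" if "x \<in> H" for x
  proof -
    have x: "x \<in> carrier M" using that assms(2) by auto
    have "(\<ominus>\<^bsub>R\<^esub> \<one>\<^bsub>R\<^esub>) \<odot>\<^bsub>M\<^esub> x \<oplus>\<^bsub>M\<^esub> x = \<zero>\<^bsub>M\<^esub>"
      using M.smult_l_distr[of "\<ominus>\<^bsub>R\<^esub> \<one>\<^bsub>R\<^esub>" "\<one>\<^bsub>R\<^esub>" x] x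
      by (simp add: M.smult_one M.R.l_neg left_module_zero_smult[OF assms(1)])
    then have "(\<ominus>\<^bsub>R\<^esub> \<one>\<^bsub>R\<^esub>) \<odot>\<^bsub>M\<^esub> x = \<ominus>\<^bsub>M\<^esub> x"
      using x by (simp add: M.smult_closed M.M.minus_equality)
    then show ?thesis using assms(5)[of "\<ominus>\<^bsub>R\<^esub> \<one>\<^bsub>R\<^esub>" x] that by simp
  qed
  then show ?thesis
    using assms by (intro submodule.intro subgroup.intro) (auto simp: submodule_axioms_def a_inv_def)
qed

lemma submodule_subset: "submodule H R M \<Longrightarrow> H \<subseteq> carrier M"
  and submodule_zero: "submodule H R M \<Longrightarrow> \<zero>\<^bsub>M\<^esub> \<in> H"
  and submodule_add: "submodule H R M \<Longrightarrow> x \<in> H \<Longrightarrow> y \<in> H \<Longrightarrow> x \<oplus>\<^bsub>M\<^esub> y \<in> H"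
  and submodule_minus: "submodule H R M \<Longrightarrow> x \<in> H \<Longrightarrow> \<ominus>\<^bsub>M\<^esub> x \<in> H"
  and submodule_smult: "submodule H R M \<Longrightarrow> a \<in> carrier R \<Longrightarrow> x \<in> H \<Longrightarrow> a \<odot>\<^bsub>M\<^esub> x \<in> H"
  unfolding submodule_def submodule_axioms_def
  using subgroup.subset subgroup.one_closed subgroup.m_closed subgroup.m_inv_closed
  by (auto simp: a_inv_def) fastforce+

lemma submodule_finsum:
  assumes "left_module R M" "submodule H R M" "s \<in> A \<rightarrow> H"
  shows "finsum M s A \<in> H"
proof -
  interpret M: left_module R M by fact
  show ?thesis using assms(3)
  proof (induction A rule: infinite_finite_induct)
    case (insert i A)
    then have "s \<in> A \<rightarrow> carrier M" "s i \<in> carrier M" "s i \<in> H" "finsum M s A \<in> H"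
      using submodule_subset[OF assms(2)] by auto
    then show ?case using insert submodule_add[OF assms(2)] by simp
  qed (auto simp: submodule_zero[OF assms(2)])
qed

lemma left_module_submodule:
  assumes "left_module R M" "submodule H R M"
  shows "left_module R (M\<lparr>carrier := H\<rparr>)"
proof -
  interpret M: left_module R M by fact
  note s = subsetD[OF submodule_subset[OF assms(2)]]
  show ?thesis
  proof (rule left_moduleI)
    show "abelian_group (M\<lparr>carrier := H\<rparr>)"
    proof (rule abelian_groupI, goal_cases)
      case (6 x)
      then show ?case using s submodule_minus[OF assms(2)] by (auto intro!: bexI[of _ "\<ominus>\<^bsub>M\<^esub> x"] simp: M.M.l_neg)
    qed (auto simp: s submodule_zero[OF assms(2)] submodule_add[OF assms(2)] M.M.a_ac)
  qed (auto simp: s submodule_smult[OF assms(2)] M.R.ring_axioms M.smult_l_distr M.smult_r_distr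
      M.smult_assoc1 M.smult_one)
qed

lemma submodule_vimage:
  assumes "left_module R M" "left_module R N" "f \<in> linear_maps R M N" "submodule H R N"
  shows "submodule {x \<in> carrier M. f x \<in> H} R M"
proof -
  interpret M: left_module R M by fact
  show ?thesis
    by (rule submoduleI_left[OF assms(1)])
      (auto simp: linear_maps_add[OF assms(3)] linear_maps_smult[OF assms(3)] M.smult_closed
        linear_maps_zero[OF left_module_group left_module_group, OF assms(1-3)]
        submodule_zero[OF assms(4)] submodule_add[OF assms(4)] submodule_smult[OF assms(4)])
qed

lemma submodule_image:
  assumes "left_module R M" "left_module R N" "f \<in> linear_maps R M N"
  shows "submodule (f ` carrier M) R N"
proof -
  interpret M: left_module R M by fact
  show ?thesis
  proof (rule submoduleI_left[OF assms(2)])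
    show "\<zero>\<^bsub>N\<^esub> \<in> f ` carrier M"
      using linear_maps_zero[OF left_module_group left_module_group, OF assms(1-3)]
      by (metis M.M.zero_closed image_eqI)
  next
    fix x y assume "x \<in> f ` carrier M" "y \<in> f ` carrier M"
    then obtain a b where "x = f a" "y = f b" "a \<in> carrier M" "b \<in> carrier M" by auto
    then show "x \<oplus>\<^bsub>N\<^esub> y \<in> f ` carrier M"
      by (auto intro!: image_eqI[of _ _ "a \<oplus>\<^bsub>M\<^esub> b"] simp: linear_maps_add[OF assms(3)])
  next
    fix r x assume "r \<in> carrier R" "x \<in> f ` carrier M"
    then show "r \<odot>\<^bsub>N\<^esub> x \<in> f ` carrier M"
      by (auto simp: linear_maps_smult[OF assms(3), symmetric] M.smult_closed)
  qed (auto simp: linear_maps_closed[OF assms(3)])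
qed

lemma submodule_trivial:
  assumes "left_module R M" shows "submodule {\<zero>\<^bsub>M\<^esub>} R M"
proof -
  interpret M: left_module R M by fact
  show ?thesis by (rule submoduleI_left[OF assms]) (auto simp: left_module_smult_zero[OF assms])
qed

lemma submodule_kernel:
  assumes "left_module R M" "left_module R N" "f \<in> linear_maps R M N"
  shows "submodule (a_kernel M N f) R M"
  using submodule_vimage[OF assms submodule_trivial[OF assms(2)]] by (simp add: a_kernel_def')

lemma left_module_image:
  assumes "left_module R M" "left_module R N" "f \<in> linear_maps R M N"
  shows "left_module R (image_module M N f)"
  unfolding image_module_def using left_module_submodule[OF assms(2) submodule_image[OF assms]] .

lemma linear_maps_image_module:
  "f \<in> linear_maps R M N \<Longrightarrow> f \<in> linear_maps R M (image_module M N f)"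
  by (auto simp: linear_maps_def image_module_def)

lemma linear_maps_enlarge:
  "f \<in> linear_maps R M (N\<lparr>carrier := H\<rparr>) \<Longrightarrow> H \<subseteq> carrier N \<Longrightarrow> f \<in> linear_maps R M N"
  by (auto simp: linear_maps_def)

lemma linear_maps_shrink:
  "f \<in> linear_maps R M N \<Longrightarrow> f ` carrier M \<subseteq> H \<Longrightarrow> f \<in> linear_maps R M (N\<lparr>carrier := H\<rparr>)"
  by (auto simp: linear_maps_def)

text \<open>
  Finite generation is expressed through submodules that contain the generators; the preimage of
  such a submodule of \<open>N\<close> contains the generators of \<open>M\<close>, hence is everything.
\<close>

lemma finitely_generated_image:
  assumes "left_module R M" "left_module R N" "f \<in> linear_maps R M N" "f ` carrier M = carrier N"
    and "finitely_generated R M"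
  shows "finitely_generated R N"
proof -
  obtain S where S: "finite S" "S \<subseteq> carrier M" "\<And>H. submodule H R M \<Longrightarrow> S \<subseteq> H \<Longrightarrow> H = carrier M"
    using assms(5) by (auto simp: finitely_generated_def)
  show ?thesis unfolding finitely_generated_def
  proof (intro exI[of _ "f ` S"] conjI allI impI)
    fix H assume H: "submodule H R N \<and> f ` S \<subseteq> H"
    then have "{x \<in> carrier M. f x \<in> H} = carrier M"
      using S by (intro S(3) submodule_vimage[OF assms(1-3)]) auto
    then show "H = carrier N"
      using H submodule_subset[of H R N] assms(4)[symmetric] by auto
  qed (use S assms(4) in auto)
qed

lemma fg_module_image:
  assumes "fg_module R M" "left_module R N" "f \<in> linear_maps R M N"
  shows "fg_module R (image_module M N f)"
  using assms left_module_image[of R M N f]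
    finitely_generated_image[OF _ left_module_image linear_maps_image_module]
  by (auto simp: fg_module_def image_module_def)

lemma fg_module_iso:
  assumes "fg_module R M" "left_module R N" "mod_iso R M N"
  shows "fg_module R N"
  using assms finitely_generated_image[of R M N] by (auto simp: fg_module_def mod_iso_def bij_betw_def)

text \<open>
  The linear combinations of the generators form a submodule containing them.  The coefficient
  tuples are extensional, so that the carrier of \<open>M\<close> is the image of a set of tuples over \<open>R\<close> that
  embeds into a type of functions as soon as the carrier of \<open>R\<close> does.
\<close>

lemma finitely_generated_span:
  assumes "left_module R M" "finitely_generated R M"
  obtains n :: nat and g where "g \<in> {..<n} \<rightarrow> carrier M"
    "\<And>x. x \<in> carrier M \<Longrightarrow> \<exists>c\<in>{..<n} \<rightarrow>\<^sub>E carrier R. x = (\<Oplus>\<^bsub>M\<^esub>i\<in>{..<n}. c i \<odot>\<^bsub>M\<^esub> g i)"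
proof -
  interpret M: left_module R M by fact
  obtain S where S: "finite S" "S \<subseteq> carrier M" "\<And>H. submodule H R M \<Longrightarrow> S \<subseteq> H \<Longrightarrow> H = carrier M"
    using assms(2) by (auto simp: finitely_generated_def)
  from S(1) obtain n and g :: "nat \<Rightarrow> _" where g: "S = g ` {i. i < n}"
    using finite_imp_nat_seg_image_inj_on by blast
  then have gc: "\<And>i. i < n \<Longrightarrow> g i \<in> carrier M" using S(2) by auto
  let ?H = "{\<Oplus>\<^bsub>M\<^esub>i\<in>{..<n}. c i \<odot>\<^bsub>M\<^esub> g i | c. c \<in> {..<n} \<rightarrow> carrier R}"
  have t: "(\<lambda>i. c i \<odot>\<^bsub>M\<^esub> g i) \<in> {..<n} \<rightarrow> carrier M" if "c \<in> {..<n} \<rightarrow> carrier R" for c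
    using that by (auto intro!: M.smult_closed gc)
  have "submodule ?H R M"
  proof (rule submoduleI_left[OF assms(1)])
    show "?H \<subseteq> carrier M" using t by auto
    have "\<zero>\<^bsub>M\<^esub> = (\<Oplus>\<^bsub>M\<^esub>i\<in>{..<n}. \<zero>\<^bsub>R\<^esub> \<odot>\<^bsub>M\<^esub> g i)"
      by (subst M.M.finsum_zero[of "{..<n}", symmetric])
        (intro M.M.finsum_cong', auto simp: gc left_module_zero_smult[OF assms(1)])
    then show "\<zero>\<^bsub>M\<^esub> \<in> ?H" by (intro CollectI exI[of _ "\<lambda>_. \<zero>\<^bsub>R\<^esub>"]) auto
  next
    fix x y assume "x \<in> ?H" "y \<in> ?H"
    then obtain c d where c: "c \<in> {..<n} \<rightarrow> carrier R" "x = (\<Oplus>\<^bsub>M\<^esub>i\<in>{..<n}. c i \<odot>\<^bsub>M\<^esub> g i)"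
      and d: "d \<in> {..<n} \<rightarrow> carrier R" "y = (\<Oplus>\<^bsub>M\<^esub>i\<in>{..<n}. d i \<odot>\<^bsub>M\<^esub> g i)" by blast
    have "x \<oplus>\<^bsub>M\<^esub> y = (\<Oplus>\<^bsub>M\<^esub>i\<in>{..<n}. c i \<odot>\<^bsub>M\<^esub> g i \<oplus>\<^bsub>M\<^esub> d i \<odot>\<^bsub>M\<^esub> g i)"
      using t[OF c(1)] t[OF d(1)] c(2) d(2) by (simp add: M.M.finsum_addf)
    also have "\<dots> = (\<Oplus>\<^bsub>M\<^esub>i\<in>{..<n}. (c i \<oplus>\<^bsub>R\<^esub> d i) \<odot>\<^bsub>M\<^esub> g i)"
      using c(1) d(1) gc by (intro M.M.finsum_cong') (auto simp: M.smult_l_distr Pi_iff intro!: M.smult_closed)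
    finally show "x \<oplus>\<^bsub>M\<^esub> y \<in> ?H"
      using c d by (auto intro!: exI[of _ "\<lambda>i. c i \<oplus>\<^bsub>R\<^esub> d i"])
  next
    fix a x assume a: "a \<in> carrier R" and "x \<in> ?H"
    then obtain c where c: "c \<in> {..<n} \<rightarrow> carrier R" "x = (\<Oplus>\<^bsub>M\<^esub>i\<in>{..<n}. c i \<odot>\<^bsub>M\<^esub> g i)" by blast
    have "a \<odot>\<^bsub>M\<^esub> x = (\<Oplus>\<^bsub>M\<^esub>i\<in>{..<n}. a \<odot>\<^bsub>M\<^esub> (c i \<odot>\<^bsub>M\<^esub> g i))"
      unfolding c(2) using a t[OF c(1)]
      by (intro additive_finsum[where f = "\<lambda>x. a \<odot>\<^bsub>M\<^esub> x"])
        (auto intro: M.smult_closed M.smult_r_distr M.M.abelian_group_axioms)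
    also have "\<dots> = (\<Oplus>\<^bsub>M\<^esub>i\<in>{..<n}. (a \<otimes>\<^bsub>R\<^esub> c i) \<odot>\<^bsub>M\<^esub> g i)"
      using c(1) a gc by (intro M.M.finsum_cong') (auto simp: M.smult_assoc1 Pi_iff intro!: M.smult_closed)
    finally show "a \<odot>\<^bsub>M\<^esub> x \<in> ?H"
      using a c by (auto intro!: exI[of _ "\<lambda>i. a \<otimes>\<^bsub>R\<^esub> c i"])
  qed
  moreover have "S \<subseteq> ?H"
  proof
    fix x assume "x \<in> S"
    then obtain k where k: "k < n" "x = g k" using g by auto
    have "(\<Oplus>\<^bsub>M\<^esub>i\<in>{..<n}. (if k = i then \<one>\<^bsub>R\<^esub> else \<zero>\<^bsub>R\<^esub>) \<odot>\<^bsub>M\<^esub> g i)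
        = (\<Oplus>\<^bsub>M\<^esub>i\<in>{..<n}. if k = i then g i else \<zero>\<^bsub>M\<^esub>)"
      by (intro M.M.finsum_cong') (auto simp: gc M.smult_one left_module_zero_smult[OF assms(1)])
    also have "\<dots> = g k" using k gc by (intro M.M.finsum_singleton) auto
    finally show "x \<in> ?H" using k
      by (auto intro!: exI[of _ "\<lambda>i. if k = i then \<one>\<^bsub>R\<^esub> else \<zero>\<^bsub>R\<^esub>"])
  qed
  ultimately have H: "?H = carrier M" by (rule S(3))
  show ?thesis
  proof (rule that[of g n])
    fix x assume "x \<in> carrier M"
    then obtain c where c: "c \<in> {..<n} \<rightarrow> carrier R" "x = (\<Oplus>\<^bsub>M\<^esub>i\<in>{..<n}. c i \<odot>\<^bsub>M\<^esub> g i)"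
      using H by blast
    have "x = (\<Oplus>\<^bsub>M\<^esub>i\<in>{..<n}. restrict c {..<n} i \<odot>\<^bsub>M\<^esub> g i)"
      unfolding c(2) using t[OF c(1)] by (intro M.M.finsum_cong') (auto simp: Pi_iff)
    then show "\<exists>c\<in>{..<n} \<rightarrow>\<^sub>E carrier R. x = (\<Oplus>\<^bsub>M\<^esub>i\<in>{..<n}. c i \<odot>\<^bsub>M\<^esub> g i)"
      using c(1) by (intro bexI[of _ "restrict c {..<n}"]) auto
  qed (use gc in auto)
qed

section \<open>Transport of modules to another type\<close>

text \<open>
  Modules range over a fixed carrier type.  A module whose carrier injects into that type can be
  replaced by an isomorphic copy living there; the second argument names the type.
\<close>

definition embeddable :: "'m set \<Rightarrow> 'n itself \<Rightarrow> bool" where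
  "embeddable S _ \<longleftrightarrow> (\<exists>\<iota> :: 'm \<Rightarrow> 'n. inj_on \<iota> S)"

lemma transport_module:
  fixes M :: "('a, 'm) module"
  assumes "left_module R M" "embeddable (carrier M) TYPE('n)"
  obtains N :: "('a, 'n) module" and \<eta>
  where "left_module R N" "\<eta> \<in> linear_maps R M N" "bij_betw \<eta> (carrier M) (carrier N)"
proof -
  interpret M: left_module R M by fact
  obtain \<iota> :: "'m \<Rightarrow> 'n" where \<iota>: "inj_on \<iota> (carrier M)"
    using assms(2) by (auto simp: embeddable_def)
  define \<kappa> where "\<kappa> = inv_into (carrier M) \<iota>"
  have \<kappa>: "\<kappa> (\<iota> x) = x" if "x \<in> carrier M" for x
    using that \<iota> by (simp add: \<kappa>_def)
  define N :: "('a, 'n) module" where "N = \<lparr>carrier = \<iota> ` carrier M, monoid.mult = undefined, one = undefined,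
    zero = \<iota> \<zero>\<^bsub>M\<^esub>, add = \<lambda>x y. \<iota> (\<kappa> x \<oplus>\<^bsub>M\<^esub> \<kappa> y), smult = \<lambda>r x. \<iota> (r \<odot>\<^bsub>M\<^esub> \<kappa> x)\<rparr>"
  have N: "carrier N = \<iota> ` carrier M" "\<zero>\<^bsub>N\<^esub> = \<iota> \<zero>\<^bsub>M\<^esub>" "\<And>x y. x \<oplus>\<^bsub>N\<^esub> y = \<iota> (\<kappa> x \<oplus>\<^bsub>M\<^esub> \<kappa> y)"
    "\<And>r x. r \<odot>\<^bsub>N\<^esub> x = \<iota> (r \<odot>\<^bsub>M\<^esub> \<kappa> x)"
    by (simp_all add: N_def)
  have "left_module R N"
  proof (rule left_moduleI)
    show "abelian_group N"
    proof (rule abelian_groupI)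
      fix x assume "x \<in> carrier N"
      then show "\<exists>y\<in>carrier N. y \<oplus>\<^bsub>N\<^esub> x = \<zero>\<^bsub>N\<^esub>"
        by (intro bexI[of _ "\<iota> (\<ominus>\<^bsub>M\<^esub> \<kappa> x)"]) (auto simp: N \<kappa> M.M.l_neg)
    qed (auto simp: N \<kappa> M.M.a_ac)
  qed (auto simp: N \<kappa> M.R.ring_axioms M.smult_l_distr M.smult_r_distr M.smult_assoc1 M.smult_one
      M.smult_closed)
  moreover have "(\<lambda>x\<in>carrier M. \<iota> x) \<in> linear_maps R M N"
    by (rule linear_maps_restrictI[OF assms(1)]) (auto simp: N \<kappa> M.smult_closed)
  moreover have "bij_betw (\<lambda>x\<in>carrier M. \<iota> x) (carrier M) (carrier N)"
    using \<iota> by (auto simp: bij_betw_def inj_on_def N)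
  ultimately show ?thesis by (rule that)
qed

lemma embeddable_surj:
  assumes "embeddable S TYPE('n)" "T \<subseteq> f ` S"
  shows "embeddable T TYPE('n)"
proof -
  obtain \<iota> :: "_ \<Rightarrow> 'n" where \<iota>: "inj_on \<iota> S" using assms by (auto simp: embeddable_def)
  have i: "inv_into S f y \<in> S" "f (inv_into S f y) = y" if "y \<in> T" for y
    using assms(2) that by (auto simp: inv_into_into f_inv_into_f)
  have "inj_on (\<lambda>y. \<iota> (inv_into S f y)) T"
    by (rule inj_onI) (metis i \<iota> inj_onD)
  then show ?thesis by (auto simp: embeddable_def)
qed

lemma embeddable_inj:
  assumes "inj_on f S" "f ` S \<subseteq> T" "embeddable T TYPE('n)"
  shows "embeddable S TYPE('n)"
proof -
  obtain \<iota> :: "_ \<Rightarrow> 'n" where \<iota>: "inj_on \<iota> T" using assms by (auto simp: embeddable_def)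
  then have "inj_on (\<iota> \<circ> f) S" using assms by (auto intro: comp_inj_on inj_on_subset)
  then show ?thesis by (auto simp: embeddable_def)
qed

text \<open>
  A tuple of functions on \<open>nat\<close> becomes one such function by means of the pairing
  \<open>nat \<times> nat \<cong> nat\<close>.
\<close>

lemma embeddable_tuples:
  fixes n :: nat
  assumes "embeddable S TYPE(nat \<Rightarrow> 'k)"
  shows "embeddable ({..<n} \<rightarrow>\<^sub>E S) TYPE(nat \<Rightarrow> 'k)"
proof -
  obtain \<iota> :: "_ \<Rightarrow> nat \<Rightarrow> 'k" where \<iota>: "inj_on \<iota> S" using assms by (auto simp: embeddable_def)
  define J where "J v = (\<lambda>k. case prod_decode k of (i, j) \<Rightarrow> \<iota> (v i) j)" for v :: "nat \<Rightarrow> _"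
  have "inj_on J ({..<n} \<rightarrow>\<^sub>E S)"
  proof (rule inj_onI)
    fix u v assume u: "u \<in> {..<n} \<rightarrow>\<^sub>E S" and v: "v \<in> {..<n} \<rightarrow>\<^sub>E S" and eq: "J u = J v"
    have "\<iota> (u i) = \<iota> (v i)" for i
    proof
      fix j show "\<iota> (u i) j = \<iota> (v i) j"
        using fun_cong[OF eq, of "prod_encode (i, j)"] by (simp add: J_def)
    qed
    then show "u = v"
      by (intro PiE_ext[OF u v] inj_onD[OF \<iota>]) (use u v in auto)
  qed
  then show ?thesis by (auto simp: embeddable_def)
qed

text \<open>
  Every element is determined by a tuple of coefficients of a linear combination for it.
\<close>

lemma embeddable_fg_module:
  assumes "fg_module R M" "embeddable (carrier R) TYPE(nat \<Rightarrow> 'k)"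
  shows "embeddable (carrier M) TYPE(nat \<Rightarrow> 'k)"
proof -
  obtain n :: nat and g where
    "\<And>x. x \<in> carrier M \<Longrightarrow> \<exists>c\<in>{..<n} \<rightarrow>\<^sub>E carrier R. x = (\<Oplus>\<^bsub>M\<^esub>i\<in>{..<n}. c i \<odot>\<^bsub>M\<^esub> g i)"
    by (rule finitely_generated_span[of R M]) (use assms(1) in \<open>auto simp: fg_module_def\<close>)
  then have "carrier M \<subseteq> (\<lambda>c. \<Oplus>\<^bsub>M\<^esub>i\<in>{..<n}. c i \<odot>\<^bsub>M\<^esub> g i) ` ({..<n} \<rightarrow>\<^sub>E carrier R)"
    by blast
  then show ?thesis
    by (rule embeddable_surj[OF embeddable_tuples[OF assms(2)]])
qed

text \<open>A linear map is determined by its values on finitely many generators.\<close>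

lemma embeddable_linear_maps:
  assumes "fg_module R M" "left_module R N" "embeddable (carrier N) TYPE(nat \<Rightarrow> 'k)"
  shows "embeddable (linear_maps R M N) TYPE(nat \<Rightarrow> 'k)"
proof -
  obtain n :: nat and g where g: "g \<in> {..<n} \<rightarrow> carrier M"
    and span: "\<And>x. x \<in> carrier M \<Longrightarrow> \<exists>c\<in>{..<n} \<rightarrow>\<^sub>E carrier R. x = (\<Oplus>\<^bsub>M\<^esub>i\<in>{..<n}. c i \<odot>\<^bsub>M\<^esub> g i)"
    by (rule finitely_generated_span[of R M]) (use assms(1) in \<open>auto simp: fg_module_def\<close>)
  interpret M: left_module R M using assms(1) by (simp add: fg_module_def)
  interpret N: left_module R N by fact
  let ?e = "\<lambda>f. \<lambda>i\<in>{..<n}. f (g i)"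
  have "inj_on ?e (linear_maps R M N)"
  proof (rule inj_onI)
    fix f h assume f: "f \<in> linear_maps R M N" and h: "h \<in> linear_maps R M N" and feq: "?e f = ?e h"
    have eq: "f (g i) = h (g i)" if "i < n" for i
      using fun_cong[OF feq, of i] that by simp
    show "f = h"
    proof (rule linear_maps_ext[OF f h])
      fix x assume "x \<in> carrier M"
      then obtain c where c: "c \<in> {..<n} \<rightarrow>\<^sub>E carrier R" "x = (\<Oplus>\<^bsub>M\<^esub>i\<in>{..<n}. c i \<odot>\<^bsub>M\<^esub> g i)"
        using span by blast
      have t: "(\<lambda>i. c i \<odot>\<^bsub>M\<^esub> g i) \<in> {..<n} \<rightarrow> carrier M"
        using c(1) g by (auto intro!: M.smult_closed)
      have "f x = (\<Oplus>\<^bsub>N\<^esub>i\<in>{..<n}. f (c i \<odot>\<^bsub>M\<^esub> g i))"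
        unfolding c(2) by (rule linear_maps_finsum[OF f _ _ t]) unfold_locales
      also have "\<dots> = (\<Oplus>\<^bsub>N\<^esub>i\<in>{..<n}. h (c i \<odot>\<^bsub>M\<^esub> g i))"
        using c(1) g t eq
        by (intro N.M.finsum_cong')
          (auto simp: Pi_iff PiE_iff linear_maps_smult[OF f] linear_maps_smult[OF h]
            linear_maps_closed[OF h] N.smult_closed)
      also have "\<dots> = h x"
        unfolding c(2) by (rule linear_maps_finsum[OF h _ _ t, symmetric]) unfold_locales
      finally show "f x = h x" .
    qed
  qed
  moreover have "?e ` linear_maps R M N \<subseteq> {..<n} \<rightarrow>\<^sub>E carrier N"
  proof
    fix y assume "y \<in> ?e ` linear_maps R M N"
    then obtain f where "f \<in> linear_maps R M N" "y = ?e f" by blast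
    then show "y \<in> {..<n} \<rightarrow>\<^sub>E carrier N"
      using g linear_maps_closed[of f R M N] by (auto simp: Pi_iff)
  qed
  ultimately show ?thesis
    by (rule embeddable_inj[OF _ _ embeddable_tuples[OF assms(3)]])
qed


section \<open>Direct summands of finite sums of copies\<close>

text \<open>
  The equation \<open>x = r\<^sub>0 (s\<^sub>0 x) + \<dots> + r\<^sub>n\<^sub>-\<^sub>1 (s\<^sub>n\<^sub>-\<^sub>1 x)\<close> says that the identity of \<open>M\<close>
  factors through \<open>E\<^sup>n\<close>.  In this form membership in \<open>add E\<close> is transported by functors and
  isomorphisms without mentioning submodules, and for \<open>E = R\<close> it is the dual basis property of
  projective modules.
\<close>

definition summand_of_copies ::
  "('a, 'x) ring_scheme \<Rightarrow> ('a, 'e) module \<Rightarrow> ('a, 'm) module \<Rightarrow> bool" where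
  "summand_of_copies R E M \<longleftrightarrow> (\<exists>(n::nat) s r.
     (\<forall>j<n. s j \<in> linear_maps R M E \<and> r j \<in> linear_maps R E M) \<and>
     (\<forall>x\<in>carrier M. x = (\<Oplus>\<^bsub>M\<^esub>j\<in>{..<n}. r j (s j x))))"

lemma summand_of_copiesI:
  fixes n :: nat
  assumes "\<And>j. j < n \<Longrightarrow> s j \<in> linear_maps R M E" "\<And>j. j < n \<Longrightarrow> r j \<in> linear_maps R E M"
    and "\<And>x. x \<in> carrier M \<Longrightarrow> x = (\<Oplus>\<^bsub>M\<^esub>j\<in>{..<n}. r j (s j x))"
  shows "summand_of_copies R E M"
  unfolding summand_of_copies_def using assms by blast

lemma summand_of_copies_fg:
  assumes "fg_module R E" "left_module R M" "summand_of_copies R E M"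
  shows "fg_module R M"
proof -
  have E: "left_module R E" using assms(1) by (simp add: fg_module_def)
  obtain S where S: "finite S" "S \<subseteq> carrier E" "\<And>H. submodule H R E \<Longrightarrow> S \<subseteq> H \<Longrightarrow> H = carrier E"
    using assms(1) by (auto simp: fg_module_def finitely_generated_def)
  obtain n :: nat and s r where s: "\<And>j. j < n \<Longrightarrow> s j \<in> linear_maps R M E"
    and r: "\<And>j. j < n \<Longrightarrow> r j \<in> linear_maps R E M"
    and sum: "\<And>x. x \<in> carrier M \<Longrightarrow> x = (\<Oplus>\<^bsub>M\<^esub>j\<in>{..<n}. r j (s j x))"
    using assms(3) unfolding summand_of_copies_def by blast
  have "finitely_generated R M" unfolding finitely_generated_def
  proof (intro exI[of _ "\<Union>j\<in>{..<n}. r j ` S"] conjI allI impI)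
    fix H assume H: "submodule H R M \<and> (\<Union>j\<in>{..<n}. r j ` S) \<subseteq> H"
    have r_H: "r j y \<in> H" if "j < n" "y \<in> carrier E" for j y
    proof -
      have "{y \<in> carrier E. r j y \<in> H} = carrier E"
        using H S(2) that by (intro S(3) submodule_vimage[OF E assms(2) r]) blast+
      then show ?thesis using that by auto
    qed
    have "x \<in> H" if "x \<in> carrier M" for x
      by (subst sum[OF that], rule submodule_finsum[OF assms(2)])
        (use H r_H that linear_maps_closed[OF s] in auto)
    then show "H = carrier M" using H submodule_subset[of H R M] by auto
  qed (use S linear_maps_closed[OF r] in auto)
  then show ?thesis using assms(2) by (simp add: fg_module_def)
qed

lemma copies_simps [simp]:
  "carrier (copies n E) = {..<n} \<rightarrow>\<^sub>E carrier E"
  "\<zero>\<^bsub>copies n E\<^esub> = (\<lambda>i\<in>{..<n}. \<zero>\<^bsub>E\<^esub>)"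
  "u \<oplus>\<^bsub>copies n E\<^esub> v = (\<lambda>i\<in>{..<n}. u i \<oplus>\<^bsub>E\<^esub> v i)"
  "r \<odot>\<^bsub>copies n E\<^esub> u = (\<lambda>i\<in>{..<n}. r \<odot>\<^bsub>E\<^esub> u i)"
  by (simp_all add: copies_def)

lemma left_module_copies:
  assumes "left_module R E"
  shows "left_module R (copies n E)"
proof -
  interpret E: left_module R E by fact
  show ?thesis
  proof (rule left_moduleI)
    show "abelian_group (copies n E)"
    proof (rule abelian_groupI)
      fix x assume "x \<in> carrier (copies n E)"
      then show "\<exists>y\<in>carrier (copies n E). y \<oplus>\<^bsub>copies n E\<^esub> x = \<zero>\<^bsub>copies n E\<^esub>"
        by (intro bexI[of _ "\<lambda>i\<in>{..<n}. \<ominus>\<^bsub>E\<^esub> x i"]) (auto simp: PiE_iff E.M.l_neg intro!: restrict_ext)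
    qed (auto simp: PiE_iff E.M.a_ac intro!: restrict_ext extensionalityI[OF restrict_extensional])
  qed (auto simp: PiE_iff E.R.ring_axioms E.smult_l_distr E.smult_r_distr E.smult_assoc1 E.smult_one
      E.smult_closed intro!: restrict_ext extensionalityI[OF restrict_extensional])
qed

lemma copies_coordinate:
  assumes "left_module R E" "i < n"
  shows "(\<lambda>v\<in>carrier (copies n E). v i) \<in> linear_maps R (copies n E) E"
  by (rule linear_maps_restrictI[OF left_module_copies[OF assms(1)]]) (use assms(2) in \<open>auto simp: PiE_iff\<close>)

lemma copies_inclusion:
  assumes "left_module R E"
  shows "(\<lambda>e\<in>carrier E. \<lambda>i\<in>{..<n}. if i = j then e else \<zero>\<^bsub>E\<^esub>) \<in> linear_maps R E (copies n E)"
proof -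
  interpret E: left_module R E by fact
  show ?thesis
    by (rule linear_maps_restrictI[OF assms])
      (auto intro!: restrict_ext simp: left_module_smult_zero[OF assms])
qed

lemma copies_finsum:
  assumes "left_module R E" "s \<in> A \<rightarrow> carrier (copies n E)" "i < n"
  shows "finsum (copies n E) s A i = (\<Oplus>\<^bsub>E\<^esub>j\<in>A. s j i)"
  by (rule additive_finsum[where f = "\<lambda>v. v i"])
    (use assms in \<open>auto simp: left_module_group[OF left_module_copies] left_module_group PiE_iff Pi_iff\<close>)

lemma copies_sum_inclusions:
  assumes "left_module R E" "v \<in> carrier (copies n E)"
  shows "v = (\<Oplus>\<^bsub>copies n E\<^esub>j\<in>{..<n}. (\<lambda>i\<in>{..<n}. if i = j then v j else \<zero>\<^bsub>E\<^esub>))" (is "_ = finsum _ ?s _")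
proof -
  interpret E: left_module R E by fact
  interpret C: left_module R "copies n E" by (rule left_module_copies[OF assms(1)])
  have s: "?s \<in> {..<n} \<rightarrow> carrier (copies n E)"
    using assms(2) by (simp add: PiE_iff Pi_iff)
  show ?thesis
  proof (rule PiE_ext)
    show "v \<in> {..<n} \<rightarrow>\<^sub>E carrier E" using assms(2) by simp
    show "finsum (copies n E) ?s {..<n} \<in> {..<n} \<rightarrow>\<^sub>E carrier E"
      using C.M.finsum_closed[OF s] by simp
  next
    fix i assume i: "i \<in> {..<n}"
    have "finsum (copies n E) ?s {..<n} i = (\<Oplus>\<^bsub>E\<^esub>j\<in>{..<n}. if i = j then v j else \<zero>\<^bsub>E\<^esub>)"
      using copies_finsum[OF assms(1) s, of i] i by simp
    also have "\<dots> = v i"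
      using i assms(2) by (intro E.M.finsum_singleton) auto
    finally show "v i = finsum (copies n E) ?s {..<n} i" by simp
  qed
qed

text \<open>The universal property of \<open>E\<^sup>n\<close> as a coproduct.\<close>

lemma copies_sum_map:
  assumes "left_module R E" "left_module R M" "\<And>j. j < n \<Longrightarrow> r j \<in> linear_maps R E M"
  shows "(\<lambda>v\<in>carrier (copies n E). \<Oplus>\<^bsub>M\<^esub>j\<in>{..<n}. r j (v j)) \<in> linear_maps R (copies n E) M"
proof -
  interpret E: left_module R E by fact
  interpret M: left_module R M by fact
  have t: "(\<lambda>j. r j (v j)) \<in> {..<n} \<rightarrow> carrier M" if "v \<in> carrier (copies n E)" for v
    using that by (auto simp: PiE_iff intro!: linear_maps_closed[OF assms(3)])
  show ?thesis
  proof (rule linear_maps_restrictI[OF left_module_copies[OF assms(1)]])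
    fix u v assume uv: "u \<in> carrier (copies n E)" "v \<in> carrier (copies n E)"
    have "(\<Oplus>\<^bsub>M\<^esub>j\<in>{..<n}. r j ((u \<oplus>\<^bsub>copies n E\<^esub> v) j)) = (\<Oplus>\<^bsub>M\<^esub>j\<in>{..<n}. r j (u j) \<oplus>\<^bsub>M\<^esub> r j (v j))"
      using uv t[OF uv(1)] t[OF uv(2)]
      by (intro M.M.finsum_cong') (auto simp: PiE_iff Pi_iff linear_maps_add[OF assms(3)])
    then show "(\<Oplus>\<^bsub>M\<^esub>j\<in>{..<n}. r j ((u \<oplus>\<^bsub>copies n E\<^esub> v) j))
        = (\<Oplus>\<^bsub>M\<^esub>j\<in>{..<n}. r j (u j)) \<oplus>\<^bsub>M\<^esub> (\<Oplus>\<^bsub>M\<^esub>j\<in>{..<n}. r j (v j))"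
      using t[OF uv(1)] t[OF uv(2)] by (simp add: M.M.finsum_addf)
  next
    fix a v assume av: "a \<in> carrier R" "v \<in> carrier (copies n E)"
    have "(\<Oplus>\<^bsub>M\<^esub>j\<in>{..<n}. r j ((a \<odot>\<^bsub>copies n E\<^esub> v) j)) = (\<Oplus>\<^bsub>M\<^esub>j\<in>{..<n}. a \<odot>\<^bsub>M\<^esub> r j (v j))"
      using av t[OF av(2)]
      by (intro M.M.finsum_cong') (auto simp: PiE_iff Pi_iff linear_maps_smult[OF assms(3)] intro!: M.smult_closed)
    also have "\<dots> = a \<odot>\<^bsub>M\<^esub> (\<Oplus>\<^bsub>M\<^esub>j\<in>{..<n}. r j (v j))"
      by (rule additive_finsum[where f = "\<lambda>x. a \<odot>\<^bsub>M\<^esub> x", symmetric])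
        (use av t[OF av(2)] in \<open>auto intro: M.smult_closed M.smult_r_distr M.M.abelian_group_axioms\<close>)
    finally show "(\<Oplus>\<^bsub>M\<^esub>j\<in>{..<n}. r j ((a \<odot>\<^bsub>copies n E\<^esub> v) j)) = a \<odot>\<^bsub>M\<^esub> (\<Oplus>\<^bsub>M\<^esub>j\<in>{..<n}. r j (v j))" .
  qed (use t in auto)
qed

lemma summand_of_copies_copies:
  assumes "left_module R E"
  shows "summand_of_copies R E (copies n E)"
proof -
  let ?C = "copies n E"
  interpret C: left_module R ?C by (rule left_module_copies[OF assms])
  interpret E: left_module R E by fact
  let ?s = "\<lambda>j. \<lambda>v\<in>carrier ?C. v j" and ?r = "\<lambda>j. \<lambda>e\<in>carrier E. \<lambda>i\<in>{..<n}. if i = j then e else \<zero>\<^bsub>E\<^esub>"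
  have "v = (\<Oplus>\<^bsub>?C\<^esub>j\<in>{..<n}. ?r j (?s j v))" if v: "v \<in> carrier ?C" for v
  proof -
    have "(\<Oplus>\<^bsub>?C\<^esub>j\<in>{..<n}. ?r j (?s j v)) = (\<Oplus>\<^bsub>?C\<^esub>j\<in>{..<n}. (\<lambda>i\<in>{..<n}. if i = j then v j else \<zero>\<^bsub>E\<^esub>))"
      using v by (intro C.M.finsum_cong') (auto simp: PiE_iff intro!: restrict_ext)
    then show ?thesis using copies_sum_inclusions[OF assms v] by simp
  qed
  then show ?thesis
    by (intro summand_of_copiesI[of n ?s R _ E ?r] copies_inclusion[OF assms] copies_coordinate[OF assms])
qed

lemma summand_of_copies_retract:
  assumes "left_module R E" "left_module R L" "left_module R M" "summand_of_copies R E L"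
    and "\<sigma> \<in> linear_maps R M L" "\<rho> \<in> linear_maps R L M" "\<And>x. x \<in> carrier M \<Longrightarrow> \<rho> (\<sigma> x) = x"
  shows "summand_of_copies R E M"
proof -
  interpret L: left_module R L by fact
  interpret M: left_module R M by fact
  obtain n :: nat and s r where s: "\<And>j. j < n \<Longrightarrow> s j \<in> linear_maps R L E"
    and r: "\<And>j. j < n \<Longrightarrow> r j \<in> linear_maps R E L"
    and sum: "\<And>x. x \<in> carrier L \<Longrightarrow> x = (\<Oplus>\<^bsub>L\<^esub>j\<in>{..<n}. r j (s j x))"
    using assms(4) unfolding summand_of_copies_def by blast
  have "x = (\<Oplus>\<^bsub>M\<^esub>j\<in>{..<n}. compose (carrier E) \<rho> (r j) (compose (carrier M) (s j) \<sigma> x))"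
    if x: "x \<in> carrier M" for x
  proof -
    have \<sigma>x: "\<sigma> x \<in> carrier L" using linear_maps_closed[OF assms(5) x] .
    have t: "(\<lambda>j. r j (s j (\<sigma> x))) \<in> {..<n} \<rightarrow> carrier L"
      using \<sigma>x linear_maps_closed[OF r linear_maps_closed[OF s]] by auto
    have "x = \<rho> (\<Oplus>\<^bsub>L\<^esub>j\<in>{..<n}. r j (s j (\<sigma> x)))"
      using assms(7)[OF x] sum[OF \<sigma>x] by simp
    also have "\<dots> = (\<Oplus>\<^bsub>M\<^esub>j\<in>{..<n}. \<rho> (r j (s j (\<sigma> x))))"
      by (rule linear_maps_finsum[OF assms(6) _ _ t]) unfold_locales
    also have "\<dots> = (\<Oplus>\<^bsub>M\<^esub>j\<in>{..<n}. compose (carrier E) \<rho> (r j) (compose (carrier M) (s j) \<sigma> x))"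
      using x \<sigma>x t linear_maps_closed[OF assms(6)]
      by (intro M.M.finsum_cong') (auto simp: compose_eq linear_maps_closed[OF s] Pi_iff)
    finally show ?thesis .
  qed
  then show ?thesis
    by (intro summand_of_copiesI[of n "\<lambda>j. compose (carrier M) (s j) \<sigma>" R M E "\<lambda>j. compose (carrier E) \<rho> (r j)"]
        linear_maps_compose[OF assms(3) assms(5) s] linear_maps_compose[OF assms(1) r assms(6)])
qed

lemma summand_of_copies_iso:
  assumes "left_module R E" "left_module R M" "left_module R N" "mod_iso R M N"
    and "summand_of_copies R E M"
  shows "summand_of_copies R E N"
proof -
  obtain f where f: "f \<in> linear_maps R M N" "bij_betw f (carrier M) (carrier N)"
    using assms(4) by (auto simp: mod_iso_def)
  show ?thesis
    by (rule summand_of_copies_retract[OF assms(1,2,3,5) linear_maps_inverse[OF assms(2,3) f] f(1)])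
      (simp add: bij_betw_inv_into_right[OF f(2)])
qed

section \<open>Idempotents and \<open>add E\<close>\<close>

lemma image_compose: "compose A g f ` A = g ` f ` A"
  by (auto simp: compose_def)

text \<open>
  Every \<open>x\<close> is \<open>p x + (x - p x)\<close>, and \<open>p\<close> kills the second part.
\<close>

lemma idempotent_direct_sum:
  assumes "left_module R M" "p \<in> linear_maps R M M" "\<And>x. x \<in> carrier M \<Longrightarrow> p (p x) = p x"
  shows "internal_direct_sum R M (p ` carrier M) (a_kernel M M p)"
proof -
  interpret M: left_module R M by fact
  note pc = linear_maps_closed[OF assms(2)]
  have p0: "p \<zero>\<^bsub>M\<^esub> = \<zero>\<^bsub>M\<^esub>"
    by (rule linear_maps_zero[OF _ _ assms(2)]) unfold_locales
  have "p ` carrier M \<inter> a_kernel M M p = {\<zero>\<^bsub>M\<^esub>}"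
    using p0 assms(3) by (auto simp: a_kernel_def' intro!: image_eqI[of _ p "\<zero>\<^bsub>M\<^esub>"])
  moreover have "p ` carrier M <+>\<^bsub>M\<^esub> a_kernel M M p = carrier M"
  proof
    show "carrier M \<subseteq> p ` carrier M <+>\<^bsub>M\<^esub> a_kernel M M p"
    proof
      fix x assume x: "x \<in> carrier M"
      have "p (x \<ominus>\<^bsub>M\<^esub> p x) = p x \<oplus>\<^bsub>M\<^esub> \<ominus>\<^bsub>M\<^esub> p (p x)"
        using x pc unfolding a_minus_def
        by (simp add: linear_maps_add[OF assms(2)]
            linear_maps_minus[OF M.M.abelian_group_axioms M.M.abelian_group_axioms assms(2)])
      then have "x \<ominus>\<^bsub>M\<^esub> p x \<in> a_kernel M M p"
        using x pc assms(3) by (simp add: a_kernel_def' M.M.r_neg)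
      moreover have "x = p x \<oplus>\<^bsub>M\<^esub> (x \<ominus>\<^bsub>M\<^esub> p x)"
        using x pc by (simp add: a_minus_def M.M.a_lcomm M.M.r_neg)
      ultimately show "x \<in> p ` carrier M <+>\<^bsub>M\<^esub> a_kernel M M p"
        using x unfolding set_add_def' by blast
    qed
  qed (use pc in \<open>auto simp: set_add_def' a_kernel_def'\<close>)
  ultimately show ?thesis
    using submodule_image[OF assms(1,1,2)] submodule_kernel[OF assms(1,1,2)]
    by (simp add: internal_direct_sum_def)
qed

text \<open>
  The \<open>U\<close>-component of an element is unique because \<open>U\<close> and \<open>V\<close> meet in zero; sending an
  element to it is linear.
\<close>

lemma direct_sum_projection:
  assumes "left_module R M" "internal_direct_sum R M U V"
  obtains p where "p \<in> linear_maps R M M" "p ` carrier M \<subseteq> U" "\<And>u. u \<in> U \<Longrightarrow> p u = u"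
    "\<And>v. v \<in> V \<Longrightarrow> p v = \<zero>\<^bsub>M\<^esub>"
proof -
  interpret M: left_module R M by fact
  have U: "submodule U R M" and V: "submodule V R M" and UV: "U \<inter> V = {\<zero>\<^bsub>M\<^esub>}"
    and sum: "U <+>\<^bsub>M\<^esub> V = carrier M"
    using assms(2) by (auto simp: internal_direct_sum_def)
  note Uc = subsetD[OF submodule_subset[OF U]] and Vc = subsetD[OF submodule_subset[OF V]]
  have uniq: "u = u'" if "u \<in> U" "v \<in> V" "u' \<in> U" "v' \<in> V" "u \<oplus>\<^bsub>M\<^esub> v = u' \<oplus>\<^bsub>M\<^esub> v'" for u v u' v'
  proof -
    have c: "u \<in> carrier M" "v \<in> carrier M" "u' \<in> carrier M" "v' \<in> carrier M"
      using that Uc Vc by auto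
    have "u \<ominus>\<^bsub>M\<^esub> u' = (u \<oplus>\<^bsub>M\<^esub> v) \<ominus>\<^bsub>M\<^esub> v \<ominus>\<^bsub>M\<^esub> u'"
      using c by (simp add: a_minus_def M.M.a_assoc M.M.r_neg)
    also have "\<dots> = v' \<ominus>\<^bsub>M\<^esub> v"
      unfolding that(5) using c M.M.a_lcomm[of u' v' "\<ominus>\<^bsub>M\<^esub> v \<oplus>\<^bsub>M\<^esub> \<ominus>\<^bsub>M\<^esub> u'"]
        M.M.a_comm[of "\<ominus>\<^bsub>M\<^esub> v" "\<ominus>\<^bsub>M\<^esub> u'"]
      by (simp add: a_minus_def M.M.a_assoc M.M.r_neg1 M.M.r_neg2)
    finally have eq: "u \<ominus>\<^bsub>M\<^esub> u' = v' \<ominus>\<^bsub>M\<^esub> v" .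
    have "u \<ominus>\<^bsub>M\<^esub> u' \<in> U"
      using that submodule_add[OF U] submodule_minus[OF U] by (simp add: a_minus_def)
    moreover have "u \<ominus>\<^bsub>M\<^esub> u' \<in> V"
      unfolding eq using that submodule_add[OF V] submodule_minus[OF V] by (simp add: a_minus_def)
    ultimately have "u \<ominus>\<^bsub>M\<^esub> u' = \<zero>\<^bsub>M\<^esub>" using UV by auto
    then show ?thesis using c M.M.minus_eq_zero_iff by simp
  qed
  define p where "p = (\<lambda>x\<in>carrier M. THE u. u \<in> U \<and> (\<exists>v\<in>V. x = u \<oplus>\<^bsub>M\<^esub> v))"
  have p: "p (u \<oplus>\<^bsub>M\<^esub> v) = u" if "u \<in> U" "v \<in> V" for u v
    unfolding p_def using that uniq Uc Vc by (auto intro!: the_equality)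
  have dec: "\<exists>u\<in>U. \<exists>v\<in>V. x = u \<oplus>\<^bsub>M\<^esub> v" if "x \<in> carrier M" for x
    using that unfolding sum[symmetric] by (auto simp: set_add_def')
  have pU: "p u = u" if "u \<in> U" for u
    using p[OF that submodule_zero[OF V]] Uc[OF that] by simp
  have pV: "p v = \<zero>\<^bsub>M\<^esub>" if "v \<in> V" for v
    using p[OF submodule_zero[OF U] that] Vc[OF that] by simp
  show ?thesis
  proof (rule that[of p])
    show "p \<in> linear_maps R M M"
    proof (rule linear_mapsI)
      fix x y assume "x \<in> carrier M" "y \<in> carrier M"
      then obtain u v u' v' where uv: "u \<in> U" "v \<in> V" "x = u \<oplus>\<^bsub>M\<^esub> v" "u' \<in> U" "v' \<in> V" "y = u' \<oplus>\<^bsub>M\<^esub> v'"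
        using dec by meson
      then have "x \<oplus>\<^bsub>M\<^esub> y = (u \<oplus>\<^bsub>M\<^esub> u') \<oplus>\<^bsub>M\<^esub> (v \<oplus>\<^bsub>M\<^esub> v')"
        using Uc Vc by (simp add: M.M.a_ac)
      then show "p (x \<oplus>\<^bsub>M\<^esub> y) = p x \<oplus>\<^bsub>M\<^esub> p y"
        using uv p submodule_add[OF U] submodule_add[OF V] by simp
    next
      fix r x assume r: "r \<in> carrier R" and "x \<in> carrier M"
      then obtain u v where uv: "u \<in> U" "v \<in> V" "x = u \<oplus>\<^bsub>M\<^esub> v" using dec by meson
      then have "r \<odot>\<^bsub>M\<^esub> x = r \<odot>\<^bsub>M\<^esub> u \<oplus>\<^bsub>M\<^esub> r \<odot>\<^bsub>M\<^esub> v"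
        using r Uc Vc by (simp add: M.smult_r_distr)
      then show "p (r \<odot>\<^bsub>M\<^esub> x) = r \<odot>\<^bsub>M\<^esub> p x"
        using r uv p submodule_smult[OF U] submodule_smult[OF V] by simp
    next
      fix x assume "x \<in> carrier M"
      then show "p x \<in> carrier M" using dec p Uc by metis
    qed (simp add: p_def)
    show "p ` carrier M \<subseteq> U" using dec p by fastforce
  qed (use pU pV in auto)
qed

text \<open>
  From a decomposition of \<open>E\<^sup>n\<close>, the projection makes the summand a retract of \<open>E\<^sup>n\<close>.
  Conversely, maps \<open>s\<close> and \<open>r\<close> combine to \<open>\<sigma> : M \<rightarrow> E\<^sup>n\<close> and \<open>\<rho> : E\<^sup>n \<rightarrow> M\<close> with \<open>\<rho> \<sigma> = 1\<close>, and
  the idempotent \<open>\<sigma> \<rho>\<close> splits off a copy of \<open>M\<close>.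
\<close>

lemma in_add_iff:
  assumes "left_module R E"
  shows "in_add R E M \<longleftrightarrow> fg_module R M \<and> summand_of_copies R E M"
proof
  assume "in_add R E M"
  then obtain n U V where M: "fg_module R M" and UV: "internal_direct_sum R (copies n E) U V"
    and iso: "mod_iso R M ((copies n E)\<lparr>carrier := U\<rparr>)"
    by (auto simp: in_add_def)
  let ?C = "copies n E" let ?U = "?C\<lparr>carrier := U\<rparr>"
  have C: "left_module R ?C" by (rule left_module_copies[OF assms])
  have U: "submodule U R ?C" using UV by (simp add: internal_direct_sum_def)
  have LU: "left_module R ?U" by (rule left_module_submodule[OF C U])
  obtain p where p: "p \<in> linear_maps R ?C ?C" "p ` carrier ?C \<subseteq> U" "\<And>u. u \<in> U \<Longrightarrow> p u = u"
    using direct_sum_projection[OF C UV] by metis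
  have "(\<lambda>x\<in>U. x) \<in> linear_maps R ?U ?C"
    by (rule linear_maps_enlarge[OF linear_maps_id[OF LU, simplified]]) (use submodule_subset[OF U] in auto)
  then have "summand_of_copies R E ?U"
    by (rule summand_of_copies_retract[OF assms C LU summand_of_copies_copies[OF assms] _
          linear_maps_shrink[OF p(1,2)]]) (use p(3) in auto)
  then show "fg_module R M \<and> summand_of_copies R E M"
    using M summand_of_copies_iso[OF assms LU _ mod_iso_sym[OF _ LU iso]] by (auto simp: fg_module_def)
next
  assume "fg_module R M \<and> summand_of_copies R E M"
  then have M: "fg_module R M" "left_module R M" and "summand_of_copies R E M"
    by (auto simp: fg_module_def)
  then obtain n :: nat and s r where s: "\<And>j. j < n \<Longrightarrow> s j \<in> linear_maps R M E"
    and r: "\<And>j. j < n \<Longrightarrow> r j \<in> linear_maps R E M"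
    and sum: "\<And>x. x \<in> carrier M \<Longrightarrow> x = (\<Oplus>\<^bsub>M\<^esub>j\<in>{..<n}. r j (s j x))"
    unfolding summand_of_copies_def by blast
  interpret M: left_module R M by fact
  let ?C = "copies n E"
  have C: "left_module R ?C" by (rule left_module_copies[OF assms])
  define \<sigma> where "\<sigma> = (\<lambda>x\<in>carrier M. \<lambda>j\<in>{..<n}. s j x)"
  define \<rho> where "\<rho> = (\<lambda>v\<in>carrier ?C. \<Oplus>\<^bsub>M\<^esub>j\<in>{..<n}. r j (v j))"
  have \<sigma>: "\<sigma> \<in> linear_maps R M ?C"
    unfolding \<sigma>_def by (rule linear_maps_restrictI[OF M(2)])
      (auto intro!: restrict_ext simp: linear_maps_closed[OF s] linear_maps_add[OF s] linear_maps_smult[OF s])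
  have \<rho>: "\<rho> \<in> linear_maps R ?C M" unfolding \<rho>_def by (rule copies_sum_map[OF assms M(2) r])
  have \<rho>\<sigma>: "\<rho> (\<sigma> x) = x" if x: "x \<in> carrier M" for x
  proof -
    have "\<rho> (\<sigma> x) = (\<Oplus>\<^bsub>M\<^esub>j\<in>{..<n}. r j (\<sigma> x j))"
      using linear_maps_closed[OF \<sigma> x] by (simp add: \<rho>_def)
    also have "\<dots> = (\<Oplus>\<^bsub>M\<^esub>j\<in>{..<n}. r j (s j x))"
      using x by (intro M.M.finsum_cong') (auto simp: \<sigma>_def linear_maps_closed[OF r linear_maps_closed[OF s]])
    finally show ?thesis by (rule trans[OF _ sum[OF x, symmetric]])
  qed
  let ?p = "compose (carrier ?C) \<sigma> \<rho>"
  have p: "?p \<in> linear_maps R ?C ?C" by (rule linear_maps_compose[OF C \<rho> \<sigma>])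
  have pe: "?p v = \<sigma> (\<rho> v)" if "v \<in> carrier ?C" for v
    using that by (simp only: compose_eq)
  have p\<sigma>: "?p (\<sigma> x) = \<sigma> x" if x: "x \<in> carrier M" for x
    by (simp only: pe[OF linear_maps_closed[OF \<sigma> x]] \<rho>\<sigma>[OF x])
  have pp: "?p (?p v) = ?p v" if v: "v \<in> carrier ?C" for v
    unfolding pe[OF v] by (rule p\<sigma>[OF linear_maps_closed[OF \<rho> v]])
  have im: "?p ` carrier ?C = \<sigma> ` carrier M"
  proof
    show "?p ` carrier ?C \<subseteq> \<sigma> ` carrier M"
      using linear_maps_closed[OF \<rho>] unfolding image_compose by blast
    show "\<sigma> ` carrier M \<subseteq> ?p ` carrier ?C"
      using linear_maps_closed[OF \<sigma>] p\<sigma> by (metis image_eqI image_subsetI)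
  qed
  have "mod_iso R M (?C\<lparr>carrier := ?p ` carrier ?C\<rparr>)"
    unfolding mod_iso_def
  proof (rule bexI)
    show "\<sigma> \<in> linear_maps R M (?C\<lparr>carrier := ?p ` carrier ?C\<rparr>)"
      by (rule linear_maps_shrink[OF \<sigma>]) (simp only: im)
    show "bij_betw \<sigma> (carrier M) (carrier (?C\<lparr>carrier := ?p ` carrier ?C\<rparr>))"
      using im by (simp add: bij_betw_def inj_on_inverseI[of _ \<rho>, OF \<rho>\<sigma>])
  qed
  with idempotent_direct_sum[OF C p pp] have "internal_direct_sum R ?C (?p ` carrier ?C) (a_kernel ?C ?C ?p) \<and>
      mod_iso R M (?C\<lparr>carrier := ?p ` carrier ?C\<rparr>)"
    by (rule conjI)
  then show "in_add R E M"
    unfolding in_add_def by (intro conjI[OF M(1)] exI)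
qed

text \<open>
  Phrasing indecomposability through the endomorphism ring makes it invariant under fully faithful
  additive functors.
\<close>

lemma indecomposable_iff_idempotents:
  assumes "left_module R M"
  shows "indecomposable R M \<longleftrightarrow>
    (\<lambda>x\<in>carrier M. x) \<noteq> (\<lambda>x\<in>carrier M. \<zero>\<^bsub>M\<^esub>) \<and>
    (\<forall>p\<in>linear_maps R M M. compose (carrier M) p p = p \<longrightarrow>
       p = (\<lambda>x\<in>carrier M. \<zero>\<^bsub>M\<^esub>) \<or> p = (\<lambda>x\<in>carrier M. x))"
proof -
  interpret M: left_module R M by fact
  have nz: "carrier M \<noteq> {\<zero>\<^bsub>M\<^esub>} \<longleftrightarrow> (\<lambda>x\<in>carrier M. x) \<noteq> (\<lambda>x\<in>carrier M. \<zero>\<^bsub>M\<^esub>)"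
    using M.M.zero_closed by (auto simp: fun_eq_iff restrict_def split: if_splits)
  have "(\<forall>U V. internal_direct_sum R M U V \<longrightarrow> U = {\<zero>\<^bsub>M\<^esub>} \<or> V = {\<zero>\<^bsub>M\<^esub>}) \<longleftrightarrow>
    (\<forall>p\<in>linear_maps R M M. compose (carrier M) p p = p \<longrightarrow>
       p = (\<lambda>x\<in>carrier M. \<zero>\<^bsub>M\<^esub>) \<or> p = (\<lambda>x\<in>carrier M. x))" (is "?A = ?B")
  proof
    assume A: ?A
    show ?B
    proof (intro ballI impI)
      fix p assume p: "p \<in> linear_maps R M M" "compose (carrier M) p p = p"
      have pp: "p (p x) = p x" if "x \<in> carrier M" for x
        using compose_eq[OF that, of p p] p(2) by simp
      have "p ` carrier M = {\<zero>\<^bsub>M\<^esub>} \<or> a_kernel M M p = {\<zero>\<^bsub>M\<^esub>}"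
        using A idempotent_direct_sum[OF assms p(1) pp] by blast
      then show "p = (\<lambda>x\<in>carrier M. \<zero>\<^bsub>M\<^esub>) \<or> p = (\<lambda>x\<in>carrier M. x)"
      proof
        assume "p ` carrier M = {\<zero>\<^bsub>M\<^esub>}"
        then have "p = (\<lambda>x\<in>carrier M. \<zero>\<^bsub>M\<^esub>)"
          by (intro linear_maps_ext[OF p(1) linear_maps_const_zero[OF assms assms]]) auto
        then show ?thesis ..
      next
        assume k: "a_kernel M M p = {\<zero>\<^bsub>M\<^esub>}"
        have "p = (\<lambda>x\<in>carrier M. x)"
        proof (rule linear_maps_ext[OF p(1) linear_maps_id[OF assms]])
          fix x assume x: "x \<in> carrier M"
          note px = linear_maps_closed[OF p(1) x]
          have "p (x \<ominus>\<^bsub>M\<^esub> p x) = p x \<oplus>\<^bsub>M\<^esub> \<ominus>\<^bsub>M\<^esub> p (p x)"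
            using x px unfolding a_minus_def
            by (simp add: linear_maps_add[OF p(1)]
                linear_maps_minus[OF M.M.abelian_group_axioms M.M.abelian_group_axioms p(1)])
          then have "x \<ominus>\<^bsub>M\<^esub> p x \<in> a_kernel M M p"
            using x px pp by (simp add: a_kernel_def' M.M.r_neg)
          then have "x \<ominus>\<^bsub>M\<^esub> p x = \<zero>\<^bsub>M\<^esub>" using k by auto
          then have "x = p x" using x px by (simp only: M.M.minus_eq_zero_iff)
          then show "p x = (\<lambda>x\<in>carrier M. x) x" using x by (simp only: restrict_apply')
        qed
        then show ?thesis ..
      qed
    qed
  next
    assume B: ?B
    show ?A
    proof (intro allI impI)
      fix U V assume UV: "internal_direct_sum R M U V"
      then obtain p where p: "p \<in> linear_maps R M M" "p ` carrier M \<subseteq> U" "\<And>u. u \<in> U \<Longrightarrow> p u = u"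
        "\<And>v. v \<in> V \<Longrightarrow> p v = \<zero>\<^bsub>M\<^esub>"
        using direct_sum_projection[OF assms] by metis
      have s: "U \<subseteq> carrier M" "V \<subseteq> carrier M" "\<zero>\<^bsub>M\<^esub> \<in> U" "\<zero>\<^bsub>M\<^esub> \<in> V"
        using UV submodule_subset[of _ R M] submodule_zero[of _ R M] by (auto simp: internal_direct_sum_def)
      have "compose (carrier M) p p = p"
        by (rule linear_maps_ext[OF linear_maps_compose[OF assms p(1,1)] p(1)])
          (simp only: compose_eq p(3)[OF subsetD[OF p(2) imageI]])
      then consider "p = (\<lambda>x\<in>carrier M. \<zero>\<^bsub>M\<^esub>)" | "p = (\<lambda>x\<in>carrier M. x)" using B p(1) by blast
      then show "U = {\<zero>\<^bsub>M\<^esub>} \<or> V = {\<zero>\<^bsub>M\<^esub>}"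
      proof cases
        case 1
        have "u = \<zero>\<^bsub>M\<^esub>" if "u \<in> U" for u
          using p(3)[OF that] subsetD[OF s(1) that] unfolding 1 by (simp only: restrict_apply')
        then show ?thesis using s(3) by blast
      next
        case 2
        have "v = \<zero>\<^bsub>M\<^esub>" if "v \<in> V" for v
          using p(4)[OF that] subsetD[OF s(2) that] unfolding 2 by (simp only: restrict_apply')
        then show ?thesis using s(4) by blast
      qed
    qed
  qed
  then show ?thesis unfolding indecomposable_def nz by blast
qed

section \<open>Projective modules and dual bases\<close>

lemma regular_map:
  assumes "left_module R M" "x \<in> carrier M"
  shows "(\<lambda>a\<in>carrier R. a \<odot>\<^bsub>M\<^esub> x) \<in> linear_maps R (regular_module R) M"
proof -
  interpret M: left_module R M by fact
  show ?thesis
    using linear_maps_restrictI[OF left_module_regular[OF M.R.ring_axioms], of "\<lambda>a. a \<odot>\<^bsub>M\<^esub> x" M] assms(2)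
    by (simp add: M.smult_closed M.smult_l_distr M.smult_assoc1)
qed

lemma fg_module_regular:
  assumes "ring R" shows "fg_module R (regular_module R)"
proof -
  interpret ring R by fact
  have "finitely_generated R (regular_module R)"
    unfolding finitely_generated_def
  proof (intro exI[of _ "{\<one>\<^bsub>R\<^esub>}"] conjI allI impI)
    fix H assume H: "submodule H R (regular_module R) \<and> {\<one>\<^bsub>R\<^esub>} \<subseteq> H"
    have "a \<in> H" if "a \<in> carrier R" for a
      using submodule_smult[of H R "regular_module R" a "\<one>\<^bsub>R\<^esub>"] H that by simp
    then show "H = carrier (regular_module R)" using H submodule_subset[of H R "regular_module R"] by auto
  qed auto
  then show ?thesis using left_module_regular[OF assms] by (simp add: fg_module_def)
qed

text \<open>
  The elements \<open>b\<^sub>i\<close> are the images of \<open>1\<close> under the maps \<open>R \<rightarrow> P\<close>.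
\<close>

lemma dual_basis:
  assumes "left_module R P" "summand_of_copies R (regular_module R) P"
  obtains n :: nat and e b where
    "\<And>i. i < n \<Longrightarrow> e i \<in> linear_maps R P (regular_module R)" "\<And>i. i < n \<Longrightarrow> b i \<in> carrier P"
    "\<And>p. p \<in> carrier P \<Longrightarrow> p = (\<Oplus>\<^bsub>P\<^esub>i\<in>{..<n}. e i p \<odot>\<^bsub>P\<^esub> b i)"
proof -
  interpret P: left_module R P by fact
  obtain n :: nat and s r where s: "\<And>j. j < n \<Longrightarrow> s j \<in> linear_maps R P (regular_module R)"
    and r: "\<And>j. j < n \<Longrightarrow> r j \<in> linear_maps R (regular_module R) P"
    and sum: "\<And>x. x \<in> carrier P \<Longrightarrow> x = (\<Oplus>\<^bsub>P\<^esub>j\<in>{..<n}. r j (s j x))"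
    using assms(2) unfolding summand_of_copies_def by blast
  have b: "r j \<one>\<^bsub>R\<^esub> \<in> carrier P" if "j < n" for j using linear_maps_closed[OF r[OF that]] by simp
  show ?thesis
  proof (rule that[of n s "\<lambda>j. r j \<one>\<^bsub>R\<^esub>"])
    fix p assume p: "p \<in> carrier P"
    have sc: "s j p \<in> carrier R" if "j < n" for j using linear_maps_closed[OF s[OF that] p] by simp
    have "(\<Oplus>\<^bsub>P\<^esub>j\<in>{..<n}. r j (s j p)) = (\<Oplus>\<^bsub>P\<^esub>j\<in>{..<n}. s j p \<odot>\<^bsub>P\<^esub> r j \<one>\<^bsub>R\<^esub>)"
      using linear_maps_smult[OF r, of _ "s _ p" "\<one>\<^bsub>R\<^esub>"] sc b
      by (intro P.M.finsum_cong') (auto simp: P.smult_closed)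
    then show "p = (\<Oplus>\<^bsub>P\<^esub>j\<in>{..<n}. s j p \<odot>\<^bsub>P\<^esub> r j \<one>\<^bsub>R\<^esub>)" 
      by (rule trans[OF sum[OF p]])
  qed (use s b in auto)
qed

lemma dual_basis_expansion:
  fixes n :: nat
  assumes "left_module R P" "left_module R N" "h \<in> linear_maps R P N" "p \<in> carrier P"
    and e: "\<And>i. i < n \<Longrightarrow> e i \<in> linear_maps R P (regular_module R)"
    and b: "\<And>i. i < n \<Longrightarrow> b i \<in> carrier P"
    and sum: "p = (\<Oplus>\<^bsub>P\<^esub>i\<in>{..<n}. e i p \<odot>\<^bsub>P\<^esub> b i)"
  shows "h p = (\<Oplus>\<^bsub>N\<^esub>i\<in>{..<n}. e i p \<odot>\<^bsub>N\<^esub> h (b i))"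
proof -
  interpret P: left_module R P by fact
  interpret N: left_module R N by fact
  have ec: "e i p \<in> carrier R" if "i < n" for i using linear_maps_closed[OF e[OF that] assms(4)] by simp
  have "h p = h (\<Oplus>\<^bsub>P\<^esub>i\<in>{..<n}. e i p \<odot>\<^bsub>P\<^esub> b i)" using sum by (rule arg_cong)
  also have "\<dots> = (\<Oplus>\<^bsub>N\<^esub>i\<in>{..<n}. h (e i p \<odot>\<^bsub>P\<^esub> b i))"
    by (rule linear_maps_finsum[OF assms(3) P.M.abelian_group_axioms N.M.abelian_group_axioms])
      (use ec b P.smult_closed in auto)
  also have "\<dots> = (\<Oplus>\<^bsub>N\<^esub>i\<in>{..<n}. e i p \<odot>\<^bsub>N\<^esub> h (b i))"
    using ec b linear_maps_closed[OF assms(3)]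
    by (intro N.M.finsum_cong') (auto simp: linear_maps_smult[OF assms(3)] N.smult_closed)
  finally show ?thesis .
qed

text \<open>
  The image of \<open>\<phi> \<otimes> n\<close> under the canonical map \<open>Hom(P, R) \<otimes> N \<rightarrow> Hom(P, N)\<close>.
\<close>

definition rank_one :: "('a, 'p) module \<Rightarrow> ('a, 'm) module \<Rightarrow> ('p \<Rightarrow> 'a) \<Rightarrow> 'm \<Rightarrow> 'p \<Rightarrow> 'm" where
  "rank_one P N \<phi> n = (\<lambda>p\<in>carrier P. \<phi> p \<odot>\<^bsub>N\<^esub> n)"

lemma rank_one_linear:
  assumes "left_module R P" "left_module R N" "\<phi> \<in> linear_maps R P (regular_module R)" "n \<in> carrier N"
  shows "rank_one P N \<phi> n \<in> linear_maps R P N"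
proof -
  interpret N: left_module R N by fact
  note c = linear_maps_closed[OF assms(3), simplified] linear_maps_add[OF assms(3), simplified]
    linear_maps_smult[OF assms(3), simplified]
  show ?thesis
    unfolding rank_one_def
    by (rule linear_maps_restrictI[OF assms(1)])
      (auto simp: c assms(4) N.smult_closed N.smult_l_distr N.smult_assoc1)
qed

text \<open>
  For \<open>P\<close> with a dual basis the canonical map \<open>Hom(P, R) \<otimes> N \<rightarrow> Hom(P, N)\<close> is onto, with this
  explicit preimage.
\<close>

lemma rank_one_expansion:
  fixes n :: nat
  assumes "left_module R P" "left_module R N" "h \<in> linear_maps R P N"
    and e: "\<And>i. i < n \<Longrightarrow> e i \<in> linear_maps R P (regular_module R)"
    and b: "\<And>i. i < n \<Longrightarrow> b i \<in> carrier P"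
    and sum: "\<And>p. p \<in> carrier P \<Longrightarrow> p = (\<Oplus>\<^bsub>P\<^esub>i\<in>{..<n}. e i p \<odot>\<^bsub>P\<^esub> b i)"
  shows "h = (\<Oplus>\<^bsub>Hom R P N\<^esub>i\<in>{..<n}. rank_one P N (e i) (h (b i)))"
proof -
  interpret N: left_module R N by fact
  interpret H: abelian_group "Hom R P N" by (rule left_module_Hom[OF assms(1,2)])
  have r: "(\<lambda>i. rank_one P N (e i) (h (b i))) \<in> {..<n} \<rightarrow> linear_maps R P N"
    using rank_one_linear[OF assms(1,2) e] linear_maps_closed[OF assms(3) b] by auto
  show ?thesis
  proof (rule linear_maps_ext[OF assms(3)])
    show "(\<Oplus>\<^bsub>Hom R P N\<^esub>i\<in>{..<n}. rank_one P N (e i) (h (b i))) \<in> linear_maps R P N"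
      using H.finsum_closed[of _ "{..<n}"] r by simp
    fix p assume p: "p \<in> carrier P"
    have "(\<Oplus>\<^bsub>Hom R P N\<^esub>i\<in>{..<n}. rank_one P N (e i) (h (b i))) p
        = (\<Oplus>\<^bsub>N\<^esub>i\<in>{..<n}. e i p \<odot>\<^bsub>N\<^esub> h (b i))"
      using Hom_finsum_apply[OF assms(1,2) r p] p by (simp add: rank_one_def)
    then show "h p = (\<Oplus>\<^bsub>Hom R P N\<^esub>i\<in>{..<n}. rank_one P N (e i) (h (b i))) p"
      using dual_basis_expansion[OF assms(1-3) p e b sum[OF p]] by (simp only:)
  qed
qed

text \<open>
  Choose preimages \<open>q\<^sub>i\<close> of the images of the basis elements and send \<open>x\<close> to the sum of the
  \<open>e\<^sub>i(x) q\<^sub>i\<close>.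
\<close>

lemma projective_lift:
  assumes "left_module R P" "summand_of_copies R (regular_module R) P"
    and "left_module R Q" "left_module R Y" "g \<in> linear_maps R Q Y" "g ` carrier Q = carrier Y"
    and "h \<in> linear_maps R P Y"
  shows "\<exists>h'\<in>linear_maps R P Q. compose (carrier P) g h' = h"
proof -
  interpret Q: left_module R Q by fact
  interpret Y: left_module R Y by fact
  obtain n :: nat and e b where e: "\<And>i. i < n \<Longrightarrow> e i \<in> linear_maps R P (regular_module R)"
    and b: "\<And>i. i < n \<Longrightarrow> b i \<in> carrier P"
    and sum: "\<And>p. p \<in> carrier P \<Longrightarrow> p = (\<Oplus>\<^bsub>P\<^esub>i\<in>{..<n}. e i p \<odot>\<^bsub>P\<^esub> b i)"
    by (rule dual_basis[OF assms(1,2)], rule that)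
  have "\<forall>i\<in>{..<n}. \<exists>y. y \<in> carrier Q \<and> g y = h (b i)"
    using linear_maps_closed[OF assms(7) b] unfolding assms(6)[symmetric] by force
  then obtain q where q: "\<And>i. i < n \<Longrightarrow> q i \<in> carrier Q" "\<And>i. i < n \<Longrightarrow> g (q i) = h (b i)"
    using bchoice[of "{..<n}" "\<lambda>i y. y \<in> carrier Q \<and> g y = h (b i)"] by auto
  let ?r = "\<lambda>i. rank_one P Q (e i) (q i)"
  have r: "?r \<in> {..<n} \<rightarrow> linear_maps R P Q"
    using rank_one_linear[OF assms(1,3) e q(1)] by auto
  let ?h = "finsum (Hom R P Q) ?r {..<n}"
  interpret H: abelian_group "Hom R P Q" by (rule left_module_Hom[OF assms(1,3)])
  have h: "?h \<in> linear_maps R P Q" using H.finsum_closed[of ?r "{..<n}"] r by simp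
  have "compose (carrier P) g ?h = h"
  proof (rule linear_maps_ext[OF linear_maps_compose[OF assms(1) h assms(5)] assms(7)])
    fix x assume x: "x \<in> carrier P"
    have ec: "e i x \<in> carrier R" if "i < n" for i using linear_maps_closed[OF e[OF that] x] by simp
    have "?h x = (\<Oplus>\<^bsub>Q\<^esub>i\<in>{..<n}. e i x \<odot>\<^bsub>Q\<^esub> q i)"
      using Hom_finsum_apply[OF assms(1,3) r x] x by (simp add: rank_one_def)
    then have "g (?h x) = g (\<Oplus>\<^bsub>Q\<^esub>i\<in>{..<n}. e i x \<odot>\<^bsub>Q\<^esub> q i)" by (rule arg_cong)
    also have "\<dots> = (\<Oplus>\<^bsub>Y\<^esub>i\<in>{..<n}. g (e i x \<odot>\<^bsub>Q\<^esub> q i))"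
      by (rule linear_maps_finsum[OF assms(5) Q.M.abelian_group_axioms Y.M.abelian_group_axioms])
        (use ec q(1) Q.smult_closed in auto)
    also have "\<dots> = (\<Oplus>\<^bsub>Y\<^esub>i\<in>{..<n}. e i x \<odot>\<^bsub>Y\<^esub> h (b i))"
      using ec q linear_maps_closed[OF assms(7) b]
      by (intro Y.M.finsum_cong') (auto simp: linear_maps_smult[OF assms(5)] Y.smult_closed)
    also have "\<dots> = h x" by (rule dual_basis_expansion[OF assms(1,4,7) x e b sum[OF x], symmetric])
    finally show "compose (carrier P) g ?h x = h x" using x by (simp only: compose_eq)
  qed
  then show ?thesis using h by blast
qed

text \<open>
  A finitely generated \<open>P\<close> is the image of some \<open>R\<^sup>n\<close>; if \<open>P\<close> is projective, this surjection
  splits.  The definition of projectivity tests surjections between modules in one carrier type, and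
  the embedding of \<open>R\<close> provides a copy of \<open>R\<^sup>n\<close> there.
\<close>

lemma projective_iff:
  fixes P :: "('a, nat \<Rightarrow> 'k) module"
  assumes "ring R" "embeddable (carrier R) TYPE(nat \<Rightarrow> 'k)"
  shows "projective R P \<longleftrightarrow> fg_module R P \<and> summand_of_copies R (regular_module R) P"
proof
  assume "fg_module R P \<and> summand_of_copies R (regular_module R) P"
  then show "projective R P"
    unfolding projective_def using projective_lift[of R P] by (auto simp: fg_module_def)
next
  assume P: "projective R P"
  then have fg: "fg_module R P" and LP: "left_module R P" by (auto simp: projective_def fg_module_def)
  interpret P: left_module R P by fact
  let ?A = "regular_module R"
  have A: "left_module R ?A" by (rule left_module_regular[OF assms(1)])
  obtain n :: nat and g where g: "g \<in> {..<n} \<rightarrow> carrier P"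
    and span: "\<And>x. x \<in> carrier P \<Longrightarrow> \<exists>c\<in>{..<n} \<rightarrow>\<^sub>E carrier R. x = (\<Oplus>\<^bsub>P\<^esub>i\<in>{..<n}. c i \<odot>\<^bsub>P\<^esub> g i)"
    by (rule finitely_generated_span[of R P]) (use fg in \<open>auto simp: fg_module_def\<close>)
  let ?C = "copies n ?A"
  have C: "left_module R ?C" by (rule left_module_copies[OF A])
  let ?\<rho> = "\<lambda>v\<in>carrier ?C. \<Oplus>\<^bsub>P\<^esub>j\<in>{..<n}. (\<lambda>a\<in>carrier R. a \<odot>\<^bsub>P\<^esub> g j) (v j)"
  have \<rho>: "?\<rho> \<in> linear_maps R ?C P"
    by (rule copies_sum_map[OF A LP], rule regular_map[OF LP]) (use g in auto)
  have sur: "?\<rho> ` carrier ?C = carrier P"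
  proof
    show "carrier P \<subseteq> ?\<rho> ` carrier ?C"
    proof
      fix x assume "x \<in> carrier P"
      then obtain c where c: "c \<in> {..<n} \<rightarrow>\<^sub>E carrier R" "x = (\<Oplus>\<^bsub>P\<^esub>i\<in>{..<n}. c i \<odot>\<^bsub>P\<^esub> g i)" using span by blast
      have "(\<Oplus>\<^bsub>P\<^esub>j\<in>{..<n}. (\<lambda>a\<in>carrier R. a \<odot>\<^bsub>P\<^esub> g j) (c j)) = (\<Oplus>\<^bsub>P\<^esub>i\<in>{..<n}. c i \<odot>\<^bsub>P\<^esub> g i)"
        using c(1) g by (intro P.M.finsum_cong') (auto simp: PiE_iff Pi_iff P.smult_closed)
      then have "?\<rho> c = x"
        using c by simp
      then show "x \<in> ?\<rho> ` carrier ?C" using c(1) by (intro image_eqI[of _ _ c]) auto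
    qed
  qed (use linear_maps_closed[OF \<rho>] in blast)
  obtain F :: "('a, nat \<Rightarrow> 'k) module" and \<eta> where F: "left_module R F" "\<eta> \<in> linear_maps R ?C F"
    "bij_betw \<eta> (carrier ?C) (carrier F)"
    by (rule transport_module[OF C, where ?'n = "nat \<Rightarrow> 'k"])
      (simp_all only: copies_simps regular_module_simps embeddable_tuples[OF assms(2)])
  let ?i = "\<lambda>y\<in>carrier F. inv_into (carrier ?C) \<eta> y"
  have i: "?i \<in> linear_maps R F ?C" by (rule linear_maps_inverse[OF C F])
  have fgF: "fg_module R F"
    using summand_of_copies_fg[OF fg_module_regular[OF assms(1)] C summand_of_copies_copies[OF A]] F
    unfolding mod_iso_def by (blast intro: fg_module_iso[unfolded mod_iso_def])
  let ?g = "compose (carrier F) ?\<rho> ?i"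
  have gl: "?g \<in> linear_maps R F P" by (rule linear_maps_compose[OF F(1) i \<rho>])
  have "?i ` carrier F = carrier ?C"
    using bij_betw_inv_into[OF F(3)] by (simp only: bij_betw_def image_restrict_eq)
  then have "?g ` carrier F = carrier P"
    using sur by (simp only: image_compose)
  then obtain h where h: "h \<in> linear_maps R P F" "compose (carrier P) ?g h = (\<lambda>x\<in>carrier P. x)"
    using P gl fgF linear_maps_id[OF LP] unfolding projective_def by blast
  have "?g (h x) = x" if "x \<in> carrier P" for x
    using fun_cong[OF h(2), of x] that by (simp only: compose_eq restrict_apply')
  then have "summand_of_copies R ?A P"
    by (intro summand_of_copies_retract[OF A F(1) LP _ h(1) gl]
        summand_of_copies_iso[OF A C F(1) _ summand_of_copies_copies[OF A]])
      (use F in \<open>simp_all only: mod_iso_def, blast\<close>)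
  then show "fg_module R P \<and> summand_of_copies R ?A P" using fg by simp
qed

section \<open>The functor \<open>Hom(E, -)\<close>\<close>

text \<open>
  The left \<open>End(E)\<^sup>o\<^sup>p\<close>-module \<open>Hom(E, W)\<close>; an endomorphism acts by precomposition.
\<close>

definition hom_module ::
  "('a, 'x) ring_scheme \<Rightarrow> ('a, 'e) module \<Rightarrow> ('a, 'm) module \<Rightarrow> ('e \<Rightarrow> 'e, 'e \<Rightarrow> 'm) module" where
  "hom_module R E W = with_smult (Hom R E W) (\<lambda>\<gamma> h. compose (carrier E) h \<gamma>)"

lemma hom_module_simps [simp]:
  "carrier (hom_module R E W) = linear_maps R E W"
  "\<zero>\<^bsub>hom_module R E W\<^esub> = (\<lambda>e\<in>carrier E. \<zero>\<^bsub>W\<^esub>)"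
  "f \<oplus>\<^bsub>hom_module R E W\<^esub> g = (\<lambda>e\<in>carrier E. f e \<oplus>\<^bsub>W\<^esub> g e)"
  "\<gamma> \<odot>\<^bsub>hom_module R E W\<^esub> h = compose (carrier E) h \<gamma>"
  by (simp_all add: hom_module_def)

lemma End_op_simps [simp]:
  "carrier (End_op \<Lambda> E) = linear_maps \<Lambda> E E"
  "f \<otimes>\<^bsub>End_op \<Lambda> E\<^esub> g = compose (carrier E) g f"
  "\<one>\<^bsub>End_op \<Lambda> E\<^esub> = (\<lambda>e\<in>carrier E. e)"
  "\<zero>\<^bsub>End_op \<Lambda> E\<^esub> = (\<lambda>e\<in>carrier E. \<zero>\<^bsub>E\<^esub>)"
  "f \<oplus>\<^bsub>End_op \<Lambda> E\<^esub> g = (\<lambda>e\<in>carrier E. f e \<oplus>\<^bsub>E\<^esub> g e)"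
  "c \<odot>\<^bsub>End_op \<Lambda> E\<^esub> f = (\<lambda>e\<in>carrier E. (c \<odot>\<^bsub>\<Lambda>\<^esub> \<one>\<^bsub>\<Lambda>\<^esub>) \<odot>\<^bsub>E\<^esub> f e)"
  by (simp_all add: End_op_def op_alg_def with_smult_def)

lemma abelian_group_hom_module:
  assumes "left_module R E" "left_module R W"
  shows "abelian_group (hom_module R E W)"
  unfolding hom_module_def by (rule abelian_group_with_smult[OF left_module_Hom[OF assms]])

lemma compose_linear_assoc:
  assumes "f \<in> linear_maps R M N"
  shows "compose (carrier M) h (compose (carrier M) g f) = compose (carrier M) (compose (carrier N) h g) f"
  by (rule compose_assoc) (use linear_maps_closed[OF assms] in auto)

lemma compose_linear_id:
  assumes "f \<in> linear_maps R M N"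
  shows "compose (carrier M) f (\<lambda>x\<in>carrier M. x) = f" "compose (carrier M) (\<lambda>x\<in>carrier N. x) f = f"
  using linear_maps_extensional[OF assms] linear_maps_closed[OF assms]
  by (auto simp: compose_def intro!: extensionalityI[of _ "carrier M"])

lemma ring_End_op:
  assumes "left_module \<Lambda> E"
  shows "ring (End_op \<Lambda> E)"
proof -
  interpret E: left_module \<Lambda> E by fact
  let ?G = "End_op \<Lambda> E"
  note c = linear_maps_closed[of _ \<Lambda> E E]
  show ?thesis
  proof (rule ringI)
    show "abelian_group ?G"
      by (rule abelian_group_cong[OF left_module_Hom[OF assms assms]])
        (simp_all add: End_op_def op_alg_def with_smult_def Hom_def)
    show "Group.monoid ?G"
      by (rule monoidI)
        (auto simp: linear_maps_compose[OF assms] linear_maps_id[OF assms] compose_linear_id compose_linear_assoc)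
  next
    fix f g h assume "f \<in> carrier ?G" "g \<in> carrier ?G" "h \<in> carrier ?G"
    then have fgh: "f \<in> linear_maps \<Lambda> E E" "g \<in> linear_maps \<Lambda> E E" "h \<in> linear_maps \<Lambda> E E" by auto
    show "(f \<oplus>\<^bsub>?G\<^esub> g) \<otimes>\<^bsub>?G\<^esub> h = f \<otimes>\<^bsub>?G\<^esub> h \<oplus>\<^bsub>?G\<^esub> g \<otimes>\<^bsub>?G\<^esub> h"
      using fgh by (auto simp: compose_def c linear_maps_add[OF fgh(3)] intro!: restrict_ext)
    show "h \<otimes>\<^bsub>?G\<^esub> (f \<oplus>\<^bsub>?G\<^esub> g) = h \<otimes>\<^bsub>?G\<^esub> f \<oplus>\<^bsub>?G\<^esub> h \<otimes>\<^bsub>?G\<^esub> g"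
      using fgh by (auto simp: compose_def c intro!: restrict_ext)
  qed
qed

lemma left_module_hom_module:
  assumes "left_module \<Lambda> E" "left_module \<Lambda> W"
  shows "left_module (End_op \<Lambda> E) (hom_module \<Lambda> E W)"
proof -
  interpret E: left_module \<Lambda> E by fact
  interpret W: left_module \<Lambda> W by fact
  note c = linear_maps_closed[of _ \<Lambda> E E] linear_maps_closed[of _ \<Lambda> E W] linear_maps_add[of _ \<Lambda> E W]
  show ?thesis
  proof (rule left_moduleI[OF ring_End_op[OF assms(1)] abelian_group_hom_module[OF assms]], goal_cases)
    case (1 f h)
    then show ?case by (simp add: linear_maps_compose[OF assms(1)])
  next
    case (2 f g h)
    then show ?case by (auto simp: compose_def c intro!: restrict_ext)
  next
    case (3 f h h')
    then show ?case by (auto simp: compose_def c intro!: restrict_ext)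
  next
    case (4 f g h)
    then show ?case by (simp add: compose_linear_assoc)
  next
    case (5 h)
    then show ?case by (simp add: compose_linear_id)
  qed
qed

text \<open>
  The values of \<open>Hom(E, -)\<close> do not lie in the carrier type over which \<open>\<Gamma>\<close>-modules range.
  Instead of one functor into that type, the relation records that \<open>P\<close> is a copy of
  \<open>Hom(E, W)\<close>, by way of the isomorphism \<open>\<eta>\<close>.
\<close>

definition represents ::
  "('k, 'a) module \<Rightarrow> ('a, 'e) module \<Rightarrow> ('a, 'm) module \<Rightarrow> ('e \<Rightarrow> 'e, 'n) module \<Rightarrow>
    (('e \<Rightarrow> 'm) \<Rightarrow> 'n) \<Rightarrow> bool" where
  "represents \<Lambda> E W P \<eta> \<longleftrightarrow> left_module \<Lambda> W \<and> left_module (End_op \<Lambda> E) P \<and>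
     \<eta> \<in> linear_maps (End_op \<Lambda> E) (hom_module \<Lambda> E W) P \<and>
     bij_betw \<eta> (linear_maps \<Lambda> E W) (carrier P)"

lemma representsD:
  assumes "represents \<Lambda> E W P \<eta>"
  shows "left_module \<Lambda> W" "left_module (End_op \<Lambda> E) P"
    "\<eta> \<in> linear_maps (End_op \<Lambda> E) (hom_module \<Lambda> E W) P"
    "bij_betw \<eta> (linear_maps \<Lambda> E W) (carrier P)"
  using assms by (auto simp: represents_def)

lemma represents_closed:
  "represents \<Lambda> E W P \<eta> \<Longrightarrow> h \<in> linear_maps \<Lambda> E W \<Longrightarrow> \<eta> h \<in> carrier P"
  using representsD(4) bij_betwE by blast

lemma represents_surj:
  assumes "represents \<Lambda> E W P \<eta>" "p \<in> carrier P"
  obtains h where "h \<in> linear_maps \<Lambda> E W" "p = \<eta> h"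
  using assms representsD(4) by (metis bij_betw_iff_bijections)

lemma represents_inj:
  assumes "represents \<Lambda> E W P \<eta>" "h \<in> linear_maps \<Lambda> E W" "h' \<in> linear_maps \<Lambda> E W" "\<eta> h = \<eta> h'"
  shows "h = h'"
  using assms representsD(4)[OF assms(1)] by (auto simp: bij_betw_def inj_on_def)

text \<open>
  The composite \<open>P \<cong> Hom(E, W) \<rightarrow> Hom(E, Y) \<cong> Q\<close>: the action of the functor on the map \<open>f\<close>, read
  off on the copies \<open>P\<close> and \<open>Q\<close>.
\<close>

definition represented_map ::
  "('k, 'a) module \<Rightarrow> ('a, 'e) module \<Rightarrow> ('a, 'm) module \<Rightarrow> ('e \<Rightarrow> 'e, 'n) module \<Rightarrow>
    (('e \<Rightarrow> 'm) \<Rightarrow> 'n) \<Rightarrow> (('e \<Rightarrow> 'm') \<Rightarrow> 'n') \<Rightarrow> ('m \<Rightarrow> 'm') \<Rightarrow> 'n \<Rightarrow> 'n'" where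
  "represented_map \<Lambda> E W P \<eta> \<zeta> f =
     (\<lambda>p\<in>carrier P. \<zeta> (compose (carrier E) f (inv_into (linear_maps \<Lambda> E W) \<eta> p)))"

locale generator_module =
  fixes \<Lambda> :: "('k, 'a) module" and E :: "('a, 'e) module"
  assumes fg_E: "fg_module \<Lambda> E"
    and generates: "summand_of_copies \<Lambda> E (regular_module \<Lambda>)"
begin

abbreviation "\<Gamma> \<equiv> End_op \<Lambda> E"
abbreviation "F W \<equiv> hom_module \<Lambda> E W"
abbreviation "rep \<equiv> represents \<Lambda> E"
abbreviation "rmap \<equiv> represented_map \<Lambda> E"

lemma left_E: "left_module \<Lambda> E"
  using fg_E by (simp add: fg_module_def)

lemma ring_\<Gamma>: "ring \<Gamma>"
  by (rule ring_End_op[OF left_E])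

lemma rmap_apply:
  assumes "rep W P \<eta>" "h \<in> linear_maps \<Lambda> E W"
  shows "rmap W P \<eta> \<zeta> f (\<eta> h) = \<zeta> (compose (carrier E) f h)"
  using represents_closed[OF assms] bij_betw_inv_into_left[OF representsD(4)[OF assms(1)] assms(2)]
  by (simp add: represented_map_def)

lemma compose_E:
  "f \<in> linear_maps \<Lambda> W Y \<Longrightarrow> h \<in> linear_maps \<Lambda> E W \<Longrightarrow> compose (carrier E) f h \<in> linear_maps \<Lambda> E Y"
  by (rule linear_maps_compose[OF left_E])

lemma F_map:
  assumes "left_module \<Lambda> W" "f \<in> linear_maps \<Lambda> W Y"
  shows "(\<lambda>h\<in>linear_maps \<Lambda> E W. compose (carrier E) f h) \<in> linear_maps \<Gamma> (F W) (F Y)"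
proof -
  note c = linear_maps_closed[of _ \<Lambda> E W] linear_maps_closed[of _ \<Lambda> E E]
  have "(\<lambda>h\<in>carrier (F W). compose (carrier E) f h) \<in> linear_maps \<Gamma> (F W) (F Y)"
  proof (rule linear_maps_restrictI[OF left_module_hom_module[OF left_E assms(1)]])
    fix h h' assume "h \<in> carrier (F W)" "h' \<in> carrier (F W)"
    then show "compose (carrier E) f (h \<oplus>\<^bsub>F W\<^esub> h') = compose (carrier E) f h \<oplus>\<^bsub>F Y\<^esub> compose (carrier E) f h'"
      by (auto simp: c compose_def linear_maps_add[OF assms(2)] intro!: restrict_ext)
  next
    fix \<gamma> h assume "\<gamma> \<in> carrier \<Gamma>" "h \<in> carrier (F W)"
    then show "compose (carrier E) f (\<gamma> \<odot>\<^bsub>F W\<^esub> h) = \<gamma> \<odot>\<^bsub>F Y\<^esub> compose (carrier E) f h"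
      by (simp add: compose_linear_assoc)
  qed (simp add: compose_E[OF assms(2)])
  then show ?thesis by simp
qed

lemma rmap_linear:
  assumes "rep W P \<eta>" "rep Y Q \<zeta>" "f \<in> linear_maps \<Lambda> W Y"
  shows "rmap W P \<eta> \<zeta> f \<in> linear_maps \<Gamma> P Q"
proof -
  let ?i = "\<lambda>p\<in>carrier P. inv_into (carrier (F W)) \<eta> p"
  let ?f = "\<lambda>h\<in>linear_maps \<Lambda> E W. compose (carrier E) f h"
  note W = representsD[OF assms(1)] and Y = representsD[OF assms(2)]
  have FX: "left_module \<Gamma> (F W)" by (rule left_module_hom_module[OF left_E W(1)])
  have i: "?i \<in> linear_maps \<Gamma> P (F W)"
    by (rule linear_maps_inverse[OF FX W(2,3)]) (simp add: W(4))
  have "rmap W P \<eta> \<zeta> f = compose (carrier P) \<zeta> (compose (carrier P) ?f ?i)"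
    using linear_maps_closed[OF i]
    by (auto simp: represented_map_def compose_def intro!: restrict_ext)
  also have "\<dots> \<in> linear_maps \<Gamma> P Q"
    by (rule linear_maps_compose[OF W(2) linear_maps_compose[OF W(2) i F_map[OF W(1) assms(3)]] Y(3)])
  finally show ?thesis .
qed

lemma rmap_unique:
  assumes "rep W P \<eta>" "rep Y Q \<zeta>" "f \<in> linear_maps \<Lambda> W Y" "g \<in> linear_maps \<Gamma> P Q"
    and "\<And>h. h \<in> linear_maps \<Lambda> E W \<Longrightarrow> g (\<eta> h) = \<zeta> (compose (carrier E) f h)"
  shows "g = rmap W P \<eta> \<zeta> f"
proof (rule linear_maps_ext[OF assms(4) rmap_linear[OF assms(1-3)]])
  fix p assume "p \<in> carrier P"
  then obtain h where "h \<in> linear_maps \<Lambda> E W" "p = \<eta> h" by (rule represents_surj[OF assms(1)])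
  then show "g p = rmap W P \<eta> \<zeta> f p" using assms(5) by (simp add: rmap_apply[OF assms(1)])
qed

text \<open>
  The generator property makes \<open>\<Lambda>\<close> a summand of some \<open>E\<^sup>n\<close>; evaluate the factorization of its identity
  at \<open>1\<close>.
\<close>

lemma generator_one:
  obtains n :: nat and \<pi> u where "\<And>j. j < n \<Longrightarrow> \<pi> j \<in> linear_maps \<Lambda> E (regular_module \<Lambda>)"
    "\<And>j. j < n \<Longrightarrow> u j \<in> carrier E"
    "(\<Oplus>\<^bsub>regular_module \<Lambda>\<^esub>j\<in>{..<n}. \<pi> j (u j)) = \<one>\<^bsub>\<Lambda>\<^esub>"
proof -
  interpret E: left_module \<Lambda> E by (rule left_E)
  obtain n :: nat and s r where s: "\<And>j. j < n \<Longrightarrow> s j \<in> linear_maps \<Lambda> (regular_module \<Lambda>) E"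
    and r: "\<And>j. j < n \<Longrightarrow> r j \<in> linear_maps \<Lambda> E (regular_module \<Lambda>)"
    and sum: "\<And>x. x \<in> carrier (regular_module \<Lambda>) \<Longrightarrow>
      x = (\<Oplus>\<^bsub>regular_module \<Lambda>\<^esub>j\<in>{..<n}. r j (s j x))"
    using generates unfolding summand_of_copies_def by blast
  show ?thesis
    by (rule that[of n r "\<lambda>j. s j \<one>\<^bsub>\<Lambda>\<^esub>"])
      (use r linear_maps_closed[OF s] sum[of "\<one>\<^bsub>\<Lambda>\<^esub>", symmetric] in auto)
qed

lemma trace_map:
  assumes "left_module \<Lambda> W" "\<pi> \<in> linear_maps \<Lambda> E (regular_module \<Lambda>)" "x \<in> carrier W"
  shows "(\<lambda>e\<in>carrier E. \<pi> e \<odot>\<^bsub>W\<^esub> x) \<in> linear_maps \<Lambda> E W"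
proof -
  interpret W: left_module \<Lambda> W by fact
  have "\<pi> e \<in> carrier \<Lambda>" if "e \<in> carrier E" for e
    using linear_maps_closed[OF assms(2) that] by simp
  then show ?thesis
    by (intro linear_maps_restrictI[OF left_E])
      (auto simp: linear_maps_add[OF assms(2)] linear_maps_smult[OF assms(2)] assms(3)
        W.smult_l_distr W.smult_assoc1 W.smult_closed)
qed

text \<open>
  Multiply \<open>1 = \<pi>\<^sub>0(u\<^sub>0) + \<dots> + \<pi>\<^sub>n\<^sub>-\<^sub>1(u\<^sub>n\<^sub>-\<^sub>1)\<close> by \<open>x\<close>.
\<close>

lemma generator_expansion:
  fixes n :: nat
  assumes "left_module \<Lambda> W" "x \<in> carrier W"
    and \<pi>: "\<And>j. j < n \<Longrightarrow> \<pi> j \<in> linear_maps \<Lambda> E (regular_module \<Lambda>)"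
    and u: "\<And>j. j < n \<Longrightarrow> u j \<in> carrier E"
    and one: "(\<Oplus>\<^bsub>regular_module \<Lambda>\<^esub>j\<in>{..<n}. \<pi> j (u j)) = \<one>\<^bsub>\<Lambda>\<^esub>"
  shows "x = (\<Oplus>\<^bsub>W\<^esub>j\<in>{..<n}. (\<lambda>e\<in>carrier E. \<pi> j e \<odot>\<^bsub>W\<^esub> x) (u j))"
proof -
  interpret W: left_module \<Lambda> W by fact
  note A = left_module_group[OF left_module_regular[OF W.R.ring_axioms]]
  have \<pi>u: "\<pi> j (u j) \<in> carrier \<Lambda>" if "j < n" for j
    using linear_maps_closed[OF \<pi> u] that by simp
  have "x = (\<Oplus>\<^bsub>regular_module \<Lambda>\<^esub>j\<in>{..<n}. \<pi> j (u j)) \<odot>\<^bsub>W\<^esub> x"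
    using assms(2) by (simp add: one W.smult_one)
  also have "\<dots> = (\<Oplus>\<^bsub>W\<^esub>j\<in>{..<n}. \<pi> j (u j) \<odot>\<^bsub>W\<^esub> x)"
    by (rule additive_finsum[OF A W.M.abelian_group_axioms, where f = "\<lambda>a. a \<odot>\<^bsub>W\<^esub> x"])
      (use assms(2) \<pi>u in \<open>auto simp: W.smult_l_distr W.smult_closed\<close>)
  also have "\<dots> = (\<Oplus>\<^bsub>W\<^esub>j\<in>{..<n}. (\<lambda>e\<in>carrier E. \<pi> j e \<odot>\<^bsub>W\<^esub> x) (u j))"
    using assms(2) \<pi>u by (intro W.M.finsum_cong') (auto simp: u W.smult_closed)
  finally show ?thesis .
qed

text \<open>
  By the expansion of \<open>y\<close>, what holds for all values of the maps \<open>e \<mapsto> \<pi>(e) y\<close> and is stable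
  under sums holds for \<open>y\<close>.  This is how statements about \<open>Hom(E, -)\<close> are brought back to elements.
\<close>

lemma generator_detects:
  assumes "left_module \<Lambda> Y" "submodule H \<Lambda> Y" "y \<in> carrier Y"
    and "\<And>\<pi> e. \<pi> \<in> linear_maps \<Lambda> E (regular_module \<Lambda>) \<Longrightarrow> e \<in> carrier E \<Longrightarrow>
      (\<lambda>e\<in>carrier E. \<pi> e \<odot>\<^bsub>Y\<^esub> y) e \<in> H"
  shows "y \<in> H"
proof -
  obtain n :: nat and \<pi> u where \<pi>: "\<And>j. j < n \<Longrightarrow> \<pi> j \<in> linear_maps \<Lambda> E (regular_module \<Lambda>)"
    and u: "\<And>j. j < n \<Longrightarrow> u j \<in> carrier E"
    and one: "(\<Oplus>\<^bsub>regular_module \<Lambda>\<^esub>j\<in>{..<n}. \<pi> j (u j)) = \<one>\<^bsub>\<Lambda>\<^esub>"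
    by (rule generator_one, rule that)
  have "(\<Oplus>\<^bsub>Y\<^esub>j\<in>{..<n}. (\<lambda>e\<in>carrier E. \<pi> j e \<odot>\<^bsub>Y\<^esub> y) (u j)) \<in> H"
    by (intro submodule_finsum[OF assms(1,2)] Pi_I assms(4) \<pi> u) simp_all
  then show ?thesis by (subst generator_expansion[OF assms(1,3) \<pi> u one])
qed

text \<open>
  The equalizer of \<open>f\<close> and \<open>f'\<close> is a submodule that contains the values of all maps from \<open>E\<close>.
\<close>

lemma F_faithful:
  assumes "left_module \<Lambda> W" "left_module \<Lambda> Y" "f \<in> linear_maps \<Lambda> W Y" "f' \<in> linear_maps \<Lambda> W Y"
    and "\<And>h. h \<in> linear_maps \<Lambda> E W \<Longrightarrow> compose (carrier E) f h = compose (carrier E) f' h"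
  shows "f = f'"
proof (rule linear_maps_ext[OF assms(3,4)])
  interpret W: left_module \<Lambda> W by fact
  fix x assume x: "x \<in> carrier W"
  let ?H = "{x \<in> carrier W. f x = f' x}"
  have H: "submodule ?H \<Lambda> W"
  proof (rule submoduleI_left[OF assms(1)])
    show "\<zero>\<^bsub>W\<^esub> \<in> ?H"
      using linear_maps_zero[OF left_module_group left_module_group, OF assms(1,2,3)]
        linear_maps_zero[OF left_module_group left_module_group, OF assms(1,2,4)] by simp
  qed (auto simp: W.smult_closed linear_maps_add[OF assms(3)] linear_maps_add[OF assms(4)]
      linear_maps_smult[OF assms(3)] linear_maps_smult[OF assms(4)])
  have "x \<in> ?H"
  proof (rule generator_detects[OF assms(1) H x])
    fix \<pi> e assume \<pi>: "\<pi> \<in> linear_maps \<Lambda> E (regular_module \<Lambda>)" and e: "e \<in> carrier E"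
    note t = trace_map[OF assms(1) \<pi> x]
    show "(\<lambda>e\<in>carrier E. \<pi> e \<odot>\<^bsub>W\<^esub> x) e \<in> ?H"
      using fun_cong[OF assms(5)[OF t], of e] linear_maps_closed[OF t e] e
      by (simp only: compose_eq mem_Collect_eq simp_thms)
  qed
  then show "f x = f' x" by simp
qed

text \<open>
  Write \<open>\<pi>\<^sub>j x\<close> for the map \<open>e \<mapsto> \<pi>\<^sub>j(e) x\<close>.  The preimage of \<open>\<Phi>\<close> has to satisfy
  \<open>f(x) = \<Phi>(\<pi>\<^sub>0 x)(u\<^sub>0) + \<dots> + \<Phi>(\<pi>\<^sub>n\<^sub>-\<^sub>1 x)(u\<^sub>n\<^sub>-\<^sub>1)\<close>, and this formula works.  For \<open>g : E \<rightarrow> W\<close> the map \<open>\<pi>\<^sub>j g(e)\<close>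
  is \<open>g\<close> preceded by the endomorphism \<open>e' \<mapsto> \<pi>\<^sub>j(e') e\<close> of \<open>E\<close>, so \<open>\<Gamma>\<close>-linearity of \<open>\<Phi>\<close> gives
  \<open>f \<circ> g = \<Phi>(g)\<close>; linearity of \<open>f\<close> over \<open>\<Lambda>\<close> follows from this.
\<close>

lemma F_full:
  assumes "left_module \<Lambda> W" "left_module \<Lambda> Y" "\<Phi> \<in> linear_maps \<Gamma> (F W) (F Y)"
  obtains f where "f \<in> linear_maps \<Lambda> W Y"
    "\<And>h. h \<in> linear_maps \<Lambda> E W \<Longrightarrow> \<Phi> h = compose (carrier E) f h"
proof -
  interpret W: left_module \<Lambda> W by fact
  interpret Y: left_module \<Lambda> Y by fact
  interpret E: left_module \<Lambda> E by (rule left_E)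
  obtain n :: nat and \<pi> u where \<pi>: "\<And>j. j < n \<Longrightarrow> \<pi> j \<in> linear_maps \<Lambda> E (regular_module \<Lambda>)"
    and u: "\<And>j. j < n \<Longrightarrow> u j \<in> carrier E"
    and one: "(\<Oplus>\<^bsub>regular_module \<Lambda>\<^esub>j\<in>{..<n}. \<pi> j (u j)) = \<one>\<^bsub>\<Lambda>\<^esub>"
    by (rule generator_one, rule that)
  note \<pi>W = trace_map[OF assms(1) \<pi>] and sum = generator_expansion[OF assms(1) _ \<pi> u one]
  have \<pi>c: "\<pi> j e \<in> carrier \<Lambda>" if "j < n" "e \<in> carrier E" for j e
    using linear_maps_closed[OF \<pi>[OF that(1)] that(2)] by simp
  define t where "t x j = (\<lambda>e\<in>carrier E. \<pi> j e \<odot>\<^bsub>W\<^esub> x)" for x j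
  have tm: "t x j \<in> linear_maps \<Lambda> E W" if "x \<in> carrier W" "j < n" for x j
    using \<pi>W[OF that(2,1)] by (simp add: t_def)
  have \<Phi>c: "\<Phi> h \<in> linear_maps \<Lambda> E Y" if "h \<in> linear_maps \<Lambda> E W" for h
    using linear_maps_closed[OF assms(3)] that by simp
  have \<Phi>t: "\<Phi> (t x j) e \<in> carrier Y" if "x \<in> carrier W" "j < n" "e \<in> carrier E" for x j e
    using linear_maps_closed[OF \<Phi>c[OF tm] that(3)] that by simp
  define f where "f = (\<lambda>x\<in>carrier W. \<Oplus>\<^bsub>Y\<^esub>j\<in>{..<n}. \<Phi> (t x j) (u j))"
  have fadd: "f (x \<oplus>\<^bsub>W\<^esub> y) = f x \<oplus>\<^bsub>Y\<^esub> f y" if x: "x \<in> carrier W" and y: "y \<in> carrier W" for x y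
  proof -
    have "t (x \<oplus>\<^bsub>W\<^esub> y) j = t x j \<oplus>\<^bsub>F W\<^esub> t y j" if "j < n" for j
      using that x y by (auto simp: t_def W.smult_r_distr \<pi>c intro!: restrict_ext)
    then have "\<Phi> (t (x \<oplus>\<^bsub>W\<^esub> y) j) (u j) = \<Phi> (t x j) (u j) \<oplus>\<^bsub>Y\<^esub> \<Phi> (t y j) (u j)" if "j < n" for j
      using that x y linear_maps_add[OF assms(3), of "t x j" "t y j"] tm u by simp
    then have "(\<Oplus>\<^bsub>Y\<^esub>j\<in>{..<n}. \<Phi> (t (x \<oplus>\<^bsub>W\<^esub> y) j) (u j))
        = (\<Oplus>\<^bsub>Y\<^esub>j\<in>{..<n}. \<Phi> (t x j) (u j) \<oplus>\<^bsub>Y\<^esub> \<Phi> (t y j) (u j))"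
      using x y \<Phi>t u by (intro Y.M.finsum_cong') auto
    then have "f (x \<oplus>\<^bsub>W\<^esub> y) = (\<Oplus>\<^bsub>Y\<^esub>j\<in>{..<n}. \<Phi> (t x j) (u j) \<oplus>\<^bsub>Y\<^esub> \<Phi> (t y j) (u j))"
      unfolding f_def using x y by simp
    also have "\<dots> = f x \<oplus>\<^bsub>Y\<^esub> f y"
      unfolding f_def using x y \<Phi>t u by (simp add: Y.M.finsum_addf)
    finally show ?thesis .
  qed
  have fc: "f x \<in> carrier Y" if "x \<in> carrier W" for x
    using that \<Phi>t u unfolding f_def by auto
  have fg: "f (g e) = \<Phi> g e" if g: "g \<in> linear_maps \<Lambda> E W" and e: "e \<in> carrier E" for g e
  proof -
    have ge: "g e \<in> carrier W" by (rule linear_maps_closed[OF g e])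
    \<comment> \<open>The map \<open>\<pi>\<^sub>j g(e)\<close> is the multiple of \<open>g\<close> by this element of \<open>\<Gamma>\<close>.\<close>
    let ?\<gamma> = "\<lambda>j. \<lambda>e'\<in>carrier E. \<pi> j e' \<odot>\<^bsub>E\<^esub> e"
    have \<gamma>: "?\<gamma> j \<in> linear_maps \<Lambda> E E" if "j < n" for j
      by (rule trace_map[OF left_E \<pi>[OF that] e])
    have "t (g e) j = compose (carrier E) g (?\<gamma> j)" if "j < n" for j
      using that e by (auto simp: t_def compose_def linear_maps_smult[OF g] \<pi>c intro!: restrict_ext)
    then have "\<Phi> (t (g e) j) (u j) = \<Phi> g (?\<gamma> j (u j))" if "j < n" for j
      using linear_maps_smult[OF assms(3), of "?\<gamma> j" g] g \<gamma> u[OF that] that by (simp add: compose_eq)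
    then have "f (g e) = (\<Oplus>\<^bsub>Y\<^esub>j\<in>{..<n}. \<Phi> g (?\<gamma> j (u j)))"
      unfolding f_def using ge linear_maps_closed[OF \<Phi>c[OF g]] linear_maps_closed[OF \<gamma> u]
      by (auto intro!: Y.M.finsum_cong')
    also have "\<dots> = \<Phi> g (\<Oplus>\<^bsub>E\<^esub>j\<in>{..<n}. ?\<gamma> j (u j))"
      by (rule linear_maps_finsum[OF \<Phi>c[OF g] E.M.abelian_group_axioms Y.M.abelian_group_axioms, symmetric])
        (use linear_maps_closed[OF \<gamma> u] in blast)
    also have "(\<Oplus>\<^bsub>E\<^esub>j\<in>{..<n}. ?\<gamma> j (u j)) = e"
      by (rule generator_expansion[OF left_E e \<pi> u one, symmetric])
    finally show ?thesis .
  qed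
  \<comment> \<open>Move \<open>a\<close> inside the maps \<open>\<pi>\<^sub>j x\<close>, and replace \<open>f\<close> of their values by values of \<open>\<Phi>(\<pi>\<^sub>j x)\<close>.\<close>
  have fsmult: "f (a \<odot>\<^bsub>W\<^esub> x) = a \<odot>\<^bsub>Y\<^esub> f x" if a: "a \<in> carrier \<Lambda>" and x: "x \<in> carrier W" for a x
  proof -
    have tu: "(\<lambda>j. t x j (u j)) \<in> {..<n} \<rightarrow> carrier W" using linear_maps_closed[OF tm[OF x] u] by blast
    have atu: "(\<lambda>j. t x j (a \<odot>\<^bsub>E\<^esub> u j)) \<in> {..<n} \<rightarrow> carrier W"
      using linear_maps_closed[OF tm[OF x] E.smult_closed[OF a u]] by blast
    have "a \<odot>\<^bsub>W\<^esub> x = a \<odot>\<^bsub>W\<^esub> (\<Oplus>\<^bsub>W\<^esub>j\<in>{..<n}. t x j (u j))"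
      using sum[OF x] by (simp add: t_def)
    also have "\<dots> = (\<Oplus>\<^bsub>W\<^esub>j\<in>{..<n}. a \<odot>\<^bsub>W\<^esub> t x j (u j))"
      by (rule additive_finsum[OF W.M.abelian_group_axioms W.M.abelian_group_axioms])
        (use a tu in \<open>auto simp: W.smult_closed W.smult_r_distr\<close>)
    also have "\<dots> = (\<Oplus>\<^bsub>W\<^esub>j\<in>{..<n}. t x j (a \<odot>\<^bsub>E\<^esub> u j))"
      using atu by (intro W.M.finsum_cong') (auto simp: linear_maps_smult[OF tm[OF x] a u])
    finally have "f (a \<odot>\<^bsub>W\<^esub> x) = f (\<Oplus>\<^bsub>W\<^esub>j\<in>{..<n}. t x j (a \<odot>\<^bsub>E\<^esub> u j))" by simp
    also have "\<dots> = (\<Oplus>\<^bsub>Y\<^esub>j\<in>{..<n}. f (t x j (a \<odot>\<^bsub>E\<^esub> u j)))"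
      by (rule additive_finsum[OF W.M.abelian_group_axioms Y.M.abelian_group_axioms])
        (use fadd fc atu in auto)
    also have "\<dots> = (\<Oplus>\<^bsub>Y\<^esub>j\<in>{..<n}. a \<odot>\<^bsub>Y\<^esub> \<Phi> (t x j) (u j))"
      using a by (intro Y.M.finsum_cong')
        (auto simp: fg[OF tm[OF x] E.smult_closed[OF a u]] linear_maps_smult[OF \<Phi>c[OF tm[OF x]] a u]
          Y.smult_closed \<Phi>t[OF x] u)
    also have "\<dots> = a \<odot>\<^bsub>Y\<^esub> (\<Oplus>\<^bsub>Y\<^esub>j\<in>{..<n}. \<Phi> (t x j) (u j))"
      by (rule additive_finsum[OF Y.M.abelian_group_axioms Y.M.abelian_group_axioms, where f = "\<lambda>y. a \<odot>\<^bsub>Y\<^esub> y", symmetric])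
        (use a \<Phi>t[OF x] u in \<open>auto simp: Y.smult_closed Y.smult_r_distr\<close>)
    finally show ?thesis using x by (simp add: f_def)
  qed
  show ?thesis
  proof (rule that[of f])
    show "f \<in> linear_maps \<Lambda> W Y"
      by (rule linear_mapsI) (use fadd fc fsmult in \<open>auto simp: f_def\<close>)
    show "\<Phi> h = compose (carrier E) f h" if h: "h \<in> linear_maps \<Lambda> E W" for h
      using linear_maps_extensional[OF \<Phi>c[OF h]] fg[OF h]
      by (intro extensionalityI[of _ "carrier E"]) (auto simp: compose_eq compose_def)
  qed
qed

lemma rmap_full:
  assumes "rep W P \<eta>" "rep Y Q \<zeta>" "g \<in> linear_maps \<Gamma> P Q"
  obtains f where "f \<in> linear_maps \<Lambda> W Y" "g = rmap W P \<eta> \<zeta> f"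
proof -
  note W = representsD[OF assms(1)] and Y = representsD[OF assms(2)]
  have FW: "left_module \<Gamma> (F W)" and FY: "left_module \<Gamma> (F Y)"
    by (auto intro: left_module_hom_module[OF left_E] W(1) Y(1))
  let ?i = "\<lambda>q\<in>carrier Q. inv_into (carrier (F Y)) \<zeta> q"
  have i: "?i \<in> linear_maps \<Gamma> Q (F Y)"
    by (rule linear_maps_inverse[OF FY Y(2,3)]) (simp add: Y(4))
  let ?\<Phi> = "compose (carrier (F W)) ?i (compose (carrier (F W)) g \<eta>)"
  have \<Phi>: "?\<Phi> \<in> linear_maps \<Gamma> (F W) (F Y)"
    by (rule linear_maps_compose[OF FW linear_maps_compose[OF FW W(3) assms(3)] i])
  obtain f where f: "f \<in> linear_maps \<Lambda> W Y"
    "\<And>h. h \<in> linear_maps \<Lambda> E W \<Longrightarrow> ?\<Phi> h = compose (carrier E) f h"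
    by (rule F_full[OF W(1) Y(1) \<Phi>], rule that)
  have "g = rmap W P \<eta> \<zeta> f"
  proof (rule rmap_unique[OF assms(1,2) f(1) assms(3)])
    fix h assume h: "h \<in> linear_maps \<Lambda> E W"
    have gh: "g (\<eta> h) \<in> carrier Q" by (rule linear_maps_closed[OF assms(3) represents_closed[OF assms(1) h]])
    have "\<zeta> (compose (carrier E) f h) = \<zeta> (inv_into (linear_maps \<Lambda> E Y) \<zeta> (g (\<eta> h)))"
      using gh h by (simp add: f(2)[symmetric] compose_eq)
    then show "g (\<eta> h) = \<zeta> (compose (carrier E) f h)"
      using bij_betw_inv_into_right[OF Y(4) gh] by simp
  qed
  then show ?thesis using f(1) that by blast
qed

lemma rmap_inj:
  assumes "rep W P \<eta>" "rep Y Q \<zeta>" "f \<in> linear_maps \<Lambda> W Y" "f' \<in> linear_maps \<Lambda> W Y"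
    and "rmap W P \<eta> \<zeta> f = rmap W P \<eta> \<zeta> f'"
  shows "f = f'"
proof (rule F_faithful[OF representsD(1)[OF assms(1)] representsD(1)[OF assms(2)] assms(3,4)])
  fix h assume h: "h \<in> linear_maps \<Lambda> E W"
  have "\<zeta> (compose (carrier E) f h) = \<zeta> (compose (carrier E) f' h)"
    using assms(5) rmap_apply[OF assms(1) h] by metis
  then show "compose (carrier E) f h = compose (carrier E) f' h"
    by (rule represents_inj[OF assms(2) compose_E[OF assms(3) h] compose_E[OF assms(4) h]])
qed

lemma rmap_compose:
  assumes "rep W P \<eta>" "rep Y Q \<zeta>" "rep Z S \<theta>" "f \<in> linear_maps \<Lambda> W Y" "g \<in> linear_maps \<Lambda> Y Z"
  shows "compose (carrier P) (rmap Y Q \<zeta> \<theta> g) (rmap W P \<eta> \<zeta> f) = rmap W P \<eta> \<theta> (compose (carrier W) g f)"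
proof (rule rmap_unique[OF assms(1,3)])
  fix h assume h: "h \<in> linear_maps \<Lambda> E W"
  show "compose (carrier P) (rmap Y Q \<zeta> \<theta> g) (rmap W P \<eta> \<zeta> f) (\<eta> h)
      = \<theta> (compose (carrier E) (compose (carrier W) g f) h)"
    using h represents_closed[OF assms(1) h] compose_E[OF assms(4) h]
    by (simp add: compose_eq rmap_apply[OF assms(1)] rmap_apply[OF assms(2)] compose_linear_assoc[OF h])
qed (rule linear_maps_compose[OF representsD(1)[OF assms(1)] assms(4,5)],
    rule linear_maps_compose[OF representsD(2)[OF assms(1)] rmap_linear[OF assms(1,2,4)] rmap_linear[OF assms(2,3,5)]])

lemma rmap_id:
  assumes "rep W P \<eta>"
  shows "rmap W P \<eta> \<eta> (\<lambda>x\<in>carrier W. x) = (\<lambda>p\<in>carrier P. p)"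
  by (rule rmap_unique[OF assms assms linear_maps_id linear_maps_id, symmetric])
    (use representsD[OF assms] represents_closed[OF assms] in \<open>auto simp: compose_linear_id\<close>)

lemma rmap_zero:
  assumes "rep W P \<eta>" "rep Y Q \<zeta>"
  shows "rmap W P \<eta> \<zeta> (\<lambda>x\<in>carrier W. \<zero>\<^bsub>Y\<^esub>) = (\<lambda>p\<in>carrier P. \<zero>\<^bsub>Q\<^esub>)"
proof (rule rmap_unique[OF assms linear_maps_const_zero linear_maps_const_zero, symmetric])
  fix h assume h: "h \<in> linear_maps \<Lambda> E W"
  have "compose (carrier E) (\<lambda>x\<in>carrier W. \<zero>\<^bsub>Y\<^esub>) h = \<zero>\<^bsub>F Y\<^esub>"
    using linear_maps_closed[OF h] by (auto simp: compose_def intro!: restrict_ext)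
  then show "(\<lambda>p\<in>carrier P. \<zero>\<^bsub>Q\<^esub>) (\<eta> h) = \<zeta> (compose (carrier E) (\<lambda>x\<in>carrier W. \<zero>\<^bsub>Y\<^esub>) h)"
    using represents_closed[OF assms(1) h]
      linear_maps_zero[OF abelian_group_hom_module[OF left_E representsD(1)[OF assms(2)]]
        left_module_group[OF representsD(2)[OF assms(2)]] representsD(3)[OF assms(2)]]
    by simp
qed (use representsD[OF assms(1)] representsD[OF assms(2)] in auto)

lemma rmap_eq_zero_iff:
  assumes "rep W P \<eta>" "rep Y Q \<zeta>" "f \<in> linear_maps \<Lambda> W Y"
  shows "rmap W P \<eta> \<zeta> f = (\<lambda>p\<in>carrier P. \<zero>\<^bsub>Q\<^esub>) \<longleftrightarrow> f = (\<lambda>x\<in>carrier W. \<zero>\<^bsub>Y\<^esub>)"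
  using rmap_zero[OF assms(1,2)] rmap_inj[OF assms(1,2,3)]
    linear_maps_const_zero[OF representsD(1)[OF assms(1)] representsD(1)[OF assms(2)]] by metis

lemma rmap_eq_id_iff:
  assumes "rep W P \<eta>" "f \<in> linear_maps \<Lambda> W W"
  shows "rmap W P \<eta> \<eta> f = (\<lambda>p\<in>carrier P. p) \<longleftrightarrow> f = (\<lambda>x\<in>carrier W. x)"
  using rmap_id[OF assms(1)] rmap_inj[OF assms(1,1,2) linear_maps_id[OF representsD(1)[OF assms(1)]]]
  by metis

lemma rmap_bij_iff:
  assumes "rep W P \<eta>" "rep Y Q \<zeta>" "f \<in> linear_maps \<Lambda> W Y"
  shows "bij_betw (rmap W P \<eta> \<zeta> f) (carrier P) (carrier Q) \<longleftrightarrow> bij_betw f (carrier W) (carrier Y)"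
proof -
  note W = representsD[OF assms(1)] and Y = representsD[OF assms(2)]
  note c = rmap_compose[OF assms(1,2,1) assms(3)] rmap_compose[OF assms(2,1,2) _ assms(3)]
  note l = linear_maps_compose[OF W(1) assms(3)] linear_maps_compose[OF Y(1) _ assms(3)]
  show ?thesis
    unfolding bij_iff_inverse[OF W(1) Y(1) assms(3)]
      bij_iff_inverse[OF W(2) Y(2) rmap_linear[OF assms]]
  proof
    assume "\<exists>g\<in>linear_maps \<Lambda> Y W. compose (carrier W) g f = (\<lambda>x\<in>carrier W. x) \<and>
      compose (carrier Y) f g = (\<lambda>y\<in>carrier Y. y)"
    then obtain g where g: "g \<in> linear_maps \<Lambda> Y W" "compose (carrier W) g f = (\<lambda>x\<in>carrier W. x)"
      "compose (carrier Y) f g = (\<lambda>y\<in>carrier Y. y)" by blast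
    then show "\<exists>g\<in>linear_maps \<Gamma> Q P. compose (carrier P) g (rmap W P \<eta> \<zeta> f) = (\<lambda>x\<in>carrier P. x) \<and>
      compose (carrier Q) (rmap W P \<eta> \<zeta> f) g = (\<lambda>y\<in>carrier Q. y)"
      by (intro bexI[OF _ rmap_linear[OF assms(2,1) g(1)]])
        (simp add: c rmap_id[OF assms(1)] rmap_id[OF assms(2)])
  next
    assume "\<exists>g\<in>linear_maps \<Gamma> Q P. compose (carrier P) g (rmap W P \<eta> \<zeta> f) = (\<lambda>x\<in>carrier P. x) \<and>
      compose (carrier Q) (rmap W P \<eta> \<zeta> f) g = (\<lambda>y\<in>carrier Q. y)"
    then obtain g' where g': "g' \<in> linear_maps \<Gamma> Q P" "compose (carrier P) g' (rmap W P \<eta> \<zeta> f) = (\<lambda>x\<in>carrier P. x)"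
      "compose (carrier Q) (rmap W P \<eta> \<zeta> f) g' = (\<lambda>y\<in>carrier Q. y)" by blast
    obtain g where g: "g \<in> linear_maps \<Lambda> Y W" "g' = rmap Y Q \<zeta> \<eta> g"
      by (rule rmap_full[OF assms(2,1) g'(1)], rule that)
    show "\<exists>g\<in>linear_maps \<Lambda> Y W. compose (carrier W) g f = (\<lambda>x\<in>carrier W. x) \<and>
      compose (carrier Y) f g = (\<lambda>y\<in>carrier Y. y)"
      using g' l[OF g(1)] c(1)[OF g(1)] c(2)[OF g(1)] rmap_eq_id_iff[OF assms(1)] rmap_eq_id_iff[OF assms(2)]
      by (intro bexI[OF _ g(1)]) (simp add: g(2))
  qed
qed

end

section \<open>Exactness and images under \<open>Hom(E, -)\<close>\<close>

lemma exact_at_iff: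
  "exact_at Q Y Z f g \<longleftrightarrow> f ` carrier Q = {y \<in> carrier Y. g y = \<zero>\<^bsub>Z\<^esub>}"
  by (simp add: exact_at_def a_kernel_def')

context generator_module
begin

lemma rmap_image:
  assumes "rep W P \<eta>" "rep Y Q \<zeta>"
  shows "rmap W P \<eta> \<zeta> ` linear_maps \<Lambda> W Y = linear_maps \<Gamma> P Q"
  using rmap_linear[OF assms] rmap_full[OF assms] by blast

lemma rmap_inj_on:
  assumes "rep W P \<eta>" "rep Y Q \<zeta>"
  shows "inj_on (rmap W P \<eta> \<zeta>) (linear_maps \<Lambda> W Y)"
  using rmap_inj[OF assms] by (auto intro: inj_onI)

lemma represents_image_eq:
  "rep W P \<eta> \<Longrightarrow> \<eta> ` linear_maps \<Lambda> E W = carrier P"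
  using bij_betw_imp_surj_on[OF representsD(4)] .

lemma represents_zero:
  assumes "rep W P \<eta>"
  shows "\<eta> (\<lambda>e\<in>carrier E. \<zero>\<^bsub>W\<^esub>) = \<zero>\<^bsub>P\<^esub>"
  using linear_maps_zero[OF abelian_group_hom_module[OF left_E representsD(1)[OF assms]]
      left_module_group[OF representsD(2)[OF assms]] representsD(3)[OF assms]] by simp

lemma represents_eq_zero_iff:
  assumes "rep W P \<eta>" "h \<in> linear_maps \<Lambda> E W"
  shows "\<eta> h = \<zero>\<^bsub>P\<^esub> \<longleftrightarrow> h = (\<lambda>e\<in>carrier E. \<zero>\<^bsub>W\<^esub>)"
  using represents_zero[OF assms(1)] represents_inj[OF assms]
    linear_maps_const_zero[OF left_E representsD(1)[OF assms(1)]] by metis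

lemma exact_at_rmap_iff:
  assumes "rep W P \<eta>" "rep Y Q \<zeta>" "rep Z S \<theta>" "f \<in> linear_maps \<Lambda> W Y" "f' \<in> linear_maps \<Lambda> Y Z"
  shows "exact_at P Q S (rmap W P \<eta> \<zeta> f) (rmap Y Q \<zeta> \<theta> f') \<longleftrightarrow>
    exact_at (Hom \<Lambda> E W) (Hom \<Lambda> E Y) (Hom \<Lambda> E Z) (postcomp E f) (postcomp E f')"
proof -
  have "rmap W P \<eta> \<zeta> f ` carrier P = \<zeta> ` postcomp E f ` linear_maps \<Lambda> E W"
    unfolding represents_image_eq[OF assms(1), symmetric] image_image
    by (intro image_cong) (auto simp: rmap_apply[OF assms(1)] postcomp_def)
  moreover have "{q \<in> carrier Q. rmap Y Q \<zeta> \<theta> f' q = \<zero>\<^bsub>S\<^esub>}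
      = \<zeta> ` {h \<in> linear_maps \<Lambda> E Y. postcomp E f' h = (\<lambda>e\<in>carrier E. \<zero>\<^bsub>Z\<^esub>)}"
    unfolding represents_image_eq[OF assms(2), symmetric]
    by (auto simp: rmap_apply[OF assms(2)] postcomp_def represents_zero[OF assms(3)]
        represents_eq_zero_iff[OF assms(3) compose_E[OF assms(5)]])
  moreover have "postcomp E f ` linear_maps \<Lambda> E W \<subseteq> linear_maps \<Lambda> E Y"
    by (auto simp: postcomp_def compose_E[OF assms(4)])
  moreover have "inj_on \<zeta> (linear_maps \<Lambda> E Y)"
    using representsD(4)[OF assms(2)] by (simp add: bij_betw_def)
  ultimately show ?thesis
    by (simp add: exact_at_iff inj_on_image_eq_iff[of \<zeta> "linear_maps \<Lambda> E Y"])
qed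

lemma exact_at_contravariant_iff:
  assumes "rep W P \<eta>" "rep Y Q \<zeta>" "rep Z S \<theta>" "rep V T \<xi>"
    and "f \<in> linear_maps \<Lambda> W Y" "f' \<in> linear_maps \<Lambda> Y Z"
  shows "exact_at (Hom \<Gamma> S T) (Hom \<Gamma> Q T) (Hom \<Gamma> P T)
      (precomp Q (rmap Y Q \<zeta> \<theta> f')) (precomp P (rmap W P \<eta> \<zeta> f)) \<longleftrightarrow>
    exact_at (Hom \<Lambda> Z V) (Hom \<Lambda> Y V) (Hom \<Lambda> W V) (precomp Y f') (precomp W f)"
proof -
  let ?r = "rmap Y Q \<zeta> \<xi>"
  have "precomp Q (rmap Y Q \<zeta> \<theta> f') ` linear_maps \<Gamma> S T = ?r ` precomp Y f' ` linear_maps \<Lambda> Z V"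
    unfolding rmap_image[OF assms(3,4), symmetric] image_image
    by (intro image_cong) (auto simp: precomp_def rmap_compose[OF assms(2,3,4,6)])
  moreover have "{g \<in> linear_maps \<Gamma> Q T. precomp P (rmap W P \<eta> \<zeta> f) g = (\<lambda>p\<in>carrier P. \<zero>\<^bsub>T\<^esub>)}
      = ?r ` {g \<in> linear_maps \<Lambda> Y V. precomp W f g = (\<lambda>x\<in>carrier W. \<zero>\<^bsub>V\<^esub>)}"
    unfolding rmap_image[OF assms(2,4), symmetric]
    by (auto simp: precomp_def rmap_compose[OF assms(1,2,4,5)] rmap_zero[OF assms(1,4)]
        rmap_eq_zero_iff[OF assms(1,4) linear_maps_compose[OF representsD(1)[OF assms(1)] assms(5)]])
  moreover have "precomp Y f' ` linear_maps \<Lambda> Z V \<subseteq> linear_maps \<Lambda> Y V"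
    by (auto simp: precomp_def linear_maps_compose[OF representsD(1)[OF assms(2)] assms(6)])
  ultimately show ?thesis
    by (simp add: exact_at_iff inj_on_image_eq_iff[OF rmap_inj_on[OF assms(2,4)]])
qed

lemma precomp_surj_iff:
  assumes "rep W P \<eta>" "rep Y Q \<zeta>" "rep V T \<xi>" "f \<in> linear_maps \<Lambda> W Y"
  shows "precomp P (rmap W P \<eta> \<zeta> f) ` linear_maps \<Gamma> Q T = linear_maps \<Gamma> P T \<longleftrightarrow>
    precomp W f ` linear_maps \<Lambda> Y V = linear_maps \<Lambda> W V"
proof -
  have "precomp P (rmap W P \<eta> \<zeta> f) ` linear_maps \<Gamma> Q T
      = rmap W P \<eta> \<xi> ` precomp W f ` linear_maps \<Lambda> Y V"
    unfolding rmap_image[OF assms(2,3), symmetric] image_image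
    by (intro image_cong) (auto simp: precomp_def rmap_compose[OF assms(1,2,3,4)])
  moreover have "precomp W f ` linear_maps \<Lambda> Y V \<subseteq> linear_maps \<Lambda> W V"
    by (auto simp: precomp_def linear_maps_compose[OF representsD(1)[OF assms(1)] assms(4)])
  ultimately show ?thesis
    unfolding rmap_image[OF assms(1,3), symmetric]
    by (simp add: inj_on_image_eq_iff[OF rmap_inj_on[OF assms(1,3)]])
qed

text \<open>
  An element \<open>y\<close> in the kernel of \<open>f'\<close> gives maps \<open>e \<mapsto> \<pi>(e) y\<close> into that kernel.  They lift along
  \<open>f\<close>, so their values lie in the image of \<open>f\<close>, and so does \<open>y\<close>.
\<close>

lemma exact_at_reflect:
  assumes "left_module \<Lambda> W" "left_module \<Lambda> Y" "left_module \<Lambda> Z"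
    and "f \<in> linear_maps \<Lambda> W Y" "f' \<in> linear_maps \<Lambda> Y Z"
    and "exact_at (Hom \<Lambda> E W) (Hom \<Lambda> E Y) (Hom \<Lambda> E Z) (postcomp E f) (postcomp E f')"
  shows "exact_at W Y Z f f'"
proof -
  interpret W: left_module \<Lambda> W by fact
  interpret Y: left_module \<Lambda> Y by fact
  interpret Z: left_module \<Lambda> Z by fact
  have ex: "(\<lambda>k. compose (carrier E) f k) ` linear_maps \<Lambda> E W
      = {h \<in> linear_maps \<Lambda> E Y. compose (carrier E) f' h = (\<lambda>e\<in>carrier E. \<zero>\<^bsub>Z\<^esub>)}"
    using assms(6) by (simp add: exact_at_iff postcomp_def)
  have zero: "compose (carrier W) f' f = (\<lambda>x\<in>carrier W. \<zero>\<^bsub>Z\<^esub>)"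
  proof (rule F_faithful[OF assms(1,3) linear_maps_compose[OF assms(1,4,5)] linear_maps_const_zero[OF assms(1,3)]])
    fix h assume h: "h \<in> linear_maps \<Lambda> E W"
    have "compose (carrier E) f' (compose (carrier E) f h) = (\<lambda>e\<in>carrier E. \<zero>\<^bsub>Z\<^esub>)"
      using ex h by blast
    also have "\<dots> = compose (carrier E) (\<lambda>x\<in>carrier W. \<zero>\<^bsub>Z\<^esub>) h"
      using linear_maps_closed[OF h] by (auto simp: compose_def intro!: restrict_ext)
    finally show "compose (carrier E) (compose (carrier W) f' f) h = compose (carrier E) (\<lambda>x\<in>carrier W. \<zero>\<^bsub>Z\<^esub>) h"
      by (simp only: compose_linear_assoc[OF h])
  qed
  have ker: "y \<in> f ` carrier W" if y: "y \<in> carrier Y" "f' y = \<zero>\<^bsub>Z\<^esub>" for y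
  proof (rule generator_detects[OF assms(2) submodule_image[OF assms(1,2,4)] y(1)])
    fix \<pi> u assume \<pi>: "\<pi> \<in> linear_maps \<Lambda> E (regular_module \<Lambda>)" and u: "u \<in> carrier E"
    let ?h = "\<lambda>e\<in>carrier E. \<pi> e \<odot>\<^bsub>Y\<^esub> y"
    have h: "?h \<in> linear_maps \<Lambda> E Y" by (rule trace_map[OF assms(2) \<pi> y(1)])
    have "f' (\<pi> e \<odot>\<^bsub>Y\<^esub> y) = \<zero>\<^bsub>Z\<^esub>" if "e \<in> carrier E" for e
      using linear_maps_closed[OF \<pi> that] y
      by (simp add: linear_maps_smult[OF assms(5)] left_module_smult_zero[OF assms(3)])
    then have "compose (carrier E) f' ?h = (\<lambda>e\<in>carrier E. \<zero>\<^bsub>Z\<^esub>)"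
      by (auto simp: compose_def intro!: restrict_ext)
    then obtain k where k: "k \<in> linear_maps \<Lambda> E W" "?h = compose (carrier E) f k"
      using ex h by blast
    show "?h u \<in> f ` carrier W"
      unfolding k(2) using linear_maps_closed[OF k(1) u] by (simp add: compose_eq u)
  qed
  have "f' (f x) = \<zero>\<^bsub>Z\<^esub>" if "x \<in> carrier W" for x
    using fun_cong[OF zero, of x] that by (simp add: compose_eq)
  then show ?thesis
    using ker linear_maps_closed[OF assms(4)] by (auto simp: exact_at_iff)
qed

text \<open>
  \<open>Hom(E, E)\<close> is the regular module.  Together with full faithfulness this identifies
  \<open>Hom(-, E)\<close> with \<open>Hom(-, \<Gamma>)\<close>.
\<close>

lemma represents_self: "rep E (regular_module \<Gamma>) (\<lambda>h\<in>linear_maps \<Lambda> E E. h)"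
proof -
  have "(\<lambda>h\<in>carrier (F E). h) \<in> linear_maps \<Gamma> (F E) (regular_module \<Gamma>)"
    by (rule linear_maps_restrictI[OF left_module_hom_module[OF left_E left_E]]) auto
  then show ?thesis
    by (simp add: represents_def left_E left_module_regular[OF ring_\<Gamma>] bij_betw_def inj_on_def)
qed

lemma represents_iso_target:
  assumes "rep W P \<eta>" "left_module \<Gamma> P'" "g \<in> linear_maps \<Gamma> P P'" "bij_betw g (carrier P) (carrier P')"
  shows "rep W P' (compose (linear_maps \<Lambda> E W) g \<eta>)"
  using linear_maps_compose[OF left_module_hom_module[OF left_E representsD(1)[OF assms(1)]]
      representsD(3)[OF assms(1)] assms(3)] bij_betw_compose[OF representsD(4)[OF assms(1)] assms(4)]
    representsD(1)[OF assms(1)] assms(2)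
  by (simp add: represents_def)

lemma represents_iso_source:
  assumes "rep W P \<eta>" "left_module \<Lambda> W'" "f \<in> linear_maps \<Lambda> W' W" "bij_betw f (carrier W') (carrier W)"
  shows "rep W' P (compose (linear_maps \<Lambda> E W') \<eta> (\<lambda>h\<in>linear_maps \<Lambda> E W'. compose (carrier E) f h))"
proof -
  note W = representsD(1)[OF assms(1)]
  let ?f = "\<lambda>h\<in>linear_maps \<Lambda> E W'. compose (carrier E) f h"
  have Ff: "?f \<in> linear_maps \<Gamma> (F W') (F W)" by (rule F_map[OF assms(2,3)])
  have bij: "bij_betw ?f (linear_maps \<Lambda> E W') (linear_maps \<Lambda> E W)"
    unfolding bij_betw_def
  proof
    show "inj_on ?f (linear_maps \<Lambda> E W')"
    proof (rule inj_onI)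
      fix h h' assume h: "h \<in> linear_maps \<Lambda> E W'" "h' \<in> linear_maps \<Lambda> E W'" "?f h = ?f h'"
      then have eq: "compose (carrier E) f h = compose (carrier E) f h'" by simp
      show "h = h'"
      proof (rule linear_maps_ext[OF h(1,2)])
        fix e assume e: "e \<in> carrier E"
        then show "h e = h' e"
          using fun_cong[OF eq, of e] linear_maps_closed[OF h(1) e] linear_maps_closed[OF h(2) e]
            bij_betw_imp_inj_on[OF assms(4)] by (simp add: compose_eq inj_on_eq_iff)
      qed
    qed
    let ?i = "\<lambda>y\<in>carrier W. inv_into (carrier W') f y"
    note i = linear_maps_inverse[OF assms(2) W assms(3,4)]
    have "h \<in> ?f ` linear_maps \<Lambda> E W'" if h: "h \<in> linear_maps \<Lambda> E W" for h
    proof (rule image_eqI)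
      show ih: "compose (carrier E) ?i h \<in> linear_maps \<Lambda> E W'" by (rule compose_E[OF i h])
      show "h = ?f (compose (carrier E) ?i h)"
      proof (rule linear_maps_ext[OF h])
        show "?f (compose (carrier E) ?i h) \<in> linear_maps \<Lambda> E W"
          using compose_E[OF assms(3) ih] ih by simp
        fix e assume e: "e \<in> carrier E"
        then show "h e = ?f (compose (carrier E) ?i h) e"
          using ih linear_maps_closed[OF h e] bij_betw_inv_into_right[OF assms(4)]
          by (simp add: compose_eq)
      qed
    qed
    then show "?f ` linear_maps \<Lambda> E W' = linear_maps \<Lambda> E W"
      using compose_E[OF assms(3)] by auto
  qed
  show ?thesis
    using linear_maps_compose[OF left_module_hom_module[OF left_E assms(2)] Ff representsD(3)[OF assms(1)]]
      bij_betw_compose[OF bij representsD(4)[OF assms(1)]] assms(2) representsD(2)[OF assms(1)]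
    by (simp add: represents_def)
qed

text \<open>
  Taking images does not commute with \<open>Hom(E, -)\<close> in general; the assumption that maps from \<open>E\<close> into
  the image lift along \<open>f\<close> is what makes it do so.
\<close>

lemma represents_image:
  assumes "rep W P \<eta>" "rep Y Q \<zeta>" "f \<in> linear_maps \<Lambda> W Y"
    and lift: "\<And>h. h \<in> linear_maps \<Lambda> E (image_module W Y f) \<Longrightarrow>
      \<exists>k\<in>linear_maps \<Lambda> E W. h = compose (carrier E) f k"
  shows "rep (image_module W Y f) (image_module P Q (rmap W P \<eta> \<zeta> f))
    (\<lambda>h\<in>linear_maps \<Lambda> E (image_module W Y f). \<zeta> h)"
proof -
  note W = representsD[OF assms(1)] and Y = representsD[OF assms(2)]
  note r = rmap_linear[OF assms(1-3)]
  let ?I = "image_module W Y f" and ?J = "image_module P Q (rmap W P \<eta> \<zeta> f)"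
  have I: "left_module \<Lambda> ?I" by (rule left_module_image[OF W(1) Y(1) assms(3)])
  have J: "left_module \<Gamma> ?J" by (rule left_module_image[OF W(2) Y(2) r])
  have sub: "linear_maps \<Lambda> E ?I \<subseteq> linear_maps \<Lambda> E Y"
    using linear_maps_closed[OF assms(3)] unfolding image_module_def by (auto intro: linear_maps_enlarge)
  have "\<zeta> ` linear_maps \<Lambda> E ?I = \<zeta> ` compose (carrier E) f ` linear_maps \<Lambda> E W"
    using lift compose_E[OF linear_maps_image_module[OF assms(3)]] by blast
  also have "\<dots> = rmap W P \<eta> \<zeta> f ` carrier P"
    unfolding represents_image_eq[OF assms(1), symmetric] image_image
    by (intro image_cong) (auto simp: rmap_apply[OF assms(1)])
  finally have im: "\<zeta> ` linear_maps \<Lambda> E ?I = carrier ?J" by (simp add: image_module_def)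
  have "inj_on \<zeta> (linear_maps \<Lambda> E ?I)"
    by (rule inj_on_subset[OF bij_betw_imp_inj_on[OF representsD(4)[OF assms(2)]] sub])
  then have bij: "bij_betw (\<lambda>h\<in>linear_maps \<Lambda> E ?I. \<zeta> h) (linear_maps \<Lambda> E ?I) (carrier ?J)"
    using im by (simp add: bij_betw_def)
  have "(\<lambda>h\<in>carrier (F ?I). \<zeta> h) \<in> linear_maps \<Gamma> (F ?I) ?J"
  proof (rule linear_maps_restrictI[OF left_module_hom_module[OF left_E I]])
    fix h h' assume "h \<in> carrier (F ?I)" "h' \<in> carrier (F ?I)"
    then have "h \<in> carrier (F Y)" "h' \<in> carrier (F Y)" using sub by auto
    then show "\<zeta> (h \<oplus>\<^bsub>F ?I\<^esub> h') = \<zeta> h \<oplus>\<^bsub>?J\<^esub> \<zeta> h'"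
      using linear_maps_add[OF Y(3), of h h'] by (simp add: image_module_def)
  next
    fix \<gamma> h assume "\<gamma> \<in> carrier \<Gamma>" "h \<in> carrier (F ?I)"
    then have "\<gamma> \<in> carrier \<Gamma>" "h \<in> carrier (F Y)" using sub by auto
    then show "\<zeta> (\<gamma> \<odot>\<^bsub>F ?I\<^esub> h) = \<gamma> \<odot>\<^bsub>?J\<^esub> \<zeta> h"
      using linear_maps_smult[OF Y(3), of \<gamma> h] by (simp add: image_module_def)
  qed (use im in auto)
  then show ?thesis
    using I J bij by (simp add: represents_def)
qed

end

section \<open>\<open>add E\<close> and the projective \<open>\<Gamma>\<close>-modules\<close>

context generator_module
begin

text \<open>
  Apply the functor to a factorization of the identity of \<open>W\<close> through \<open>E\<^sup>n\<close>; it becomes a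
  factorization of the identity of \<open>P\<close> through \<open>\<Gamma>\<^sup>n\<close>.
\<close>

lemma summand_of_copies_represented:
  assumes "rep W P \<eta>" "summand_of_copies \<Lambda> E W"
  shows "summand_of_copies \<Gamma> (regular_module \<Gamma>) P"
proof -
  note W = representsD[OF assms(1)] and self = represents_self
  let ?id = "\<lambda>h\<in>linear_maps \<Lambda> E E. h" and ?G = "regular_module \<Gamma>"
  obtain n :: nat and s r where s: "\<And>j. j < n \<Longrightarrow> s j \<in> linear_maps \<Lambda> W E"
    and r: "\<And>j. j < n \<Longrightarrow> r j \<in> linear_maps \<Lambda> E W"
    and sum: "\<And>x. x \<in> carrier W \<Longrightarrow> x = (\<Oplus>\<^bsub>W\<^esub>j\<in>{..<n}. r j (s j x))"
    using assms(2) unfolding summand_of_copies_def by blast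
  interpret P: left_module \<Gamma> P by (rule W(2))
  interpret W: left_module \<Lambda> W by (rule W(1))
  let ?s = "\<lambda>j. rmap W P \<eta> ?id (s j)" and ?r = "\<lambda>j. rmap E ?G ?id \<eta> (r j)"
  show ?thesis
  proof (rule summand_of_copiesI[of n ?s _ _ _ ?r])
    fix p assume "p \<in> carrier P"
    then obtain h where h: "h \<in> linear_maps \<Lambda> E W" "p = \<eta> h" by (rule represents_surj[OF assms(1)])
    let ?k = "\<lambda>j. compose (carrier E) (compose (carrier W) (r j) (s j)) h"
    have k: "?k j \<in> linear_maps \<Lambda> E W" if "j < n" for j
      using compose_E[OF linear_maps_compose[OF W(1) s[OF that] r[OF that]] h(1)] .
    have "?r j (?s j p) = \<eta> (?k j)" if "j < n" for j
      using fun_cong[OF rmap_compose[OF assms(1) self assms(1) s[OF that] r[OF that]], of "\<eta> h"]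
      by (simp only: h(2) compose_eq[OF represents_closed[OF assms(1) h(1)]] rmap_apply[OF assms(1) h(1)])
    then have "(\<Oplus>\<^bsub>P\<^esub>j\<in>{..<n}. ?r j (?s j p)) = (\<Oplus>\<^bsub>P\<^esub>j\<in>{..<n}. \<eta> (?k j))"
      using represents_closed[OF assms(1) k] by (intro P.M.finsum_cong') auto
    also have "\<dots> = \<eta> (finsum (F W) ?k {..<n})"
      by (rule linear_maps_finsum[OF W(3) abelian_group_hom_module[OF left_E W(1)] P.M.abelian_group_axioms, symmetric])
        (use k in auto)
    also have "finsum (F W) ?k {..<n} = h"
    proof (rule linear_maps_ext[of _ \<Lambda> E W, OF _ h(1)])
      interpret FW: abelian_group "F W" by (rule abelian_group_hom_module[OF left_E W(1)])
      show "finsum (F W) ?k {..<n} \<in> linear_maps \<Lambda> E W"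
        using FW.finsum_closed[of ?k "{..<n}"] k by auto
      fix e assume e: "e \<in> carrier E"
      have he: "h e \<in> carrier W" by (rule linear_maps_closed[OF h(1) e])
      have "finsum (F W) ?k {..<n} e = (\<Oplus>\<^bsub>W\<^esub>j\<in>{..<n}. ?k j e)"
        by (rule additive_finsum[OF FW.abelian_group_axioms W.M.abelian_group_axioms, where f = "\<lambda>h. h e"])
          (use e k linear_maps_closed[of _ \<Lambda> E W] in auto)
      also have "\<dots> = (\<Oplus>\<^bsub>W\<^esub>j\<in>{..<n}. r j (s j (h e)))"
        using e he linear_maps_closed[OF r linear_maps_closed[OF s]]
        by (intro W.M.finsum_cong') (auto simp: compose_eq)
      finally show "finsum (F W) ?k {..<n} e = h e" by (rule trans[OF _ sum[OF he, symmetric]])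
    qed
    finally show "p = (\<Oplus>\<^bsub>P\<^esub>j\<in>{..<n}. ?r j (?s j p))" unfolding h(2) by (rule sym)
  qed (use rmap_linear[OF assms(1) self s] rmap_linear[OF self assms(1) r] in auto)
qed

text \<open>
  Let \<open>s, b\<close> be a dual basis of \<open>P\<close>.  The endomorphisms \<open>s\<^sub>j(b\<^sub>k)\<close> of \<open>E\<close> form an idempotent matrix
  acting on \<open>E\<^sup>n\<close>, and \<open>W\<close> is its image, the tuples fixed by it.  A map \<open>E \<rightarrow> W\<close> is then a tuple of
  endomorphisms \<open>\<gamma>\<^sub>k\<close> of \<open>E\<close> with \<open>\<gamma>\<^sub>j\<close> the sum of the \<open>s\<^sub>j(b\<^sub>k) \<gamma>\<^sub>k\<close>; these are exactly the
  coordinate tuples of elements of \<open>P\<close>.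
\<close>

lemma summand_of_regular_representable:
  fixes P :: "('e \<Rightarrow> 'e, 'n) module"
  assumes "left_module \<Gamma> P" "summand_of_copies \<Gamma> (regular_module \<Gamma>) P"
  obtains W :: "('a, nat \<Rightarrow> 'e) module" and n \<eta> where "rep W P \<eta>" "summand_of_copies \<Lambda> E W"
    "carrier W \<subseteq> {..<n} \<rightarrow>\<^sub>E carrier E"
proof -
  interpret P: left_module \<Gamma> P by fact
  interpret E: left_module \<Lambda> E by (rule left_E)
  let ?G = "regular_module \<Gamma>"
  obtain n :: nat and s b where s: "\<And>j. j < n \<Longrightarrow> s j \<in> linear_maps \<Gamma> P ?G"
    and b: "\<And>j. j < n \<Longrightarrow> b j \<in> carrier P"
    and expand: "\<And>p. p \<in> carrier P \<Longrightarrow> p = (\<Oplus>\<^bsub>P\<^esub>j\<in>{..<n}. s j p \<odot>\<^bsub>P\<^esub> b j)"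
    by (rule dual_basis[OF assms], rule that)
  let ?C = "copies n E"
  interpret C: left_module \<Lambda> ?C by (rule left_module_copies[OF left_E])
  have sc: "s j p \<in> linear_maps \<Lambda> E E" if "j < n" "p \<in> carrier P" for j p
    using linear_maps_closed[OF s[OF that(1)] that(2)] by simp
  \<comment> \<open>The \<open>j\<close>-th coordinate of \<open>\<gamma>\<^sub>0 b\<^sub>0 + \<dots> + \<gamma>\<^sub>n\<^sub>-\<^sub>1 b\<^sub>n\<^sub>-\<^sub>1\<close> is given by row \<open>j\<close> of the matrix; products in \<open>\<Gamma>\<close> are reversed composites.\<close>
  have s_expand: "s j (\<Oplus>\<^bsub>P\<^esub>k\<in>{..<n}. \<gamma> k \<odot>\<^bsub>P\<^esub> b k) e = (\<Oplus>\<^bsub>E\<^esub>k\<in>{..<n}. s j (b k) (\<gamma> k e))"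
    if j: "j < n" and \<gamma>: "\<And>k. k < n \<Longrightarrow> \<gamma> k \<in> linear_maps \<Lambda> E E" and e: "e \<in> carrier E" for j \<gamma> e
  proof -
    have t: "(\<lambda>k. \<gamma> k \<odot>\<^bsub>P\<^esub> b k) \<in> {..<n} \<rightarrow> carrier P"
      using \<gamma> b by (auto intro!: P.smult_closed)
    have G: "abelian_group ?G" by (rule left_module_group[OF left_module_regular[OF ring_\<Gamma>]])
    have "s j (\<Oplus>\<^bsub>P\<^esub>k\<in>{..<n}. \<gamma> k \<odot>\<^bsub>P\<^esub> b k) e = (\<Oplus>\<^bsub>?G\<^esub>k\<in>{..<n}. s j (\<gamma> k \<odot>\<^bsub>P\<^esub> b k)) e"
      by (rule fun_cong[OF linear_maps_finsum[OF s[OF j] P.M.abelian_group_axioms G t]])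
    also have "\<dots> = (\<Oplus>\<^bsub>E\<^esub>k\<in>{..<n}. s j (\<gamma> k \<odot>\<^bsub>P\<^esub> b k) e)"
      by (rule additive_finsum[OF G E.M.abelian_group_axioms, where f = "\<lambda>h. h e"])
        (use e sc[OF j] t linear_maps_closed[of _ \<Lambda> E E] in auto)
    also have "\<dots> = (\<Oplus>\<^bsub>E\<^esub>k\<in>{..<n}. s j (b k) (\<gamma> k e))"
      using e \<gamma> b linear_maps_closed[OF \<gamma> e] linear_maps_closed[OF sc[OF j b]]
      by (intro E.M.finsum_cong') (auto simp: linear_maps_smult[OF s[OF j]] compose_eq)
    finally show ?thesis .
  qed
  define U where "U = {v \<in> carrier ?C. \<forall>j<n. v j = (\<Oplus>\<^bsub>E\<^esub>k\<in>{..<n}. s j (b k) (v k))}"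
  define W where "W = ?C\<lparr>carrier := U\<rparr>"
  have m: "(\<lambda>v\<in>carrier ?C. \<Oplus>\<^bsub>E\<^esub>k\<in>{..<n}. s j (b k) (v k)) \<in> linear_maps \<Lambda> ?C E" if "j < n" for j
    by (rule copies_sum_map[OF left_E left_E sc[OF that b]])
  have U: "submodule U \<Lambda> ?C"
  proof (rule submoduleI_left[OF C.left_module_axioms])
    have "\<zero>\<^bsub>?C\<^esub> \<in> carrier ?C" by (rule C.M.zero_closed)
    moreover have "\<zero>\<^bsub>?C\<^esub> j = (\<Oplus>\<^bsub>E\<^esub>k\<in>{..<n}. s j (b k) (\<zero>\<^bsub>?C\<^esub> k))" if "j < n" for j
      using linear_maps_zero[OF C.M.abelian_group_axioms E.M.abelian_group_axioms m[OF that]]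
        C.M.zero_closed that by (simp del: C.M.zero_closed)
    ultimately show "\<zero>\<^bsub>?C\<^esub> \<in> U" unfolding U_def by blast
  next
    fix v w assume vw: "v \<in> U" "w \<in> U"
    then have c: "v \<in> carrier ?C" "w \<in> carrier ?C" "v \<oplus>\<^bsub>?C\<^esub> w \<in> carrier ?C"
      by (auto simp: U_def simp del: copies_simps)
    moreover have "(v \<oplus>\<^bsub>?C\<^esub> w) j = (\<Oplus>\<^bsub>E\<^esub>k\<in>{..<n}. s j (b k) ((v \<oplus>\<^bsub>?C\<^esub> w) k))" if "j < n" for j
      using linear_maps_add[OF m[OF that] c(1,2)] c vw that
      by (simp only: restrict_apply' U_def mem_Collect_eq) simp
    ultimately show "v \<oplus>\<^bsub>?C\<^esub> w \<in> U" unfolding U_def by blast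
  next
    fix a v assume av: "a \<in> carrier \<Lambda>" "v \<in> U"
    then have c: "v \<in> carrier ?C" "a \<odot>\<^bsub>?C\<^esub> v \<in> carrier ?C"
      by (auto simp: U_def C.smult_closed simp del: copies_simps)
    moreover have "(a \<odot>\<^bsub>?C\<^esub> v) j = (\<Oplus>\<^bsub>E\<^esub>k\<in>{..<n}. s j (b k) ((a \<odot>\<^bsub>?C\<^esub> v) k))" if "j < n" for j
      using linear_maps_smult[OF m[OF that] av(1) c(1)] c av that
      by (simp only: restrict_apply' U_def mem_Collect_eq) simp
    ultimately show "a \<odot>\<^bsub>?C\<^esub> v \<in> U" unfolding U_def by blast
  qed (auto simp: U_def)
  have LW: "left_module \<Lambda> W" unfolding W_def by (rule left_module_submodule[OF C.left_module_axioms U])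
  interpret W: left_module \<Lambda> W by (rule LW)
  have Wc: "carrier W = U" by (simp add: W_def)
  have vU: "v i \<in> carrier E" if "v \<in> U" "i < n" for v i using that by (auto simp: U_def PiE_iff)
  have sU: "(\<lambda>j\<in>{..<n}. s j p e) \<in> U" if p: "p \<in> carrier P" and e: "e \<in> carrier E" for p e
  proof -
    have "s j p e = (\<Oplus>\<^bsub>E\<^esub>k\<in>{..<n}. s j (b k) ((\<lambda>j\<in>{..<n}. s j p e) k))" if "j < n" for j
    proof -
      have "s j p e = s j (\<Oplus>\<^bsub>P\<^esub>k\<in>{..<n}. s k p \<odot>\<^bsub>P\<^esub> b k) e" 
        using expand[OF p] by (rule arg_cong[of _ _ "\<lambda>p. s j p e"])
      also have "\<dots> = (\<Oplus>\<^bsub>E\<^esub>k\<in>{..<n}. s j (b k) (s k p e))" by (rule s_expand[OF that sc[OF _ p] e])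
      also have "\<dots> = (\<Oplus>\<^bsub>E\<^esub>k\<in>{..<n}. s j (b k) ((\<lambda>j\<in>{..<n}. s j p e) k))"
        using linear_maps_closed[OF sc[OF that b] linear_maps_closed[OF sc[OF _ p] e]]
        by (intro E.M.finsum_cong') auto
      finally show ?thesis .
    qed
    then show ?thesis using linear_maps_closed[OF sc[OF _ p] e] by (auto simp: U_def)
  qed
  \<comment> \<open>The inverse of the representing isomorphism sends \<open>p\<close> to its tuple of coordinates.\<close>
  define \<epsilon> where "\<epsilon> = (\<lambda>p\<in>carrier P. \<lambda>e\<in>carrier E. \<lambda>j\<in>{..<n}. s j p e)"
  have \<epsilon>c: "\<epsilon> p \<in> linear_maps \<Lambda> E W" if p: "p \<in> carrier P" for p
  proof -
    have "(\<lambda>e\<in>carrier E. \<lambda>j\<in>{..<n}. s j p e) \<in> linear_maps \<Lambda> E W"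
      by (rule linear_maps_restrictI[OF left_E])
        (simp_all add: Wc sU[OF p], simp_all add: W_def linear_maps_add[OF sc[OF _ p]]
          linear_maps_smult[OF sc[OF _ p]] cong: restrict_cong)
    then show ?thesis using p by (simp add: \<epsilon>_def)
  qed
  have \<epsilon>: "\<epsilon> \<in> linear_maps \<Gamma> P (F W)"
    unfolding \<epsilon>_def
  proof (rule linear_maps_restrictI[OF assms(1)])
    fix p assume "p \<in> carrier P"
    then show "(\<lambda>e\<in>carrier E. \<lambda>j\<in>{..<n}. s j p e) \<in> carrier (F W)"
      using \<epsilon>c[of p] by (simp add: \<epsilon>_def)
  next
    fix p q assume pq: "p \<in> carrier P" "q \<in> carrier P"
    then show "(\<lambda>e\<in>carrier E. \<lambda>j\<in>{..<n}. s j (p \<oplus>\<^bsub>P\<^esub> q) e)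
        = (\<lambda>e\<in>carrier E. \<lambda>j\<in>{..<n}. s j p e) \<oplus>\<^bsub>F W\<^esub> (\<lambda>e\<in>carrier E. \<lambda>j\<in>{..<n}. s j q e)"
      by (simp add: W_def linear_maps_add[OF s] cong: restrict_cong)
  next
    fix \<gamma> p assume gp: "\<gamma> \<in> carrier \<Gamma>" "p \<in> carrier P"
    then show "(\<lambda>e\<in>carrier E. \<lambda>j\<in>{..<n}. s j (\<gamma> \<odot>\<^bsub>P\<^esub> p) e)
        = \<gamma> \<odot>\<^bsub>F W\<^esub> (\<lambda>e\<in>carrier E. \<lambda>j\<in>{..<n}. s j p e)"
      using linear_maps_closed[of \<gamma> \<Lambda> E E]
      by (simp add: compose_def linear_maps_smult[OF s] cong: restrict_cong)
  qed
  have bij: "bij_betw \<epsilon> (carrier P) (linear_maps \<Lambda> E W)"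
    unfolding bij_betw_def
  proof
    show "inj_on \<epsilon> (carrier P)"
    proof (rule inj_onI)
      fix p q assume pq: "p \<in> carrier P" "q \<in> carrier P" "\<epsilon> p = \<epsilon> q"
      have "s j p = s j q" if "j < n" for j
      proof (rule linear_maps_ext[OF sc[OF that pq(1)] sc[OF that pq(2)]])
        fix e assume "e \<in> carrier E"
        then show "s j p e = s j q e"
          using fun_cong[OF fun_cong[OF pq(3), of e], of j] pq(1,2) that by (simp add: \<epsilon>_def)
      qed
      then have "(\<Oplus>\<^bsub>P\<^esub>k\<in>{..<n}. s k p \<odot>\<^bsub>P\<^esub> b k) = (\<Oplus>\<^bsub>P\<^esub>k\<in>{..<n}. s k q \<odot>\<^bsub>P\<^esub> b k)"
        using sc[OF _ pq(2)] b P.smult_closed by (intro P.M.finsum_cong') auto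
      then show "p = q"
        unfolding expand[OF pq(1), symmetric] expand[OF pq(2), symmetric] .
    qed
    have "h \<in> \<epsilon> ` carrier P" if h: "h \<in> linear_maps \<Lambda> E W" for h
    proof (rule image_eqI)
      let ?h = "\<lambda>k. \<lambda>e\<in>carrier E. h e k"
      have hU: "h e \<in> U" if "e \<in> carrier E" for e using linear_maps_closed[OF h that] Wc by simp
      have hk: "?h k \<in> linear_maps \<Lambda> E E" if "k < n" for k
        by (rule linear_maps_restrictI[OF left_E])
          (use that vU[OF hU] in \<open>auto simp: linear_maps_add[OF h] linear_maps_smult[OF h] W_def\<close>)
      let ?p = "\<Oplus>\<^bsub>P\<^esub>k\<in>{..<n}. ?h k \<odot>\<^bsub>P\<^esub> b k"
      show p: "?p \<in> carrier P" using hk b by (auto intro!: P.M.finsum_closed P.smult_closed)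
      show "h = \<epsilon> ?p"
      proof (rule linear_maps_ext[OF h \<epsilon>c[OF p]])
        fix e assume e: "e \<in> carrier E"
        have "s j ?p e = h e j" if "j < n" for j
        proof -
          have "s j ?p e = (\<Oplus>\<^bsub>E\<^esub>k\<in>{..<n}. s j (b k) (?h k e))" by (rule s_expand[OF that hk e])
          also have "\<dots> = (\<Oplus>\<^bsub>E\<^esub>k\<in>{..<n}. s j (b k) (h e k))" using e by simp
          also have "\<dots> = h e j" using hU[OF e] that by (simp add: U_def)
          finally show ?thesis .
        qed
        then have "\<epsilon> ?p e = (\<lambda>j\<in>{..<n}. h e j)"
          using p e by (auto simp: \<epsilon>_def intro!: restrict_ext)
        also have "\<dots> = h e"
          using hU[OF e] by (auto simp: U_def PiE_iff intro!: extensionalityI[of _ "{..<n}"])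
        finally show "h e = \<epsilon> ?p e" ..
      qed
    qed
    then show "\<epsilon> ` carrier P = linear_maps \<Lambda> E W" using \<epsilon>c by blast
  qed
  have FW: "left_module \<Gamma> (F W)" by (rule left_module_hom_module[OF left_E LW])
  have bij': "bij_betw \<epsilon> (carrier P) (carrier (F W))" using bij by simp
  have "rep W P (\<lambda>h\<in>carrier (F W). inv_into (carrier P) \<epsilon> h)"
    using linear_maps_inverse[OF assms(1) FW \<epsilon> bij'] bij_betw_inv_into[OF bij] LW assms(1)
    by (simp add: represents_def cong: bij_betw_cong)
  moreover have "summand_of_copies \<Lambda> E W"
  proof (rule summand_of_copiesI[of n "\<lambda>j. \<lambda>v\<in>carrier W. v j" _ _ _ "\<lambda>j. \<epsilon> (b j)"])
    show "(\<lambda>v\<in>carrier W. v j) \<in> linear_maps \<Lambda> W E" if "j < n" for j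
      by (rule linear_maps_restrictI[OF LW]) (use that vU in \<open>auto simp: W_def\<close>)
    show "\<epsilon> (b j) \<in> linear_maps \<Lambda> E W" if "j < n" for j by (rule \<epsilon>c[OF b[OF that]])
    fix v assume v: "v \<in> carrier W"
    then have vc: "v \<in> U" by (simp add: Wc)
    let ?t = "\<lambda>j. \<epsilon> (b j) ((\<lambda>v\<in>carrier W. v j) v)"
    have t: "?t \<in> {..<n} \<rightarrow> carrier W"
      using v vU[OF vc] linear_maps_closed[OF \<epsilon>c[OF b]] by auto
    have fin: "finsum W ?t {..<n} \<in> U" using W.M.finsum_closed[OF t] Wc by simp
    show "v = finsum W ?t {..<n}"
    proof (rule PiE_ext)
      show "v \<in> {..<n} \<rightarrow>\<^sub>E carrier E" using vc by (simp add: U_def)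
      show "finsum W ?t {..<n} \<in> {..<n} \<rightarrow>\<^sub>E carrier E" using fin by (simp add: U_def)
      fix i assume i: "i \<in> {..<n}"
      have "finsum W ?t {..<n} i = (\<Oplus>\<^bsub>E\<^esub>j\<in>{..<n}. ?t j i)"
        by (rule additive_finsum[OF W.M.abelian_group_axioms E.M.abelian_group_axioms _ _ t, where f = "\<lambda>v. v i"])
          (use i vU in \<open>auto simp: Wc\<close>, use i in \<open>auto simp: W_def\<close>)
      also have "\<dots> = (\<Oplus>\<^bsub>E\<^esub>j\<in>{..<n}. s i (b j) (v j))"
        using i v b vU[OF vc] linear_maps_closed[OF sc[OF _ b]]
        by (intro E.M.finsum_cong') (auto simp: \<epsilon>_def)
      also have "\<dots> = v i" using vc i by (simp add: U_def)
      finally show "v i = finsum W ?t {..<n} i" ..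
    qed
  qed
  moreover have "carrier W \<subseteq> {..<n} \<rightarrow>\<^sub>E carrier E" by (auto simp: Wc U_def)
  ultimately show ?thesis by (rule that)
qed

end

section \<open>Separating functionals\<close>

text \<open>
  By Zorn's lemma there is a subspace \<open>M\<close> that contains \<open>H\<close>, avoids \<open>x\<close> and is maximal with these properties.
  Maximality makes \<open>M\<close> a complement of the line through \<open>x\<close>, and \<open>L\<close> is the coordinate along \<open>x\<close>.
\<close>

lemma separating_functional:
  assumes "field K" "left_module K V" "submodule H K V" "x \<in> carrier V" "x \<notin> H"
  obtains L where "L \<in> linear_maps K V (regular_module K)" "\<And>h. h \<in> H \<Longrightarrow> L h = \<zero>\<^bsub>K\<^esub>" "L x = \<one>\<^bsub>K\<^esub>"
proof -
  interpret K: field K by fact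
  interpret V: left_module K V by fact
  define \<A> where "\<A> = {M. submodule M K V \<and> H \<subseteq> M \<and> x \<notin> M}"
  have "\<exists>M\<in>\<A>. \<forall>N\<in>\<A>. M \<subseteq> N \<longrightarrow> N = M"
  proof (rule subset_Zorn_nonempty)
    show "\<A> \<noteq> {}" using assms by (auto simp: \<A>_def)
  next
    fix C assume C: "C \<noteq> {}" "subset.chain \<A> C"
    then have CA: "\<And>M. M \<in> C \<Longrightarrow> submodule M K V \<and> H \<subseteq> M \<and> x \<notin> M"
      and lin: "\<And>M N. M \<in> C \<Longrightarrow> N \<in> C \<Longrightarrow> M \<subseteq> N \<or> N \<subseteq> M"
      by (auto simp: \<A>_def subset.chain_def)
    obtain M0 where M0: "M0 \<in> C" using C by auto
    have "submodule (\<Union>C) K V"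
    proof (rule submoduleI_left[OF assms(2)])
      show "\<Union>C \<subseteq> carrier V" using CA submodule_subset[of _ K V] by blast
      show "\<zero>\<^bsub>V\<^esub> \<in> \<Union>C" using CA[OF M0] M0 submodule_zero[of M0 K V] by auto
    next
      fix u v assume "u \<in> \<Union>C" "v \<in> \<Union>C"
      then obtain M where "M \<in> C" "u \<in> M" "v \<in> M" using lin by blast
      then show "u \<oplus>\<^bsub>V\<^esub> v \<in> \<Union>C" using CA submodule_add[of M K V] by blast
    next
      fix a u assume "a \<in> carrier K" "u \<in> \<Union>C"
      then show "a \<odot>\<^bsub>V\<^esub> u \<in> \<Union>C" using CA submodule_smult[of _ K V] by blast
    qed
    then show "\<Union>C \<in> \<A>" using CA M0 by (auto simp: \<A>_def)
  qed
  then obtain M where MA: "M \<in> \<A>" and Mmax: "\<And>N. N \<in> \<A> \<Longrightarrow> M \<subseteq> N \<Longrightarrow> N = M"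
    by blast
  have M: "submodule M K V" "H \<subseteq> M" "x \<notin> M" using MA by (simp_all add: \<A>_def)
  have max: "N = M" if "submodule N K V" "M \<subseteq> N" "x \<notin> N" for N
    using that M(2) by (intro Mmax) (auto simp: \<A>_def)
  note Mc = subsetD[OF submodule_subset[OF M(1)]]
  note vc = V.smult_closed
  \<comment> \<open>By maximality, \<open>M\<close> together with \<open>x\<close> spans the whole space.\<close>
  have ex: "\<exists>c\<in>carrier K. v \<ominus>\<^bsub>V\<^esub> c \<odot>\<^bsub>V\<^esub> x \<in> M" if v: "v \<in> carrier V" for v
  proof (cases "v \<in> M")
    case True
    then show ?thesis
      using v assms(4) by (intro bexI[of _ "\<zero>\<^bsub>K\<^esub>"]) (simp_all add: left_module_zero_smult[OF assms(2)] a_minus_def)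
  next
    case False
    let ?N = "{m \<oplus>\<^bsub>V\<^esub> c \<odot>\<^bsub>V\<^esub> v | m c. m \<in> M \<and> c \<in> carrier K}"
    have "submodule ?N K V"
    proof (rule submoduleI_left[OF assms(2)])
      show "?N \<subseteq> carrier V" using Mc v vc by auto
      show "\<zero>\<^bsub>V\<^esub> \<in> ?N"
        using submodule_zero[OF M(1)] v by (auto intro!: exI[of _ "\<zero>\<^bsub>V\<^esub>"] exI[of _ "\<zero>\<^bsub>K\<^esub>"] simp: left_module_zero_smult[OF assms(2)])
    next
      fix y z assume "y \<in> ?N" "z \<in> ?N"
      then obtain m c m' c' where mc: "m \<in> M" "c \<in> carrier K" "y = m \<oplus>\<^bsub>V\<^esub> c \<odot>\<^bsub>V\<^esub> v"
        "m' \<in> M" "c' \<in> carrier K" "z = m' \<oplus>\<^bsub>V\<^esub> c' \<odot>\<^bsub>V\<^esub> v" by blast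
      then have "y \<oplus>\<^bsub>V\<^esub> z = (m \<oplus>\<^bsub>V\<^esub> m') \<oplus>\<^bsub>V\<^esub> (c \<oplus>\<^bsub>K\<^esub> c') \<odot>\<^bsub>V\<^esub> v"
        using Mc v vc by (simp add: V.smult_l_distr V.M.a_ac)
      then show "y \<oplus>\<^bsub>V\<^esub> z \<in> ?N" using mc submodule_add[OF M(1)] by blast
    next
      fix a y assume a: "a \<in> carrier K" and "y \<in> ?N"
      then obtain m c where mc: "m \<in> M" "c \<in> carrier K" "y = m \<oplus>\<^bsub>V\<^esub> c \<odot>\<^bsub>V\<^esub> v" by blast
      then have "a \<odot>\<^bsub>V\<^esub> y = a \<odot>\<^bsub>V\<^esub> m \<oplus>\<^bsub>V\<^esub> (a \<otimes>\<^bsub>K\<^esub> c) \<odot>\<^bsub>V\<^esub> v"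
        using Mc v vc a by (simp add: V.smult_r_distr V.smult_assoc1)
      then show "a \<odot>\<^bsub>V\<^esub> y \<in> ?N" using mc a submodule_smult[OF M(1)] by blast
    qed
    moreover have "M \<subseteq> ?N"
    proof
      fix m assume "m \<in> M"
      then show "m \<in> ?N" using Mc v
        by (auto intro!: exI[of _ m] exI[of _ "\<zero>\<^bsub>K\<^esub>"] simp: left_module_zero_smult[OF assms(2)])
    qed
    moreover have "v \<in> ?N"
      using v submodule_zero[OF M(1)] by (auto intro!: exI[of _ "\<zero>\<^bsub>V\<^esub>"] exI[of _ "\<one>\<^bsub>K\<^esub>"] simp: V.smult_one)
    ultimately have "x \<in> ?N" using max[of ?N] False by blast
    then obtain m c where mc: "m \<in> M" "c \<in> carrier K" "x = m \<oplus>\<^bsub>V\<^esub> c \<odot>\<^bsub>V\<^esub> v" by blast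
    have "c \<noteq> \<zero>\<^bsub>K\<^esub>" using mc M(3) Mc v by (auto simp: left_module_zero_smult[OF assms(2)])
    then have inv: "inv\<^bsub>K\<^esub> c \<in> carrier K" "inv\<^bsub>K\<^esub> c \<otimes>\<^bsub>K\<^esub> c = \<one>\<^bsub>K\<^esub>"
      using mc(2) K.field_Units by auto
    have "inv\<^bsub>K\<^esub> c \<odot>\<^bsub>V\<^esub> x = inv\<^bsub>K\<^esub> c \<odot>\<^bsub>V\<^esub> m \<oplus>\<^bsub>V\<^esub> v"
      using mc inv Mc[OF mc(1)] v by (simp add: V.smult_r_distr vc V.smult_assoc1[symmetric] V.smult_one)
    then have "v \<ominus>\<^bsub>V\<^esub> inv\<^bsub>K\<^esub> c \<odot>\<^bsub>V\<^esub> x = \<ominus>\<^bsub>V\<^esub> (inv\<^bsub>K\<^esub> c \<odot>\<^bsub>V\<^esub> m)"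
      using mc inv Mc[OF mc(1)] v vc
      by (simp add: a_minus_def V.M.minus_add V.M.a_comm[of "\<ominus>\<^bsub>V\<^esub> _" "\<ominus>\<^bsub>V\<^esub> v"] V.M.r_neg1 V.M.r_neg2)
    then show ?thesis
      using inv(1) submodule_minus[OF M(1) submodule_smult[OF M(1) inv(1) mc(1)]]
      by (intro bexI[of _ "inv\<^bsub>K\<^esub> c"]) auto
  qed
  have uniq: "c = c'" if c: "c \<in> carrier K" "c' \<in> carrier K" and v: "v \<in> carrier V"
    "v \<ominus>\<^bsub>V\<^esub> c \<odot>\<^bsub>V\<^esub> x \<in> M" "v \<ominus>\<^bsub>V\<^esub> c' \<odot>\<^bsub>V\<^esub> x \<in> M" for c c' v
  proof (rule ccontr)
    assume "c \<noteq> c'"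
    then have "c' \<ominus>\<^bsub>K\<^esub> c \<noteq> \<zero>\<^bsub>K\<^esub>" "c' \<ominus>\<^bsub>K\<^esub> c \<in> carrier K"
      using c K.minus_eq_zero_iff by auto
    then have inv: "inv\<^bsub>K\<^esub> (c' \<ominus>\<^bsub>K\<^esub> c) \<in> carrier K" "inv\<^bsub>K\<^esub> (c' \<ominus>\<^bsub>K\<^esub> c) \<otimes>\<^bsub>K\<^esub> (c' \<ominus>\<^bsub>K\<^esub> c) = \<one>\<^bsub>K\<^esub>"
      using K.field_Units by auto
    have m: "(\<ominus>\<^bsub>K\<^esub> c) \<odot>\<^bsub>V\<^esub> x = \<ominus>\<^bsub>V\<^esub> (c \<odot>\<^bsub>V\<^esub> x)"
    proof -
      have "(\<ominus>\<^bsub>K\<^esub> c) \<odot>\<^bsub>V\<^esub> x \<oplus>\<^bsub>V\<^esub> c \<odot>\<^bsub>V\<^esub> x = \<zero>\<^bsub>V\<^esub>"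
        using V.smult_l_distr[of "\<ominus>\<^bsub>K\<^esub> c" c x] c assms(4)
        by (simp add: K.l_neg left_module_zero_smult[OF assms(2)])
      then show ?thesis using c assms(4) vc by (simp add: V.M.minus_equality)
    qed
    have "(c' \<ominus>\<^bsub>K\<^esub> c) \<odot>\<^bsub>V\<^esub> x = (v \<ominus>\<^bsub>V\<^esub> c \<odot>\<^bsub>V\<^esub> x) \<ominus>\<^bsub>V\<^esub> (v \<ominus>\<^bsub>V\<^esub> c' \<odot>\<^bsub>V\<^esub> x)"
    proof -
      have cx: "c \<odot>\<^bsub>V\<^esub> x \<in> carrier V" "c' \<odot>\<^bsub>V\<^esub> x \<in> carrier V" using c assms(4) vc by auto
      have "(c' \<ominus>\<^bsub>K\<^esub> c) \<odot>\<^bsub>V\<^esub> x = c' \<odot>\<^bsub>V\<^esub> x \<ominus>\<^bsub>V\<^esub> c \<odot>\<^bsub>V\<^esub> x"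
        using c assms(4) by (simp add: a_minus_def V.smult_l_distr m)
      also have "\<dots> = (v \<ominus>\<^bsub>V\<^esub> c \<odot>\<^bsub>V\<^esub> x) \<ominus>\<^bsub>V\<^esub> (v \<ominus>\<^bsub>V\<^esub> c' \<odot>\<^bsub>V\<^esub> x)"
        using cx v(1) V.M.a_lcomm[of v "\<ominus>\<^bsub>V\<^esub> (c \<odot>\<^bsub>V\<^esub> x)" "\<ominus>\<^bsub>V\<^esub> v \<oplus>\<^bsub>V\<^esub> c' \<odot>\<^bsub>V\<^esub> x"]
        by (simp add: a_minus_def V.M.minus_add V.M.a_assoc V.M.r_neg1 V.M.r_neg2
            V.M.a_comm[of "c' \<odot>\<^bsub>V\<^esub> x" "\<ominus>\<^bsub>V\<^esub> (c \<odot>\<^bsub>V\<^esub> x)"])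
      finally show ?thesis .
    qed
    also have "\<dots> \<in> M"
      using v submodule_add[OF M(1)] submodule_minus[OF M(1)] by (simp add: a_minus_def[of V "_ \<ominus>\<^bsub>V\<^esub> _"])
    finally have "inv\<^bsub>K\<^esub> (c' \<ominus>\<^bsub>K\<^esub> c) \<odot>\<^bsub>V\<^esub> ((c' \<ominus>\<^bsub>K\<^esub> c) \<odot>\<^bsub>V\<^esub> x) \<in> M"
      by (rule submodule_smult[OF M(1) inv(1)])
    then show False
      using inv M(3) assms(4) c by (simp add: V.smult_assoc1[symmetric] V.smult_one)
  qed
  define L where "L = (\<lambda>v\<in>carrier V. THE c. c \<in> carrier K \<and> v \<ominus>\<^bsub>V\<^esub> c \<odot>\<^bsub>V\<^esub> x \<in> M)"
  have L_eq: "L v = c" if "v \<in> carrier V" "c \<in> carrier K" "v \<ominus>\<^bsub>V\<^esub> c \<odot>\<^bsub>V\<^esub> x \<in> M" for v c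
    using that uniq by (auto simp: L_def intro!: the_equality)
  have L: "L v \<in> carrier K" "v \<ominus>\<^bsub>V\<^esub> L v \<odot>\<^bsub>V\<^esub> x \<in> M" if "v \<in> carrier V" for v
    using ex[OF that] L_eq[OF that] by auto
  show ?thesis
  proof (rule that[of L])
    show "L \<in> linear_maps K V (regular_module K)"
    proof (rule linear_mapsI)
      fix v w assume vw: "v \<in> carrier V" "w \<in> carrier V"
      have cx: "L v \<odot>\<^bsub>V\<^esub> x \<in> carrier V" "L w \<odot>\<^bsub>V\<^esub> x \<in> carrier V" using vw L(1) assms(4) vc by auto
      have "(v \<oplus>\<^bsub>V\<^esub> w) \<ominus>\<^bsub>V\<^esub> (L v \<oplus>\<^bsub>K\<^esub> L w) \<odot>\<^bsub>V\<^esub> x = (v \<ominus>\<^bsub>V\<^esub> L v \<odot>\<^bsub>V\<^esub> x) \<oplus>\<^bsub>V\<^esub> (w \<ominus>\<^bsub>V\<^esub> L w \<odot>\<^bsub>V\<^esub> x)"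
        using vw L(1) assms(4) cx by (simp add: V.smult_l_distr a_minus_def V.M.minus_add V.M.a_ac)
      then show "L (v \<oplus>\<^bsub>V\<^esub> w) = L v \<oplus>\<^bsub>regular_module K\<^esub> L w"
        using vw L submodule_add[OF M(1)] by (intro L_eq) auto
    next
      fix a v assume av: "a \<in> carrier K" "v \<in> carrier V"
      have cx: "L v \<odot>\<^bsub>V\<^esub> x \<in> carrier V" using av L(1) assms(4) vc by auto
      have "a \<odot>\<^bsub>V\<^esub> v \<ominus>\<^bsub>V\<^esub> (a \<otimes>\<^bsub>K\<^esub> L v) \<odot>\<^bsub>V\<^esub> x = a \<odot>\<^bsub>V\<^esub> (v \<ominus>\<^bsub>V\<^esub> L v \<odot>\<^bsub>V\<^esub> x)"
        using av L(1) assms(4) cx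
        by (simp add: V.smult_assoc1 a_minus_def V.smult_r_distr left_module_smult_minus[OF assms(2)])
      then show "L (a \<odot>\<^bsub>V\<^esub> v) = a \<odot>\<^bsub>regular_module K\<^esub> L v"
        using av L submodule_smult[OF M(1)] vc by (intro L_eq) auto
    qed (use L in \<open>auto simp: L_def\<close>)
    show "L h = \<zero>\<^bsub>K\<^esub>" if "h \<in> H" for h
      using that M(2) Mc assms(4) by (intro L_eq) (auto simp: left_module_zero_smult[OF assms(2)] a_minus_def)
    show "L x = \<one>\<^bsub>K\<^esub>"
      using assms(4) submodule_zero[OF M(1)] by (intro L_eq) (auto simp: V.smult_one a_minus_def V.M.r_neg)
  qed
qed

section \<open>Quotients and duals\<close>

lemma quotient_module_simps [simp]:
  "carrier (quotient_module R M U) = a_rcosets\<^bsub>M\<^esub> U"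
  "\<zero>\<^bsub>quotient_module R M U\<^esub> = U"
  "B \<oplus>\<^bsub>quotient_module R M U\<^esub> C = B <+>\<^bsub>M\<^esub> C"
  "r \<odot>\<^bsub>quotient_module R M U\<^esub> C = (\<Union>x\<in>C. U +>\<^bsub>M\<^esub> (r \<odot>\<^bsub>M\<^esub> x))"
  by (simp_all add: quotient_module_def)

lemma submodule_abelian_subgroup:
  assumes "left_module R M" "submodule U R M"
  shows "abelian_subgroup U M"
  using assms left_module_group[OF assms(1)]
  by (intro abelian_subgroupI3) (auto simp: submodule_def intro: additive_subgroupI)

lemma quotient_module_carrier:
  "q \<in> carrier (quotient_module R M U) \<longleftrightarrow> (\<exists>x\<in>carrier M. q = U +>\<^bsub>M\<^esub> x)"
  by (auto simp: A_RCOSETS_def')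

lemma coset_eq_iff:
  assumes "left_module R M" "submodule U R M" "x \<in> carrier M" "y \<in> carrier M"
  shows "U +>\<^bsub>M\<^esub> x = U +>\<^bsub>M\<^esub> y \<longleftrightarrow> x \<ominus>\<^bsub>M\<^esub> y \<in> U"
proof -
  interpret U: abelian_subgroup U M by (rule submodule_abelian_subgroup[OF assms(1,2)])
  have "U +>\<^bsub>M\<^esub> x = U +>\<^bsub>M\<^esub> y \<longleftrightarrow> x \<in> U +>\<^bsub>M\<^esub> y"
    using U.a_rcos_self[OF assms(3)] U.a_repr_independence'[OF _ assms(4), of x] by blast
  then show ?thesis
    unfolding a_minus_def U.a_rcos_module[OF assms(4,3)] .
qed

lemma quotient_module_add:
  assumes "left_module R M" "submodule U R M" "x \<in> carrier M" "y \<in> carrier M"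
  shows "(U +>\<^bsub>M\<^esub> x) \<oplus>\<^bsub>quotient_module R M U\<^esub> (U +>\<^bsub>M\<^esub> y) = U +>\<^bsub>M\<^esub> (x \<oplus>\<^bsub>M\<^esub> y)"
proof -
  interpret U: abelian_subgroup U M by (rule submodule_abelian_subgroup[OF assms(1,2)])
  show ?thesis using U.a_rcos_sum assms by simp
qed

lemma quotient_module_smult:
  assumes "left_module R M" "submodule U R M" "r \<in> carrier R" "x \<in> carrier M"
  shows "r \<odot>\<^bsub>quotient_module R M U\<^esub> (U +>\<^bsub>M\<^esub> x) = U +>\<^bsub>M\<^esub> (r \<odot>\<^bsub>M\<^esub> x)"
proof -
  interpret M: left_module R M by fact
  interpret U: abelian_subgroup U M by (rule submodule_abelian_subgroup[OF assms(1,2)])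
  have "U +>\<^bsub>M\<^esub> (r \<odot>\<^bsub>M\<^esub> y) = U +>\<^bsub>M\<^esub> (r \<odot>\<^bsub>M\<^esub> x)" if "y \<in> U +>\<^bsub>M\<^esub> x" for y
  proof -
    from that obtain u where u: "u \<in> U" "y = u \<oplus>\<^bsub>M\<^esub> x" by (auto simp: a_r_coset_def')
    have uc: "u \<in> carrier M" using u(1) submodule_subset[OF assms(2)] by auto
    have "r \<odot>\<^bsub>M\<^esub> y \<ominus>\<^bsub>M\<^esub> r \<odot>\<^bsub>M\<^esub> x = r \<odot>\<^bsub>M\<^esub> u"
      using u uc assms(3,4) by (simp add: M.smult_r_distr a_minus_def M.M.a_assoc M.smult_closed M.M.r_neg)
    then show ?thesis
      using u uc assms(3,4) submodule_smult[OF assms(2,3) u(1)]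
      by (simp add: coset_eq_iff[OF assms(1,2)] M.smult_closed)
  qed
  moreover have "x \<in> U +>\<^bsub>M\<^esub> x" using U.a_rcos_self[OF assms(4)] .
  ultimately have "(\<Union>y\<in>U +>\<^bsub>M\<^esub> x. U +>\<^bsub>M\<^esub> (r \<odot>\<^bsub>M\<^esub> y)) = U +>\<^bsub>M\<^esub> (r \<odot>\<^bsub>M\<^esub> x)" by blast
  then show ?thesis by simp
qed

lemma op_alg_simps [simp]:
  "carrier (op_alg A) = carrier A" "zero (op_alg A) = zero A" "one (op_alg A) = one A"
  "add (op_alg A) = add A" "smult (op_alg A) = smult A"
  "x \<otimes>\<^bsub>op_alg A\<^esub> y = y \<otimes>\<^bsub>A\<^esub> x"
  by (simp_all add: op_alg_def)

lemma ring_op_alg: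
  assumes "ring A"
  shows "ring (op_alg A)"
proof -
  interpret ring A by fact
  show ?thesis
  proof (rule ringI)
    show "abelian_group (op_alg A)" by (rule abelian_group_cong[OF abelian_group_axioms]) simp_all
    show "Group.monoid (op_alg A)" by (rule monoidI) (auto simp: m_assoc)
  qed (auto simp: l_distr r_distr)
qed

lemma star_dual_simps [simp]:
  "carrier (star_dual A P) = linear_maps A P (regular_module A)"
  "\<zero>\<^bsub>star_dual A P\<^esub> = (\<lambda>p\<in>carrier P. \<zero>\<^bsub>A\<^esub>)"
  "f \<oplus>\<^bsub>star_dual A P\<^esub> g = (\<lambda>p\<in>carrier P. f p \<oplus>\<^bsub>A\<^esub> g p)"
  "a \<odot>\<^bsub>star_dual A P\<^esub> f = (\<lambda>p\<in>carrier P. f p \<otimes>\<^bsub>A\<^esub> a)"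
  by (simp_all add: star_dual_def)

lemma left_module_star_dual:
  assumes "left_module A P"
  shows "left_module (op_alg A) (star_dual A P)"
proof -
  interpret P: left_module A P by fact
  note c = linear_maps_closed[of _ A P "regular_module A", simplified]
    linear_maps_add[of _ A P "regular_module A", simplified]
    linear_maps_smult[of _ A P "regular_module A", simplified]
  show ?thesis
  proof (rule left_moduleI[OF ring_op_alg[OF P.R.ring_axioms]])
    show "abelian_group (star_dual A P)"
      unfolding star_dual_def
      by (rule abelian_group_with_smult[OF left_module_Hom[OF assms left_module_regular[OF P.R.ring_axioms]]])
  next
    fix a f assume "a \<in> carrier (op_alg A)" "f \<in> carrier (star_dual A P)"
    then have "(\<lambda>p\<in>carrier P. f p \<otimes>\<^bsub>A\<^esub> a) \<in> linear_maps A P (regular_module A)"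
      by (intro linear_maps_restrictI[OF assms]) (auto simp: c P.R.l_distr P.R.m_assoc)
    then show "a \<odot>\<^bsub>star_dual A P\<^esub> f \<in> carrier (star_dual A P)" by simp
  next
    fix f assume "f \<in> carrier (star_dual A P)"
    then have f: "f \<in> linear_maps A P (regular_module A)" by simp
    show "\<one>\<^bsub>op_alg A\<^esub> \<odot>\<^bsub>star_dual A P\<^esub> f = f"
      using linear_maps_extensional[OF f]
      by (auto simp: c[OF f] intro!: extensionalityI[OF restrict_extensional])
  qed (auto simp: c P.R.r_distr P.R.l_distr P.R.m_assoc intro!: restrict_ext)
qed

lemma precomp_star_dual_submodule:
  assumes "left_module A P1" "left_module A P0" "f \<in> linear_maps A P1 P0"
  shows "submodule (precomp P1 f ` carrier (star_dual A P0)) (op_alg A) (star_dual A P1)"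
proof -
  interpret P1: left_module A P1 by fact
  note l = left_module_star_dual[OF assms(1)] left_module_star_dual[OF assms(2)]
  have "(\<lambda>\<phi>\<in>carrier (star_dual A P0). precomp P1 f \<phi>) \<in> linear_maps (op_alg A) (star_dual A P0) (star_dual A P1)"
  proof (rule linear_maps_restrictI[OF l(2)])
    fix \<phi> assume "\<phi> \<in> carrier (star_dual A P0)"
    then show "precomp P1 f \<phi> \<in> carrier (star_dual A P1)"
      by (simp add: precomp_def linear_maps_compose[OF assms(1,3)])
  qed (auto simp: precomp_def compose_def linear_maps_closed[OF assms(3)] intro!: restrict_ext)
  from submodule_image[OF l(2,1) this] show ?thesis by simp
qed

section \<open>Homomorphisms into the Auslander--Reiten translate\<close>

text \<open>
  The part of the structure of \<open>End(E)\<^sup>o\<^sup>p\<close> on which duality over \<open>K\<close> relies: the scalars act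
  through the center.
\<close>

locale algebra_over_field = module K A + ring A
  for K :: "('k, 'z) ring_scheme" (structure) and A :: "('k, 'a) module" (structure) +
  assumes base_field: "field K"
    and smult_assoc2: "\<lbrakk>c \<in> carrier K; x \<in> carrier A; y \<in> carrier A\<rbrakk> \<Longrightarrow>
        (c \<odot>\<^bsub>A\<^esub> x) \<otimes>\<^bsub>A\<^esub> y = c \<odot>\<^bsub>A\<^esub> (x \<otimes>\<^bsub>A\<^esub> y)"
    and smult_assoc3: "\<lbrakk>c \<in> carrier K; x \<in> carrier A; y \<in> carrier A\<rbrakk> \<Longrightarrow>
        x \<otimes>\<^bsub>A\<^esub> (c \<odot>\<^bsub>A\<^esub> y) = c \<odot>\<^bsub>A\<^esub> (x \<otimes>\<^bsub>A\<^esub> y)"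

lemma K_dual_simps [simp]:
  "carrier (K_dual K B Q) = linear_maps K (underlying_space B Q) (regular_module K)"
  "\<zero>\<^bsub>K_dual K B Q\<^esub> = (\<lambda>x\<in>carrier Q. \<zero>\<^bsub>K\<^esub>)"
  "f \<oplus>\<^bsub>K_dual K B Q\<^esub> g = (\<lambda>x\<in>carrier Q. f x \<oplus>\<^bsub>K\<^esub> g x)"
  "b \<odot>\<^bsub>K_dual K B Q\<^esub> f = (\<lambda>x\<in>carrier Q. f (b \<odot>\<^bsub>Q\<^esub> x))"
  by (simp_all add: K_dual_def underlying_space_def)

lemma underlying_space_simps [simp]:
  "carrier (underlying_space B Q) = carrier Q"
  "zero (underlying_space B Q) = zero Q"
  "add (underlying_space B Q) = add Q"
  "c \<odot>\<^bsub>underlying_space B Q\<^esub> x = (c \<odot>\<^bsub>B\<^esub> \<one>\<^bsub>B\<^esub>) \<odot>\<^bsub>Q\<^esub> x"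
  by (simp_all add: underlying_space_def)

context algebra_over_field
begin

lemma scalar_closed: "c \<in> carrier K \<Longrightarrow> c \<odot>\<^bsub>A\<^esub> \<one>\<^bsub>A\<^esub> \<in> carrier A"
  by (rule smult_closed) auto

lemma scalar_central:
  assumes "c \<in> carrier K" "x \<in> carrier A"
  shows "x \<otimes>\<^bsub>A\<^esub> (c \<odot>\<^bsub>A\<^esub> \<one>\<^bsub>A\<^esub>) = (c \<odot>\<^bsub>A\<^esub> \<one>\<^bsub>A\<^esub>) \<otimes>\<^bsub>A\<^esub> x"
  using assms by (simp add: smult_assoc2 smult_assoc3)

text \<open>Scalars are central, so multiplying a linear map by one gives a linear map.\<close>

lemma left_module_underlying_Hom:
  assumes "left_module A P" "left_module A N"
  shows "left_module K (with_smult (Hom A P N) (\<lambda>c h. \<lambda>p\<in>carrier P. (c \<odot>\<^bsub>A\<^esub> \<one>\<^bsub>A\<^esub>) \<odot>\<^bsub>N\<^esub> h p))"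
proof -
  interpret N: left_module A N by fact
  interpret P: left_module A P by fact
  interpret K: field K by (rule base_field)
  note sc = scalar_closed
  have cc: "(c \<otimes>\<^bsub>K\<^esub> d) \<odot>\<^bsub>A\<^esub> \<one>\<^bsub>A\<^esub> = (c \<odot>\<^bsub>A\<^esub> \<one>\<^bsub>A\<^esub>) \<otimes>\<^bsub>A\<^esub> (d \<odot>\<^bsub>A\<^esub> \<one>\<^bsub>A\<^esub>)"
    if "c \<in> carrier K" "d \<in> carrier K" for c d
    using that by (simp add: smult_assoc2 sc smult_assoc1)
  note c = linear_maps_closed[of _ A P N]
  show ?thesis
  proof (rule left_moduleI, goal_cases)
    case 1
    show ?case by (rule R.ring_axioms)
  next
    case 2
    show ?case by (rule abelian_group_with_smult[OF left_module_Hom[OF assms]])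
  next
    case (3 a h)
    then have h: "h \<in> linear_maps A P N" by simp
    have "(\<lambda>p\<in>carrier P. (a \<odot>\<^bsub>A\<^esub> \<one>\<^bsub>A\<^esub>) \<odot>\<^bsub>N\<^esub> h p) \<in> linear_maps A P N"
    proof (rule linear_maps_restrictI[OF assms(1)])
      fix r p assume rp: "r \<in> carrier A" "p \<in> carrier P"
      have "(a \<odot>\<^bsub>A\<^esub> \<one>\<^bsub>A\<^esub>) \<odot>\<^bsub>N\<^esub> (r \<odot>\<^bsub>N\<^esub> h p) = (r \<otimes>\<^bsub>A\<^esub> (a \<odot>\<^bsub>A\<^esub> \<one>\<^bsub>A\<^esub>)) \<odot>\<^bsub>N\<^esub> h p"
        using rp 3(1) by (simp only: scalar_central[OF 3(1) rp(1)] N.smult_assoc1[OF sc[OF 3(1)] rp(1) c[OF h]])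
      then show "(a \<odot>\<^bsub>A\<^esub> \<one>\<^bsub>A\<^esub>) \<odot>\<^bsub>N\<^esub> h (r \<odot>\<^bsub>P\<^esub> p) = r \<odot>\<^bsub>N\<^esub> ((a \<odot>\<^bsub>A\<^esub> \<one>\<^bsub>A\<^esub>) \<odot>\<^bsub>N\<^esub> h p)"
        using rp by (simp only: linear_maps_smult[OF h] N.smult_assoc1[OF rp(1) sc[OF 3(1)] c[OF h]])
    qed (use 3(1) in \<open>simp_all only: linear_maps_add[OF h] c[OF h] sc N.smult_closed N.smult_r_distr\<close>)
    then show ?case by simp
  next
    case (4 a b h)
    then show ?case
      using c[of h] by (auto simp: smult_l_distr N.smult_l_distr sc intro!: restrict_ext)
  next
    case (5 a h h')
    then show ?case
      using c[of h] c[of h'] by (auto simp: N.smult_r_distr sc intro!: restrict_ext)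
  next
    case (6 a b h)
    then show ?case
      using c[of h] by (auto simp: cc N.smult_assoc1 sc intro!: restrict_ext)
  next
    case (7 h)
    then have h: "h \<in> linear_maps A P N" by simp
    show ?case
      using linear_maps_extensional[OF h]
      by (auto simp: c[OF h] N.smult_one intro!: extensionalityI[OF restrict_extensional])
  qed
qed

end

text \<open>
  The setting for \<open>\<tau>\<close>: a presentation map \<open>f : P1 \<rightarrow> P0\<close> between projectives, given by dual bases, and
  a module \<open>N\<close> to be mapped to the translate that \<open>f\<close> defines.
\<close>

locale projective_presentation = algebra_over_field K A
  for K :: "('k, 'z) ring_scheme" (structure) and A :: "('k, 'a) module" (structure) +
  fixes N :: "('a, 'n) module" and P1 :: "('a, 'p1) module" and P0 :: "('a, 'p0) module"
    and f :: "'p1 \<Rightarrow> 'p0"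
  assumes N: "left_module A N" and P1: "left_module A P1" and P0: "left_module A P0"
    and f: "f \<in> linear_maps A P1 P0"
    and s1: "summand_of_copies A (regular_module A) P1"
    and s0: "summand_of_copies A (regular_module A) P0"
begin

abbreviation "reg \<equiv> regular_module A"
abbreviation "dual \<equiv> star_dual A P1"
abbreviation "homs \<equiv> Hom A P1 N"
abbreviation "rk \<equiv> rank_one P1 N"

definition im_dual where "im_dual = precomp P1 f ` carrier (star_dual A P0)"
definition Tr where "Tr = quotient_module (op_alg A) dual im_dual"
definition tau where "tau = K_dual K (op_alg A) Tr"

abbreviation "cls \<phi> \<equiv> im_dual +>\<^bsub>dual\<^esub> \<phi>"

interpretation N: left_module A N by (rule N)
interpretation P1: left_module A P1 by (rule P1)
interpretation P0: left_module A P0 by (rule P0)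
interpretation K: field K by (rule base_field)
interpretation H: abelian_group homs by (rule left_module_Hom[OF P1 N])

lemma left_reg: "left_module A reg"
  by (rule left_module_regular[OF ring_axioms])

lemma left_dual: "left_module (op_alg A) dual"
  by (rule left_module_star_dual[OF P1])

lemma submodule_im_dual: "submodule im_dual (op_alg A) dual"
  unfolding im_dual_def by (rule precomp_star_dual_submodule[OF P1 P0 f])

lemma tau_eq: "tau = K_dual K (op_alg A) (transpose_module A P1 P0 f)"
  by (simp add: tau_def Tr_def transpose_module_def im_dual_def)

lemma Tr_carrier_iff: "q \<in> carrier Tr \<longleftrightarrow> (\<exists>\<phi>\<in>linear_maps A P1 reg. q = cls \<phi>)"
  unfolding Tr_def quotient_module_carrier by simp

lemma cls_closed: "\<phi> \<in> linear_maps A P1 reg \<Longrightarrow> cls \<phi> \<in> carrier Tr"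
  using Tr_carrier_iff by blast

lemma cls_add:
  "\<phi> \<in> linear_maps A P1 reg \<Longrightarrow> \<psi> \<in> linear_maps A P1 reg \<Longrightarrow> cls \<phi> \<oplus>\<^bsub>Tr\<^esub> cls \<psi> = cls (\<phi> \<oplus>\<^bsub>dual\<^esub> \<psi>)"
  unfolding Tr_def by (intro quotient_module_add[OF left_dual submodule_im_dual]) auto

lemma cls_smult:
  "a \<in> carrier A \<Longrightarrow> \<phi> \<in> linear_maps A P1 reg \<Longrightarrow> a \<odot>\<^bsub>Tr\<^esub> cls \<phi> = cls (a \<odot>\<^bsub>dual\<^esub> \<phi>)"
  unfolding Tr_def by (intro quotient_module_smult[OF left_dual submodule_im_dual]) auto

lemma Tr_zero: "\<zero>\<^bsub>Tr\<^esub> = im_dual"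
  by (simp add: Tr_def)

lemma dual_add_closed:
  "\<phi> \<in> linear_maps A P1 reg \<Longrightarrow> \<psi> \<in> linear_maps A P1 reg \<Longrightarrow> \<phi> \<oplus>\<^bsub>dual\<^esub> \<psi> \<in> linear_maps A P1 reg"
  using abelian_groupE(1)[OF left_module_group[OF left_dual], of \<phi> \<psi>] by simp

lemma dual_smult_closed:
  "a \<in> carrier A \<Longrightarrow> \<phi> \<in> linear_maps A P1 reg \<Longrightarrow> a \<odot>\<^bsub>dual\<^esub> \<phi> \<in> linear_maps A P1 reg"
  using left_module.smult_closed[OF left_dual, of a \<phi>] by simp

lemma Tr_smult_closed: "a \<in> carrier A \<Longrightarrow> q \<in> carrier Tr \<Longrightarrow> a \<odot>\<^bsub>Tr\<^esub> q \<in> carrier Tr"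
  using dual_smult_closed cls_smult unfolding Tr_carrier_iff by blast

lemma Tr_add_closed: "q \<in> carrier Tr \<Longrightarrow> q' \<in> carrier Tr \<Longrightarrow> q \<oplus>\<^bsub>Tr\<^esub> q' \<in> carrier Tr"
  using dual_add_closed cls_add unfolding Tr_carrier_iff by blast

lemmas rk_linear = rank_one_linear[OF P1 N]

lemma dual_apply_closed: "\<phi> \<in> linear_maps A P1 reg \<Longrightarrow> p \<in> carrier P1 \<Longrightarrow> \<phi> p \<in> carrier A"
  using linear_maps_closed[of \<phi> A P1 reg p] by simp

lemma rk_add_left:
  "\<phi> \<in> linear_maps A P1 reg \<Longrightarrow> \<psi> \<in> linear_maps A P1 reg \<Longrightarrow> n \<in> carrier N \<Longrightarrow>
    rk (\<phi> \<oplus>\<^bsub>dual\<^esub> \<psi>) n = rk \<phi> n \<oplus>\<^bsub>homs\<^esub> rk \<psi> n"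
  by (auto simp: rank_one_def dual_apply_closed N.smult_l_distr intro!: restrict_ext)

lemma rk_add_right:
  "\<phi> \<in> linear_maps A P1 reg \<Longrightarrow> n \<in> carrier N \<Longrightarrow> n' \<in> carrier N \<Longrightarrow>
    rk \<phi> (n \<oplus>\<^bsub>N\<^esub> n') = rk \<phi> n \<oplus>\<^bsub>homs\<^esub> rk \<phi> n'"
  by (auto simp: rank_one_def dual_apply_closed N.smult_r_distr intro!: restrict_ext)

lemma rk_balanced:
  "a \<in> carrier A \<Longrightarrow> \<phi> \<in> linear_maps A P1 reg \<Longrightarrow> n \<in> carrier N \<Longrightarrow>
    rk (a \<odot>\<^bsub>dual\<^esub> \<phi>) n = rk \<phi> (a \<odot>\<^bsub>N\<^esub> n)"
  by (auto simp: rank_one_def dual_apply_closed N.smult_assoc1 intro!: restrict_ext)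

lemma zero_Hom_translate: "\<zero>\<^bsub>Hom A N tau\<^esub> \<in> carrier (Hom A N tau)"
proof -
  have z: "(\<lambda>x\<in>carrier Tr. \<zero>\<^bsub>K\<^esub>) \<in> linear_maps K (underlying_space (op_alg A) Tr) (regular_module K)"
    by (rule linear_mapsI) (auto simp: Tr_add_closed Tr_smult_closed scalar_closed)
  have "(\<lambda>n\<in>carrier N. \<lambda>x\<in>carrier Tr. \<zero>\<^bsub>K\<^esub>) \<in> linear_maps A N tau"
    by (rule linear_maps_restrictI[OF N]) (use z in \<open>auto simp: tau_def Tr_smult_closed intro!: restrict_ext\<close>)
  then show ?thesis by (simp add: tau_def)
qed

text \<open>
  A map \<open>\<theta> : N \<rightarrow> D Tr\<close> is a pairing \<open>B(\<phi>, n) = \<theta>(n)[\<phi>]\<close> between \<open>Hom(P1, A)\<close> and \<open>N\<close>, balanced over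
  \<open>A\<close> and zero if \<open>\<phi>\<close> factors through \<open>f\<close>.  Since \<open>Hom(P1, A) \<otimes> N = Hom(P1, N)\<close>, it is a function \<open>L\<close>
  of the map \<open>p \<mapsto> \<phi>(p) n\<close>.  If that map is \<open>g \<circ> f\<close>, expanding \<open>g\<close> in a dual basis of \<open>P0\<close>
  writes it as a sum of maps \<open>p \<mapsto> \<psi>(f(p)) n'\<close>, on which \<open>L\<close> vanishes.
\<close>

lemma Hom_translate_zero_if_surj:
  assumes surj: "precomp P1 f ` linear_maps A P0 N = linear_maps A P1 N"
  shows "carrier (Hom A N tau) = {\<zero>\<^bsub>Hom A N tau\<^esub>}"
proof -
  obtain m :: nat and e b where e: "\<And>i. i < m \<Longrightarrow> e i \<in> linear_maps A P1 reg"
    and b: "\<And>i. i < m \<Longrightarrow> b i \<in> carrier P1"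
    and sum1: "\<And>p. p \<in> carrier P1 \<Longrightarrow> p = (\<Oplus>\<^bsub>P1\<^esub>i\<in>{..<m}. e i p \<odot>\<^bsub>P1\<^esub> b i)"
    by (rule dual_basis[OF P1 s1], rule that)
  have "\<theta> = \<zero>\<^bsub>Hom A N tau\<^esub>" if \<theta>: "\<theta> \<in> linear_maps A N tau" for \<theta>
  proof -
    have \<theta>c: "\<theta> n \<in> linear_maps K (underlying_space (op_alg A) Tr) (regular_module K)" if "n \<in> carrier N" for n
      using linear_maps_closed[OF \<theta> that] by (simp add: tau_def)
    define B where "B \<phi> n = \<theta> n (cls \<phi>)" for \<phi> n
    have Bc: "B \<phi> n \<in> carrier K" if "\<phi> \<in> linear_maps A P1 reg" "n \<in> carrier N" for \<phi> n
      using linear_maps_closed[OF \<theta>c[OF that(2)], of "cls \<phi>"] cls_closed[OF that(1)] by (simp add: B_def)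
    have Badd1: "B (\<phi> \<oplus>\<^bsub>dual\<^esub> \<psi>) n = B \<phi> n \<oplus>\<^bsub>K\<^esub> B \<psi> n"
      if "\<phi> \<in> linear_maps A P1 reg" "\<psi> \<in> linear_maps A P1 reg" "n \<in> carrier N" for \<phi> \<psi> n
      using linear_maps_add[OF \<theta>c[OF that(3)], of "cls \<phi>" "cls \<psi>"] cls_closed that
      by (simp add: B_def cls_add del: star_dual_simps)
    have Badd2: "B \<phi> (n \<oplus>\<^bsub>N\<^esub> n') = B \<phi> n \<oplus>\<^bsub>K\<^esub> B \<phi> n'"
      if "\<phi> \<in> linear_maps A P1 reg" "n \<in> carrier N" "n' \<in> carrier N" for \<phi> n n'
      using cls_closed that by (simp add: B_def linear_maps_add[OF \<theta>] tau_def)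
    have Bbal: "B (a \<odot>\<^bsub>dual\<^esub> \<phi>) n = B \<phi> (a \<odot>\<^bsub>N\<^esub> n)"
      if "a \<in> carrier A" "\<phi> \<in> linear_maps A P1 reg" "n \<in> carrier N" for a \<phi> n
      using cls_closed that by (simp add: B_def linear_maps_smult[OF \<theta>] tau_def cls_smult del: star_dual_simps)
    have BU: "B \<phi> n = \<zero>\<^bsub>K\<^esub>" if "\<phi> \<in> im_dual" "n \<in> carrier N" for \<phi> n
    proof -
      have "cls \<phi> = \<zero>\<^bsub>Tr\<^esub>"
        unfolding Tr_zero using abelian_subgroup.a_rcos_const[OF submodule_abelian_subgroup[OF left_dual submodule_im_dual] that(1)] .
      moreover have "\<zero>\<^bsub>Tr\<^esub> \<oplus>\<^bsub>Tr\<^esub> \<zero>\<^bsub>Tr\<^esub> = \<zero>\<^bsub>Tr\<^esub>" "\<zero>\<^bsub>Tr\<^esub> \<in> carrier Tr"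
      proof -
        have z: "\<zero>\<^bsub>dual\<^esub> \<in> linear_maps A P1 reg" using abelian_groupE(2)[OF left_module_group[OF left_dual]] by simp
        have zQ: "\<zero>\<^bsub>Tr\<^esub> = cls \<zero>\<^bsub>dual\<^esub>"
          unfolding Tr_zero
          using abelian_subgroup.a_rcos_const[OF submodule_abelian_subgroup[OF left_dual submodule_im_dual] submodule_zero[OF submodule_im_dual]] by simp
        show "\<zero>\<^bsub>Tr\<^esub> \<in> carrier Tr" unfolding zQ by (rule cls_closed[OF z])
        show "\<zero>\<^bsub>Tr\<^esub> \<oplus>\<^bsub>Tr\<^esub> \<zero>\<^bsub>Tr\<^esub> = \<zero>\<^bsub>Tr\<^esub>"
          unfolding zQ cls_add[OF z z] using abelian_groupE(5)[OF left_module_group[OF left_dual], of "\<zero>\<^bsub>dual\<^esub>"] z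
          by (simp del: star_dual_simps add: star_dual_simps(1))
      qed
      ultimately have dbl: "B \<phi> n = B \<phi> n \<oplus>\<^bsub>K\<^esub> B \<phi> n" and mem: "B \<phi> n \<in> carrier K"
        using linear_maps_add[OF \<theta>c[OF that(2)], of "\<zero>\<^bsub>Tr\<^esub>" "\<zero>\<^bsub>Tr\<^esub>"]
          linear_maps_closed[OF \<theta>c[OF that(2)], of "\<zero>\<^bsub>Tr\<^esub>"] by (simp_all add: B_def)
      have "B \<phi> n \<oplus>\<^bsub>K\<^esub> B \<phi> n = B \<phi> n \<oplus>\<^bsub>K\<^esub> \<zero>\<^bsub>K\<^esub>" using mem by (simp add: dbl[symmetric])
      then show ?thesis using mem by simp
    qed
    \<comment> \<open>The balanced map \<open>B\<close> factors through a functional on \<open>Hom(P1, N)\<close>.\<close>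
    define L where "L h = (\<Oplus>\<^bsub>K\<^esub>i\<in>{..<m}. B (e i) (h (b i)))" for h
    have hb: "h (b i) \<in> carrier N" if "h \<in> linear_maps A P1 N" "i < m" for h i
      using linear_maps_closed[OF that(1) b[OF that(2)]] .
    have Lc: "L h \<in> carrier K" if "h \<in> linear_maps A P1 N" for h
      unfolding L_def using Bc[OF e hb[OF that]] by (intro R.finsum_closed) auto
    have Ladd: "L (h \<oplus>\<^bsub>homs\<^esub> h') = L h \<oplus>\<^bsub>K\<^esub> L h'"
      if h: "h \<in> linear_maps A P1 N" "h' \<in> linear_maps A P1 N" for h h'
    proof -
      have "L (h \<oplus>\<^bsub>homs\<^esub> h') = (\<Oplus>\<^bsub>K\<^esub>i\<in>{..<m}. B (e i) (h (b i)) \<oplus>\<^bsub>K\<^esub> B (e i) (h' (b i)))"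
        unfolding L_def using Bc[OF e hb[OF h(1)]] Bc[OF e hb[OF h(2)]] b Badd2[OF e hb[OF h(1)] hb[OF h(2)]]
        by (intro R.finsum_cong') auto
      also have "\<dots> = L h \<oplus>\<^bsub>K\<^esub> L h'"
        unfolding L_def using Bc[OF e hb[OF h(1)]] Bc[OF e hb[OF h(2)]] by (intro R.finsum_addf) auto
      finally show ?thesis .
    qed
    \<comment> \<open>Expand \<open>\<phi>\<close> in the dual basis and move the coefficients \<open>\<phi>(b\<^sub>i)\<close> over to \<open>n\<close>.\<close>
    have Lt: "L (rk \<phi> n) = B \<phi> n" if \<phi>: "\<phi> \<in> linear_maps A P1 reg" and n: "n \<in> carrier N" for \<phi> n
    proof -
      let ?s = "\<lambda>i. \<phi> (b i) \<odot>\<^bsub>dual\<^esub> e i"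
      have s: "?s \<in> {..<m} \<rightarrow> carrier dual" using dual_smult_closed[OF dual_apply_closed[OF \<phi> b] e] by auto
      interpret D: abelian_group dual by (rule left_module_group[OF left_dual])
      have fin: "finsum dual ?s {..<m} \<in> linear_maps A P1 reg" using D.finsum_closed[OF s] by simp
      have "finsum dual ?s {..<m} = \<phi>"
      proof (rule linear_maps_ext[OF fin \<phi>])
        fix p assume p: "p \<in> carrier P1"
        have "finsum dual ?s {..<m} p = (\<Oplus>\<^bsub>reg\<^esub>i\<in>{..<m}. ?s i p)"
          by (rule additive_finsum[OF D.abelian_group_axioms left_module_group[OF left_reg] _ _ s, where f = "\<lambda>h. h p"])
            (use p dual_apply_closed in auto)
        also have "\<dots> = (\<Oplus>\<^bsub>reg\<^esub>i\<in>{..<m}. e i p \<odot>\<^bsub>reg\<^esub> \<phi> (b i))" using p by simp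
        also have "\<dots> = \<phi> p" by (rule dual_basis_expansion[OF P1 left_reg \<phi> p e b sum1[OF p], symmetric])
        finally show "finsum dual ?s {..<m} p = \<phi> p" .
      qed
      then have "B \<phi> n = B (finsum dual ?s {..<m}) n" by simp
      also have "\<dots> = (\<Oplus>\<^bsub>K\<^esub>i\<in>{..<m}. B (?s i) n)"
        by (rule additive_finsum[OF D.abelian_group_axioms R.abelian_group_axioms _ _ s, where f = "\<lambda>\<phi>. B \<phi> n"])
          (use Bc[OF _ n] Badd1[OF _ _ n] in \<open>simp_all del: star_dual_simps add: star_dual_simps(1)\<close>)
      also have "\<dots> = (\<Oplus>\<^bsub>K\<^esub>i\<in>{..<m}. B (e i) (\<phi> (b i) \<odot>\<^bsub>N\<^esub> n))"
        using Bbal[OF dual_apply_closed[OF \<phi> b] e n] Bc[OF e N.smult_closed[OF dual_apply_closed[OF \<phi> b] n]]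
        by (intro R.finsum_cong') (auto simp del: star_dual_simps)
      also have "\<dots> = L (rk \<phi> n)"
        unfolding L_def using b Bc[OF e N.smult_closed[OF dual_apply_closed[OF \<phi> b] n]]
        by (intro R.finsum_cong') (auto simp: rank_one_def)
      finally show ?thesis ..
    qed
    have B0: "B \<phi> n = \<zero>\<^bsub>K\<^esub>" if \<phi>: "\<phi> \<in> linear_maps A P1 reg" and n: "n \<in> carrier N" for \<phi> n
    proof -
      obtain g where g: "g \<in> linear_maps A P0 N" "rk \<phi> n = compose (carrier P1) g f"
        using surj rk_linear[OF \<phi> n] unfolding precomp_def by blast
      obtain m' :: nat and e' b' where e': "\<And>i. i < m' \<Longrightarrow> e' i \<in> linear_maps A P0 reg"
        and b': "\<And>i. i < m' \<Longrightarrow> b' i \<in> carrier P0"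
        and sum0: "\<And>p. p \<in> carrier P0 \<Longrightarrow> p = (\<Oplus>\<^bsub>P0\<^esub>i\<in>{..<m'}. e' i p \<odot>\<^bsub>P0\<^esub> b' i)"
        by (rule dual_basis[OF P0 s0], rule that)
      let ?e = "\<lambda>i. compose (carrier P1) (e' i) f"
      have eU: "?e i \<in> im_dual" if "i < m'" for i
        unfolding im_dual_def using e'[OF that] by (auto simp: precomp_def)
      have el: "?e i \<in> linear_maps A P1 reg" if "i < m'" for i
        by (rule linear_maps_compose[OF P1 f e'[OF that]])
      have gb: "g (b' i) \<in> carrier N" if "i < m'" for i by (rule linear_maps_closed[OF g(1) b'[OF that]])
      have st: "(\<lambda>i. rk (?e i) (g (b' i))) \<in> {..<m'} \<rightarrow> linear_maps A P1 N"
        using rk_linear[OF el gb] by auto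
      have "rk \<phi> n = (\<Oplus>\<^bsub>homs\<^esub>i\<in>{..<m'}. rk (?e i) (g (b' i)))"
      proof (rule linear_maps_ext[OF rk_linear[OF \<phi> n]])
        show "(\<Oplus>\<^bsub>homs\<^esub>i\<in>{..<m'}. rk (?e i) (g (b' i))) \<in> linear_maps A P1 N"
          using H.finsum_closed[of _ "{..<m'}"] st by simp
        fix p assume p: "p \<in> carrier P1"
        have fp: "f p \<in> carrier P0" by (rule linear_maps_closed[OF f p])
        have "rk \<phi> n p = g (f p)" using p by (simp add: g(2) compose_eq)
        also have "\<dots> = (\<Oplus>\<^bsub>N\<^esub>i\<in>{..<m'}. e' i (f p) \<odot>\<^bsub>N\<^esub> g (b' i))"
          by (rule dual_basis_expansion[OF P0 N g(1) fp e' b' sum0[OF fp]])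
        also have "\<dots> = (\<Oplus>\<^bsub>homs\<^esub>i\<in>{..<m'}. rk (?e i) (g (b' i))) p"
          using Hom_finsum_apply[OF P1 N st p] p by (simp add: rank_one_def compose_eq)
        finally show "rk \<phi> n p = (\<Oplus>\<^bsub>homs\<^esub>i\<in>{..<m'}. rk (?e i) (g (b' i))) p" .
      qed
      then have "B \<phi> n = L (\<Oplus>\<^bsub>homs\<^esub>i\<in>{..<m'}. rk (?e i) (g (b' i)))"
        using Lt[OF \<phi> n] by simp
      also have "\<dots> = (\<Oplus>\<^bsub>K\<^esub>i\<in>{..<m'}. L (rk (?e i) (g (b' i))))"
        by (rule additive_finsum[OF H.abelian_group_axioms R.abelian_group_axioms, where f = L])
          (use Lc Ladd st in \<open>simp_all del: Hom_simps add: Hom_simps(1)\<close>)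
      also have "\<dots> = (\<Oplus>\<^bsub>K\<^esub>i\<in>{..<m'}. \<zero>\<^bsub>K\<^esub>)"
        using BU[OF eU gb] Lt[OF el gb] by (intro R.finsum_cong') auto
      also have "\<dots> = \<zero>\<^bsub>K\<^esub>" by (rule R.finsum_zero)
      finally show ?thesis .
    qed
    show ?thesis
    proof (rule extensionalityI[OF linear_maps_extensional[OF \<theta>]])
      show "\<zero>\<^bsub>Hom A N tau\<^esub> \<in> extensional (carrier N)" by simp
      fix n assume n: "n \<in> carrier N"
      have "\<theta> n = (\<lambda>x\<in>carrier Tr. \<zero>\<^bsub>K\<^esub>)"
      proof (rule extensionalityI[of _ "carrier Tr"])
        show "\<theta> n \<in> extensional (carrier Tr)" using linear_maps_extensional[OF \<theta>c[OF n]] by simp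
        fix q assume q: "q \<in> carrier Tr"
        then obtain \<phi> where "\<phi> \<in> linear_maps A P1 reg" "q = cls \<phi>" using Tr_carrier_iff by blast
        then show "\<theta> n q = (\<lambda>x\<in>carrier Tr. \<zero>\<^bsub>K\<^esub>) q" using B0[OF _ n] q by (simp add: B_def)
      qed simp
      then show "\<theta> n = \<zero>\<^bsub>Hom A N tau\<^esub> n" using n by (simp add: tau_def)
    qed
  qed
  then have "carrier (Hom A N tau) \<subseteq> {\<zero>\<^bsub>Hom A N tau\<^esub>}"
    unfolding Hom_simps(1) by (intro subsetI iffD2[OF singleton_iff])
  then show "carrier (Hom A N tau) = {\<zero>\<^bsub>Hom A N tau\<^esub>}"
    using zero_Hom_translate by (intro subset_antisym) (simp_all only: insert_subset empty_subsetI simp_thms)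
qed

text \<open>
  Otherwise some \<open>K\<close>-linear functional \<open>L\<close> on \<open>Hom(P1, N)\<close> vanishes on all \<open>g \<circ> f\<close> and is nonzero
  somewhere.  The pairing \<open>(\<phi>, n) \<mapsto> L(p \<mapsto> \<phi>(p) n)\<close> then defines a map \<open>N \<rightarrow> D Tr\<close>, and it is nonzero
  because the maps \<open>p \<mapsto> \<phi>(p) n\<close> generate \<open>Hom(P1, N)\<close>.
\<close>

lemma surj_if_Hom_translate_zero:
  assumes triv: "carrier (Hom A N tau) = {\<zero>\<^bsub>Hom A N tau\<^esub>}"
  shows "precomp P1 f ` linear_maps A P0 N = linear_maps A P1 N"
proof -
  obtain m :: nat and e b where e: "\<And>i. i < m \<Longrightarrow> e i \<in> linear_maps A P1 reg"
    and b: "\<And>i. i < m \<Longrightarrow> b i \<in> carrier P1"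
    and sum1: "\<And>p. p \<in> carrier P1 \<Longrightarrow> p = (\<Oplus>\<^bsub>P1\<^esub>i\<in>{..<m}. e i p \<odot>\<^bsub>P1\<^esub> b i)"
    by (rule dual_basis[OF P1 s1], rule that)
  have e_exp: "h = (\<Oplus>\<^bsub>homs\<^esub>i\<in>{..<m}. rk (e i) (h (b i)))" if "h \<in> linear_maps A P1 N" for h
    by (rule rank_one_expansion[OF P1 N that e b sum1])
  let ?I = "precomp P1 f ` linear_maps A P0 N"
  have Isub: "?I \<subseteq> linear_maps A P1 N" by (auto simp: precomp_def linear_maps_compose[OF P1 f])
  show "?I = linear_maps A P1 N"
  proof (rule ccontr)
    assume "?I \<noteq> linear_maps A P1 N"
    then obtain h0 where h0: "h0 \<in> linear_maps A P1 N" "h0 \<notin> ?I" using Isub by blast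
    define V where "V = with_smult homs (\<lambda>c h. \<lambda>p\<in>carrier P1. (c \<odot>\<^bsub>A\<^esub> \<one>\<^bsub>A\<^esub>) \<odot>\<^bsub>N\<^esub> h p)"
    define V0 where "V0 = with_smult (Hom A P0 N) (\<lambda>c h. \<lambda>p\<in>carrier P0. (c \<odot>\<^bsub>A\<^esub> \<one>\<^bsub>A\<^esub>) \<odot>\<^bsub>N\<^esub> h p)"
    have LV: "left_module K V" and LV0: "left_module K V0"
      unfolding V_def V0_def by (rule left_module_underlying_Hom[OF P1 N], rule left_module_underlying_Hom[OF P0 N])
    have "(\<lambda>g\<in>carrier V0. precomp P1 f g) \<in> linear_maps K V0 V"
    proof (rule linear_maps_restrictI[OF LV0])
      fix g assume "g \<in> carrier V0"
      then show "precomp P1 f g \<in> carrier V" using Isub by (auto simp: V0_def V_def)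
    qed (auto simp: V0_def V_def precomp_def compose_def linear_maps_closed[OF f] intro!: restrict_ext)
    from submodule_image[OF LV0 LV this] have I: "submodule ?I K V" by (simp add: V0_def)
    have Vc: "carrier V = linear_maps A P1 N" by (simp add: V_def)
    obtain L where L: "L \<in> linear_maps K V (regular_module K)" "\<And>h. h \<in> ?I \<Longrightarrow> L h = \<zero>\<^bsub>K\<^esub>" "L h0 = \<one>\<^bsub>K\<^esub>"
      using separating_functional[OF base_field LV I] h0 Vc by metis
    have Lc: "L h \<in> carrier K" if "h \<in> linear_maps A P1 N" for h
      using linear_maps_closed[OF L(1)] that by (simp add: Vc)
    have Ladd: "L (h \<oplus>\<^bsub>homs\<^esub> h') = L h \<oplus>\<^bsub>K\<^esub> L h'" if "h \<in> linear_maps A P1 N" "h' \<in> linear_maps A P1 N" for h h'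
      using linear_maps_add[OF L(1), of h h'] that by (simp add: V_def)
    \<comment> \<open>If \<open>\<phi>\<close> factors through \<open>f\<close>, then so does \<open>p \<mapsto> \<phi>(p) n\<close>.\<close>
    have LU: "L (rk \<phi> n) = \<zero>\<^bsub>K\<^esub>" if pU: "\<phi> \<in> im_dual" and n: "n \<in> carrier N" for \<phi> n
    proof -
      obtain \<psi> where \<psi>: "\<psi> \<in> linear_maps A P0 reg" "\<phi> = compose (carrier P1) \<psi> f"
        using pU unfolding im_dual_def precomp_def star_dual_simps(1) by blast
      have "rk \<phi> n = precomp P1 f (rank_one P0 N \<psi> n)"
        using linear_maps_closed[OF f] by (auto simp: \<psi>(2) precomp_def rank_one_def compose_def intro!: restrict_ext)
      then show ?thesis using L(2) rank_one_linear[OF P0 N \<psi>(1) n] by (simp only:) blast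
    qed
    have wd: "L (rk \<phi> n) = L (rk \<psi> n)"
      if \<phi>: "\<phi> \<in> linear_maps A P1 reg" and \<psi>: "\<psi> \<in> linear_maps A P1 reg" and eq: "cls \<phi> = cls \<psi>"
        and n: "n \<in> carrier N" for \<phi> \<psi> n
    proof -
      interpret D: left_module "op_alg A" dual by (rule left_dual)
      have c: "\<phi> \<in> carrier dual" "\<psi> \<in> carrier dual" using \<phi> \<psi> by auto
      have d: "\<phi> \<ominus>\<^bsub>dual\<^esub> \<psi> \<in> im_dual" using eq coset_eq_iff[OF left_dual submodule_im_dual c] by simp
      then have dl: "\<phi> \<ominus>\<^bsub>dual\<^esub> \<psi> \<in> linear_maps A P1 reg" using submodule_subset[OF submodule_im_dual] by auto
      have "\<phi> = (\<phi> \<ominus>\<^bsub>dual\<^esub> \<psi>) \<oplus>\<^bsub>dual\<^esub> \<psi>"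
        using c by (simp only: a_minus_def D.M.a_assoc D.M.a_inv_closed D.M.l_neg D.M.r_zero)
      then have "L (rk \<phi> n) = L (rk ((\<phi> \<ominus>\<^bsub>dual\<^esub> \<psi>) \<oplus>\<^bsub>dual\<^esub> \<psi>) n)" by (rule arg_cong)
      also have "\<dots> = L (rk (\<phi> \<ominus>\<^bsub>dual\<^esub> \<psi>) n) \<oplus>\<^bsub>K\<^esub> L (rk \<psi> n)"
        unfolding rk_add_left[OF dl \<psi> n] by (rule Ladd[OF rk_linear[OF dl n] rk_linear[OF \<psi> n]])
      finally show ?thesis using LU[OF d n] Lc[OF rk_linear[OF \<psi> n]] by simp
    qed
    \<comment> \<open>A class is evaluated at a chosen representative; by \<open>wd\<close> the choice does not matter.\<close>
    define \<beta> where "\<beta> n q = L (rk (SOME \<phi>. \<phi> \<in> linear_maps A P1 reg \<and> q = cls \<phi>) n)" for n q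
    have \<beta>: "\<beta> n (cls \<phi>) = L (rk \<phi> n)" if "\<phi> \<in> linear_maps A P1 reg" "n \<in> carrier N" for n \<phi>
    proof -
      let ?s = "SOME \<psi>. \<psi> \<in> linear_maps A P1 reg \<and> cls \<phi> = cls \<psi>"
      have "?s \<in> linear_maps A P1 reg \<and> cls \<phi> = cls ?s"
        by (rule someI[of _ \<phi>]) (intro conjI that(1) refl)
      then show ?thesis unfolding \<beta>_def by (intro wd that) simp_all
    qed
    define \<theta> where "\<theta> = (\<lambda>n\<in>carrier N. \<lambda>q\<in>carrier Tr. \<beta> n q)"
    have "\<theta> \<in> linear_maps A N tau" unfolding \<theta>_def
    proof (rule linear_maps_restrictI[OF N])
      fix n assume n: "n \<in> carrier N"
      have "(\<lambda>q\<in>carrier Tr. \<beta> n q) \<in> linear_maps K (underlying_space (op_alg A) Tr) (regular_module K)"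
      proof (rule linear_mapsI)
        fix q assume "q \<in> carrier (underlying_space (op_alg A) Tr)"
        then obtain \<phi> where "\<phi> \<in> linear_maps A P1 reg" "q = cls \<phi>" using Tr_carrier_iff by auto
        then show "(\<lambda>q\<in>carrier Tr. \<beta> n q) q \<in> carrier (regular_module K)"
          using n cls_closed by (simp add: \<beta> Lc rk_linear)
      next
        fix q q' assume "q \<in> carrier (underlying_space (op_alg A) Tr)" "q' \<in> carrier (underlying_space (op_alg A) Tr)"
        then obtain \<phi> \<psi> where q: "\<phi> \<in> linear_maps A P1 reg" "q = cls \<phi>" "\<psi> \<in> linear_maps A P1 reg" "q' = cls \<psi>"
          using Tr_carrier_iff by auto
        have "\<beta> n (cls (\<phi> \<oplus>\<^bsub>dual\<^esub> \<psi>)) = \<beta> n (cls \<phi>) \<oplus>\<^bsub>K\<^esub> \<beta> n (cls \<psi>)"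
          unfolding \<beta>[OF dual_add_closed[OF q(1,3)] n] \<beta>[OF q(1) n] \<beta>[OF q(3) n] rk_add_left[OF q(1,3) n]
          by (rule Ladd[OF rk_linear[OF q(1) n] rk_linear[OF q(3) n]])
        then show "(\<lambda>q\<in>carrier Tr. \<beta> n q) (q \<oplus>\<^bsub>underlying_space (op_alg A) Tr\<^esub> q')
            = (\<lambda>q\<in>carrier Tr. \<beta> n q) q \<oplus>\<^bsub>regular_module K\<^esub> (\<lambda>q\<in>carrier Tr. \<beta> n q) q'"
          using q cls_closed[OF q(1)] cls_closed[OF q(3)] cls_closed[OF dual_add_closed[OF q(1,3)]]
          by (simp del: star_dual_simps add: cls_add)
      next
        fix c q assume c: "c \<in> carrier K" and "q \<in> carrier (underlying_space (op_alg A) Tr)"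
        then obtain \<phi> where q: "\<phi> \<in> linear_maps A P1 reg" "q = cls \<phi>" using Tr_carrier_iff by auto
        note sc = scalar_closed[OF c]
        have "rk ((c \<odot>\<^bsub>A\<^esub> \<one>\<^bsub>A\<^esub>) \<odot>\<^bsub>dual\<^esub> \<phi>) n = c \<odot>\<^bsub>V\<^esub> rk \<phi> n"
          using n dual_apply_closed[OF q(1)] sc
          by (auto simp: V_def rank_one_def scalar_central[OF c] N.smult_assoc1 intro!: restrict_ext)
        then have "\<beta> n (cls ((c \<odot>\<^bsub>A\<^esub> \<one>\<^bsub>A\<^esub>) \<odot>\<^bsub>dual\<^esub> \<phi>)) = c \<otimes>\<^bsub>K\<^esub> \<beta> n (cls \<phi>)"
          unfolding \<beta>[OF dual_smult_closed[OF sc q(1)] n] \<beta>[OF q(1) n]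
          using linear_maps_smult[OF L(1) c, of "rk \<phi> n"] rk_linear[OF q(1) n] by (simp add: Vc)
        then show "(\<lambda>q\<in>carrier Tr. \<beta> n q) (c \<odot>\<^bsub>underlying_space (op_alg A) Tr\<^esub> q)
            = c \<odot>\<^bsub>regular_module K\<^esub> (\<lambda>q\<in>carrier Tr. \<beta> n q) q"
          using q cls_closed[OF q(1)] cls_closed[OF dual_smult_closed[OF sc q(1)]]
          by (simp del: star_dual_simps add: cls_smult[OF sc])
      qed simp
      then show "(\<lambda>q\<in>carrier Tr. \<beta> n q) \<in> carrier tau" by (simp add: tau_def)
    next
      fix n n' assume n: "n \<in> carrier N" "n' \<in> carrier N"
      have "\<beta> (n \<oplus>\<^bsub>N\<^esub> n') q = \<beta> n q \<oplus>\<^bsub>K\<^esub> \<beta> n' q" if "q \<in> carrier Tr" for q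
      proof -
        obtain \<phi> where q: "\<phi> \<in> linear_maps A P1 reg" "q = cls \<phi>" using Tr_carrier_iff \<open>q \<in> carrier Tr\<close> by auto
        have nn: "n \<oplus>\<^bsub>N\<^esub> n' \<in> carrier N" using n by simp
        show ?thesis
          unfolding q(2) \<beta>[OF q(1) n(1)] \<beta>[OF q(1) n(2)] \<beta>[OF q(1) nn] rk_add_right[OF q(1) n]
          by (rule Ladd[OF rk_linear[OF q(1) n(1)] rk_linear[OF q(1) n(2)]])
      qed
      then show "(\<lambda>q\<in>carrier Tr. \<beta> (n \<oplus>\<^bsub>N\<^esub> n') q) = (\<lambda>q\<in>carrier Tr. \<beta> n q) \<oplus>\<^bsub>tau\<^esub> (\<lambda>q\<in>carrier Tr. \<beta> n' q)"
        by (auto simp: tau_def intro!: restrict_ext)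
    next
      fix a n assume a: "a \<in> carrier A" and n: "n \<in> carrier N"
      have "\<beta> (a \<odot>\<^bsub>N\<^esub> n) q = \<beta> n (a \<odot>\<^bsub>Tr\<^esub> q)" if "q \<in> carrier Tr" for q
      proof -
        obtain \<phi> where q: "\<phi> \<in> linear_maps A P1 reg" "q = cls \<phi>" using Tr_carrier_iff \<open>q \<in> carrier Tr\<close> by auto
        show ?thesis
          unfolding q(2) \<beta>[OF q(1) N.smult_closed[OF a n]] cls_smult[OF a q(1)] \<beta>[OF dual_smult_closed[OF a q(1)] n]
            rk_balanced[OF a q(1) n] ..
      qed
      then show "(\<lambda>q\<in>carrier Tr. \<beta> (a \<odot>\<^bsub>N\<^esub> n) q) = a \<odot>\<^bsub>tau\<^esub> (\<lambda>q\<in>carrier Tr. \<beta> n q)"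
        using Tr_smult_closed[OF a] by (auto simp: tau_def intro!: restrict_ext)
    qed
    then have "\<theta> \<in> carrier (Hom A N tau)" by (simp only: Hom_simps(1))
    then have \<theta>0: "\<theta> = \<zero>\<^bsub>Hom A N tau\<^esub>" unfolding triv by (rule singletonD)
    have L0: "L (rk \<phi> n) = \<zero>\<^bsub>K\<^esub>" if \<phi>: "\<phi> \<in> linear_maps A P1 reg" and n: "n \<in> carrier N" for \<phi> n
      using fun_cong[OF fun_cong[OF \<theta>0, of n], of "cls \<phi>"] n cls_closed[OF \<phi>]
      by (simp add: \<theta>_def tau_def \<beta>[OF \<phi> n])
    have st: "(\<lambda>i. rk (e i) (h0 (b i))) \<in> {..<m} \<rightarrow> linear_maps A P1 N"
      using rk_linear[OF e linear_maps_closed[OF h0(1) b]] by auto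
    have "L h0 = L (\<Oplus>\<^bsub>homs\<^esub>i\<in>{..<m}. rk (e i) (h0 (b i)))" by (rule arg_cong[OF e_exp[OF h0(1)]])
    also have "\<dots> = (\<Oplus>\<^bsub>K\<^esub>i\<in>{..<m}. L (rk (e i) (h0 (b i))))"
      by (rule additive_finsum[OF H.abelian_group_axioms R.abelian_group_axioms, where f = L])
        (use Lc Ladd st in \<open>simp_all del: Hom_simps add: Hom_simps(1)\<close>)
    also have "\<dots> = (\<Oplus>\<^bsub>K\<^esub>i\<in>{..<m}. \<zero>\<^bsub>K\<^esub>)"
      using L0[OF e linear_maps_closed[OF h0(1) b]] by (intro R.finsum_cong') auto
    also have "\<dots> = \<zero>\<^bsub>K\<^esub>" by (rule R.finsum_zero)
    finally show False using L(3) K.one_not_zero by simp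
  qed
qed

lemma Hom_translate_zero_iff:
  "carrier (Hom A N (K_dual K (op_alg A) (transpose_module A P1 P0 f)))
      = {\<zero>\<^bsub>Hom A N (K_dual K (op_alg A) (transpose_module A P1 P0 f))\<^esub>} \<longleftrightarrow>
    precomp P1 f ` linear_maps A P0 N = linear_maps A P1 N"
  unfolding tau_eq[symmetric]
  using Hom_translate_zero_if_surj surj_if_Hom_translate_zero by blast

end

section \<open>Approximations, covers and minimal presentations\<close>

text \<open>
  If the kernel is superfluous and \<open>f h = f\<close>, then the image of \<open>h\<close> and the kernel of \<open>f\<close> together
  span \<open>P\<close>, so \<open>h\<close> is onto and has a section \<open>s\<close>.  Again \<open>f s = f\<close>, so \<open>s\<close> is onto as well, and \<open>h\<close> is
  bijective.  Conversely, if \<open>U\<close> and the kernel span \<open>P\<close>, then \<open>f\<close> lifts along its restriction to \<open>U\<close>; the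
  lift is an endomorphism \<open>k\<close> with \<open>f k = f\<close> and image in \<open>U\<close>.
\<close>

lemma superfluous_kernel_iff_right_minimal:
  assumes P: "left_module R P" "summand_of_copies R (regular_module R) P"
    and Y: "left_module R Y" and f: "f \<in> linear_maps R P Y" "f ` carrier P = carrier Y"
  shows "(\<forall>U. submodule U R P \<and> U <+>\<^bsub>P\<^esub> a_kernel P Y f = carrier P \<longrightarrow> U = carrier P) \<longleftrightarrow>
    right_minimal R P f"
proof
  interpret P: left_module R P by (rule P(1))
  interpret Y: left_module R Y by (rule Y)
  assume sup: "\<forall>U. submodule U R P \<and> U <+>\<^bsub>P\<^esub> a_kernel P Y f = carrier P \<longrightarrow> U = carrier P"
  have surj: "h ` carrier P = carrier P" if h: "h \<in> linear_maps R P P" "compose (carrier P) f h = f" for h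
  proof -
    have fh: "f (h p) = f p" if "p \<in> carrier P" for p
      using fun_cong[OF h(2), of p] that by (simp add: compose_eq)
    have hc: "h p \<in> carrier P" if "p \<in> carrier P" for p by (rule linear_maps_closed[OF h(1) that])
    have "carrier P \<subseteq> h ` carrier P <+>\<^bsub>P\<^esub> a_kernel P Y f"
    proof
      fix p assume p: "p \<in> carrier P"
      have "f (p \<ominus>\<^bsub>P\<^esub> h p) = f p \<oplus>\<^bsub>Y\<^esub> \<ominus>\<^bsub>Y\<^esub> f (h p)"
        using p hc unfolding a_minus_def
        by (simp add: linear_maps_add[OF f(1)] linear_maps_minus[OF P.M.abelian_group_axioms Y.M.abelian_group_axioms f(1)])
      then have "p \<ominus>\<^bsub>P\<^esub> h p \<in> a_kernel P Y f"
        using p hc fh linear_maps_closed[OF f(1) p] by (simp add: a_kernel_def' Y.M.r_neg)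
      moreover have "p = h p \<oplus>\<^bsub>P\<^esub> (p \<ominus>\<^bsub>P\<^esub> h p)"
        using p hc by (simp add: a_minus_def P.M.a_lcomm P.M.r_neg)
      ultimately show "p \<in> h ` carrier P <+>\<^bsub>P\<^esub> a_kernel P Y f"
        using p unfolding set_add_def' by blast
    qed
    then have "h ` carrier P <+>\<^bsub>P\<^esub> a_kernel P Y f = carrier P"
      using hc by (auto simp: set_add_def' a_kernel_def')
    then show ?thesis using sup submodule_image[OF P(1) P(1) h(1)] by blast
  qed
  show "right_minimal R P f"
    unfolding right_minimal_def
  proof (intro ballI impI)
    fix h assume h: "h \<in> linear_maps R P P" "compose (carrier P) f h = f"
    obtain s where s: "s \<in> linear_maps R P P" "compose (carrier P) h s = (\<lambda>p\<in>carrier P. p)"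
      using projective_lift[OF P P(1) P(1) h(1) surj[OF h] linear_maps_id[OF P(1)]] by blast
    have hs: "h (s p) = p" if "p \<in> carrier P" for p
      using fun_cong[OF s(2), of p] that by (simp add: compose_eq)
    have "compose (carrier P) f s = f"
    proof (rule linear_maps_ext[OF linear_maps_compose[OF P(1) s(1) f(1)] f(1)])
      fix p assume p: "p \<in> carrier P"
      have "f (s p) = f (h (s p))"
        using fun_cong[OF h(2), of "s p"] linear_maps_closed[OF s(1) p] by (simp add: compose_eq)
      then show "compose (carrier P) f s p = f p" using p hs by (simp add: compose_eq)
    qed
    then have s_surj: "s ` carrier P = carrier P" by (rule surj[OF s(1)])
    have "inj_on h (carrier P)"
    proof (rule inj_onI)
      fix x y assume xy: "x \<in> carrier P" "y \<in> carrier P" "h x = h y"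
      then obtain a b where "a \<in> carrier P" "x = s a" "b \<in> carrier P" "y = s b"
        using s_surj by (metis imageE)
      then show "x = y" using xy hs by simp
    qed
    then show "bij_betw h (carrier P) (carrier P)" using surj[OF h] by (simp add: bij_betw_def)
  qed
next
  interpret P: left_module R P by (rule P(1))
  interpret Y: left_module R Y by (rule Y)
  assume min: "right_minimal R P f"
  show "\<forall>U. submodule U R P \<and> U <+>\<^bsub>P\<^esub> a_kernel P Y f = carrier P \<longrightarrow> U = carrier P"
  proof (intro allI impI)
    fix U assume U: "submodule U R P \<and> U <+>\<^bsub>P\<^esub> a_kernel P Y f = carrier P"
    let ?U = "P\<lparr>carrier := U\<rparr>"
    have LU: "left_module R ?U" using left_module_submodule[OF P(1)] U by blast
    note Uc = subsetD[OF submodule_subset[of U R P]]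
    have fU: "(\<lambda>u\<in>carrier ?U. f u) \<in> linear_maps R ?U Y"
      by (rule linear_maps_restrictI[OF LU])
        (use U Uc in \<open>auto simp: linear_maps_closed[OF f(1)] linear_maps_add[OF f(1)] linear_maps_smult[OF f(1)]\<close>)
    have "carrier Y \<subseteq> (\<lambda>u\<in>carrier ?U. f u) ` carrier ?U"
    proof
      fix y assume "y \<in> carrier Y"
      then obtain p where p: "p \<in> carrier P" "y = f p" using f(2) by blast
      then obtain u k where uk: "u \<in> U" "k \<in> a_kernel P Y f" "p = u \<oplus>\<^bsub>P\<^esub> k"
        using U unfolding set_add_def' by blast
      then have "u \<in> carrier P" "k \<in> carrier P" "f k = \<zero>\<^bsub>Y\<^esub>" using U Uc by (auto simp: a_kernel_def')
      then have "y = f u" using uk p by (simp add: linear_maps_add[OF f(1)] linear_maps_closed[OF f(1)])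
      then show "y \<in> (\<lambda>u\<in>carrier ?U. f u) ` carrier ?U" using uk(1) by simp
    qed
    then have fUs: "(\<lambda>u\<in>carrier ?U. f u) ` carrier ?U = carrier Y"
      using linear_maps_closed[OF fU] by blast
    obtain k where k: "k \<in> linear_maps R P ?U" "compose (carrier P) (\<lambda>u\<in>carrier ?U. f u) k = f"
      using projective_lift[OF P LU Y fU fUs f(1)] by blast
    have kP: "k \<in> linear_maps R P P" by (rule linear_maps_enlarge[OF k(1)]) (use U Uc in auto)
    have kU: "k p \<in> U" if "p \<in> carrier P" for p using linear_maps_closed[OF k(1) that] by simp
    have "compose (carrier P) f k = compose (carrier P) (\<lambda>u\<in>carrier ?U. f u) k"
      using kU by (simp add: compose_def cong: restrict_cong)
    then have "bij_betw k (carrier P) (carrier P)"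
      using min kP k(2) unfolding right_minimal_def by simp
    then have "k ` carrier P = carrier P" by (rule bij_betw_imp_surj_on)
    then have "carrier P \<subseteq> U" using kU by (metis image_subsetI)
    then show "U = carrier P" using U submodule_subset[of U R P] by (intro subset_antisym) simp_all
  qed
qed

text \<open>
  Maps from \<open>E\<close> suffice as test objects: a map from a summand of \<open>E\<^sup>n\<close> is a sum of maps that factor
  through \<open>E\<close>.
\<close>

lemma right_add_approxI:
  fixes Q Y :: "('a, nat \<Rightarrow> 'k) module"
  assumes "left_module R E" "in_add R E Q" "left_module R Y" "f \<in> linear_maps R Q Y"
    and "postcomp E f ` linear_maps R E Q = linear_maps R E Y"
  shows "right_add_approx R E Q Y f"
  unfolding right_add_approx_def
proof (intro conjI allI impI assms(2,4))
  fix Q' :: "('a, nat \<Rightarrow> 'k) module"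
  assume "in_add R E Q'"
  then have Q': "left_module R Q'" "summand_of_copies R E Q'"
    using in_add_iff[OF assms(1)] by (auto simp: fg_module_def)
  have Q: "left_module R Q" using assms(2) by (auto simp: in_add_def fg_module_def)
  interpret Q': left_module R Q' by (rule Q'(1))
  interpret Q: left_module R Q by (rule Q)
  interpret Y: left_module R Y by fact
  obtain n :: nat and s r where s: "\<And>j. j < n \<Longrightarrow> s j \<in> linear_maps R Q' E"
    and r: "\<And>j. j < n \<Longrightarrow> r j \<in> linear_maps R E Q'"
    and sum: "\<And>x. x \<in> carrier Q' \<Longrightarrow> x = (\<Oplus>\<^bsub>Q'\<^esub>j\<in>{..<n}. r j (s j x))"
    using Q'(2) unfolding summand_of_copies_def by blast
  have "q \<in> postcomp Q' f ` linear_maps R Q' Q" if q: "q \<in> linear_maps R Q' Y" for q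
  proof -
    have "\<forall>j\<in>{..<n}. \<exists>t. t \<in> linear_maps R E Q \<and> compose (carrier E) q (r j) = compose (carrier E) f t"
    proof
      fix j assume "j \<in> {..<n}"
      then have "compose (carrier E) q (r j) \<in> linear_maps R E Y"
        using linear_maps_compose[OF assms(1) r q] by simp
      then show "\<exists>t. t \<in> linear_maps R E Q \<and> compose (carrier E) q (r j) = compose (carrier E) f t"
        using assms(5) unfolding postcomp_def by blast
    qed
    then obtain t where t: "\<And>j. j < n \<Longrightarrow> t j \<in> linear_maps R E Q"
      and qt: "\<And>j. j < n \<Longrightarrow> compose (carrier E) q (r j) = compose (carrier E) f (t j)"
      using bchoice[of "{..<n}" "\<lambda>j t. t \<in> linear_maps R E Q \<and> compose (carrier E) q (r j) = compose (carrier E) f t"]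
      by auto
    interpret H: abelian_group "Hom R Q' Q" by (rule left_module_Hom[OF Q'(1) Q])
    let ?k = "\<Oplus>\<^bsub>Hom R Q' Q\<^esub>j\<in>{..<n}. compose (carrier Q') (t j) (s j)"
    have st: "(\<lambda>j. compose (carrier Q') (t j) (s j)) \<in> {..<n} \<rightarrow> linear_maps R Q' Q"
      using linear_maps_compose[OF Q'(1) s t] by auto
    have k: "?k \<in> linear_maps R Q' Q" using H.finsum_closed[of _ "{..<n}"] st by simp
    have "q = compose (carrier Q') f ?k"
    proof (rule linear_maps_ext[OF q linear_maps_compose[OF Q'(1) k assms(4)]])
      fix x assume x: "x \<in> carrier Q'"
      have sx: "s j x \<in> carrier E" if "j < n" for j by (rule linear_maps_closed[OF s[OF that] x])
      have tx: "(\<lambda>j. t j (s j x)) \<in> {..<n} \<rightarrow> carrier Q" using linear_maps_closed[OF t sx] by auto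
      have rx: "(\<lambda>j. r j (s j x)) \<in> {..<n} \<rightarrow> carrier Q'" using linear_maps_closed[OF r sx] by auto
      have eq: "q (r j (s j x)) = f (t j (s j x))" if "j < n" for j
        using fun_cong[OF qt[OF that], of "s j x"] sx[OF that] by (simp add: compose_eq)
      have "q x = q (\<Oplus>\<^bsub>Q'\<^esub>j\<in>{..<n}. r j (s j x))" by (rule arg_cong[OF sum[OF x]])
      also have "\<dots> = (\<Oplus>\<^bsub>Y\<^esub>j\<in>{..<n}. q (r j (s j x)))"
        by (rule linear_maps_finsum[OF q Q'.M.abelian_group_axioms Y.M.abelian_group_axioms rx])
      also have "\<dots> = (\<Oplus>\<^bsub>Y\<^esub>j\<in>{..<n}. f (t j (s j x)))"
        using eq tx linear_maps_closed[OF assms(4)] by (intro Y.M.finsum_cong') auto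
      also have "\<dots> = f (\<Oplus>\<^bsub>Q\<^esub>j\<in>{..<n}. t j (s j x))"
        by (rule linear_maps_finsum[OF assms(4) Q.M.abelian_group_axioms Y.M.abelian_group_axioms tx, symmetric])
      also have "(\<Oplus>\<^bsub>Q\<^esub>j\<in>{..<n}. t j (s j x)) = ?k x"
        using Hom_finsum_apply[OF Q'(1) Q st x] x by (simp add: compose_eq)
      finally show "q x = compose (carrier Q') f ?k x" using x by (simp add: compose_eq)
    qed
    then show ?thesis using k by (auto simp: postcomp_def)
  qed
  moreover have "postcomp Q' f ` linear_maps R Q' Q \<subseteq> linear_maps R Q' Y"
    by (auto simp: postcomp_def linear_maps_compose[OF Q'(1) _ assms(4)])
  ultimately show "postcomp Q' f ` linear_maps R Q' Q = linear_maps R Q' Y" by blast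
qed

text \<open>
  Test the approximation on a copy of \<open>E\<close> in the carrier type of the modules.
\<close>

lemma right_add_approx_surj:
  fixes Q Y :: "('a, nat \<Rightarrow> 'k) module"
  assumes "fg_module R E" "embeddable (carrier E) TYPE(nat \<Rightarrow> 'k)" "right_add_approx R E Q Y f"
  shows "postcomp E f ` linear_maps R E Q = linear_maps R E Y"
proof -
  have E: "left_module R E" using assms(1) by (simp add: fg_module_def)
  have f: "f \<in> linear_maps R Q Y" using assms(3) by (simp add: right_add_approx_def)
  obtain E' :: "('a, nat \<Rightarrow> 'k) module" and \<iota> where E': "left_module R E'" "\<iota> \<in> linear_maps R E E'"
    "bij_betw \<iota> (carrier E) (carrier E')"
    by (rule transport_module[OF E assms(2)])
  then have iso: "mod_iso R E E'" by (auto simp: mod_iso_def)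
  let ?i = "\<lambda>y\<in>carrier E'. inv_into (carrier E) \<iota> y"
  have i: "?i \<in> linear_maps R E' E" by (rule linear_maps_inverse[OF E E'])
  interpret E: left_module R E by (rule E)
  have "summand_of_copies R E E"
    by (rule summand_of_copiesI[of 1 "\<lambda>_. \<lambda>x\<in>carrier E. x" _ _ _ "\<lambda>_. \<lambda>x\<in>carrier E. x"])
      (auto simp: linear_maps_id[OF E, unfolded restrict_def] lessThan_Suc intro: linear_maps_id[OF E])
  then have "in_add R E E'"
    unfolding in_add_iff[OF E]
    using fg_module_iso[OF assms(1) E'(1) iso] summand_of_copies_iso[OF E E E'(1) iso] by blast
  then have surj: "postcomp E' f ` linear_maps R E' Q = linear_maps R E' Y"
    using assms(3) by (simp add: right_add_approx_def)
  have "h \<in> postcomp E f ` linear_maps R E Q" if h: "h \<in> linear_maps R E Y" for h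
  proof -
    obtain k where k: "k \<in> linear_maps R E' Q" "compose (carrier E') h ?i = compose (carrier E') f k"
      using surj linear_maps_compose[OF E'(1) i h] unfolding postcomp_def by blast
    have "h = compose (carrier E) f (compose (carrier E) k \<iota>)"
    proof (rule linear_maps_ext[OF h])
      show "compose (carrier E) f (compose (carrier E) k \<iota>) \<in> linear_maps R E Y"
        by (intro linear_maps_compose[OF E _ f] linear_maps_compose[OF E E'(2) k(1)])
      fix x assume x: "x \<in> carrier E"
      then show "h x = compose (carrier E) f (compose (carrier E) k \<iota>) x"
        using fun_cong[OF k(2), of "\<iota> x"] linear_maps_closed[OF E'(2) x] bij_betw_inv_into_left[OF E'(3) x]
        by (simp add: compose_eq)
    qed
    then show ?thesis using linear_maps_compose[OF E E'(2) k(1)] by (auto simp: postcomp_def)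
  qed
  moreover have "postcomp E f ` linear_maps R E Q \<subseteq> linear_maps R E Y"
    by (auto simp: postcomp_def linear_maps_compose[OF E _ f])
  ultimately show ?thesis by blast
qed

section \<open>The correspondence\<close>

text \<open>
  A relation that is total on both sides and identifies the two isomorphism relations induces a
  bijection on classes, although it is not a function on modules.
\<close>

lemma iso_classes_bij:
  assumes ex: "\<And>M. M \<in> \<C> \<Longrightarrow> \<exists>N\<in>\<D>. Rel M N" and ex': "\<And>N. N \<in> \<D> \<Longrightarrow> \<exists>M\<in>\<C>. Rel M N"
    and iff: "\<And>M N M' N'. M \<in> \<C> \<Longrightarrow> N \<in> \<D> \<Longrightarrow> M' \<in> \<C> \<Longrightarrow> N' \<in> \<D> \<Longrightarrow> Rel M N \<Longrightarrow> Rel M' N' \<Longrightarrow>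
      mod_iso R M M' \<longleftrightarrow> mod_iso S N N'"
    and C: "\<And>M. M \<in> \<C> \<Longrightarrow> left_module R M" and D: "\<And>N. N \<in> \<D> \<Longrightarrow> left_module S N"
  shows "\<exists>\<phi>. bij_betw \<phi> (iso_classes R \<C>) (iso_classes S \<D>)"
proof -
  let ?r = "{(M, N). M \<in> \<C> \<and> N \<in> \<C> \<and> mod_iso R M N}" and ?s = "{(M, N). M \<in> \<D> \<and> N \<in> \<D> \<and> mod_iso S M N}"
  let ?\<phi> = "\<lambda>W. {N \<in> \<D>. \<exists>M\<in>W. Rel M N}"
  have \<phi>: "?\<phi> (?r `` {M}) = ?s `` {N}" if M: "M \<in> \<C>" and N: "N \<in> \<D>" and MN: "Rel M N" for M N
  proof
    show "?\<phi> (?r `` {M}) \<subseteq> ?s `` {N}" using iff[OF M N _ _ MN] M N by blast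
    show "?s `` {N} \<subseteq> ?\<phi> (?r `` {M})"
    proof
      fix N' assume "N' \<in> ?s `` {N}"
      then have N': "N' \<in> \<D>" "mod_iso S N N'" by auto
      then obtain M' where M': "M' \<in> \<C>" "Rel M' N'" using ex' by blast
      then show "N' \<in> ?\<phi> (?r `` {M})" using iff[OF M N M'(1) N'(1) MN M'(2)] M N' by blast
    qed
  qed
  have "bij_betw ?\<phi> (\<C> // ?r) (\<D> // ?s)"
    unfolding bij_betw_def
  proof
    show "inj_on ?\<phi> (\<C> // ?r)"
    proof (rule inj_onI)
      fix A B assume A: "A \<in> \<C> // ?r" and B: "B \<in> \<C> // ?r" and eq: "?\<phi> A = ?\<phi> B"
      obtain M where M: "M \<in> \<C>" "A = ?r `` {M}" using A by (rule quotientE)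
      obtain M' where M': "M' \<in> \<C>" "B = ?r `` {M'}" using B by (rule quotientE)
      obtain N where N: "N \<in> \<D>" "Rel M N" using ex[OF M(1)] by blast
      obtain N' where N': "N' \<in> \<D>" "Rel M' N'" using ex[OF M'(1)] by blast
      have "?s `` {N} = ?s `` {N'}" using eq \<phi>[OF M(1) N] \<phi>[OF M'(1) N'] M(2) M'(2) by simp
      moreover have "N' \<in> ?s `` {N'}" using N'(1) mod_iso_refl[OF D[OF N'(1)]] by simp
      ultimately have "mod_iso S N N'" by auto
      then have iso: "mod_iso R M M'" using iff[OF M(1) N(1) M'(1) N'(1) N(2) N'(2)] by simp
      have "mod_iso R M' M" by (rule mod_iso_sym[OF C[OF M(1)] C[OF M'(1)] iso])
      then show "A = B"
        using iso M M' mod_iso_trans[OF C[OF M(1)] iso] mod_iso_trans[OF C[OF M'(1)], of M]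
        by auto
    qed
    show "?\<phi> ` (\<C> // ?r) = \<D> // ?s"
    proof
      show "?\<phi> ` (\<C> // ?r) \<subseteq> \<D> // ?s"
      proof
        fix B assume "B \<in> ?\<phi> ` (\<C> // ?r)"
        then obtain M where M: "M \<in> \<C>" "B = ?\<phi> (?r `` {M})" by (auto elim: quotientE)
        obtain N where N: "N \<in> \<D>" "Rel M N" using ex[OF M(1)] by blast
        show "B \<in> \<D> // ?s" unfolding M(2) \<phi>[OF M(1) N] by (rule quotientI[OF N(1)])
      qed
      show "\<D> // ?s \<subseteq> ?\<phi> ` (\<C> // ?r)"
      proof
        fix B assume "B \<in> \<D> // ?s"
        then obtain N where N: "N \<in> \<D>" "B = ?s `` {N}" by (rule quotientE)
        obtain M where M: "M \<in> \<C>" "Rel M N" using ex'[OF N(1)] by blast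
        show "B \<in> ?\<phi> ` (\<C> // ?r)"
          by (rule image_eqI[of _ _ "?r `` {M}"]) (simp_all only: N(2) \<phi>[OF M(1) N(1) M(2)] quotientI[OF M(1)])
      qed
    qed
  qed
  then show ?thesis unfolding iso_classes_def by blast
qed

lemma End_op_algebra:
  assumes "fd_algebra K \<Lambda>" "left_module \<Lambda> E"
  shows "algebra_over_field K (End_op \<Lambda> E)"
proof -
  interpret \<Lambda>: fd_algebra K \<Lambda> by fact
  interpret E: left_module \<Lambda> E by fact
  interpret \<Lambda>a: algebra_over_field K \<Lambda>
    by (rule algebra_over_field.intro[OF \<Lambda>.module_axioms \<Lambda>.ring_axioms
          algebra_over_field_axioms.intro[OF \<Lambda>.base_field \<Lambda>.smult_assoc2 \<Lambda>.smult_assoc3]])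
  let ?G = "End_op \<Lambda> E"
  interpret G: ring ?G by (rule ring_End_op[OF assms(2)])
  note V = \<Lambda>a.left_module_underlying_Hom[OF assms(2,2)]
  have "module K ?G"
  proof (rule moduleI[OF \<Lambda>.R.cring_axioms G.abelian_group_axioms], goal_cases)
    case (1 a x) then show ?case using left_module.smult_closed[OF V, of a x] by simp
  next
    case (2 a b x) then show ?case using left_module.smult_l_distr[OF V, of a b x] by simp
  next
    case (3 a x y) then show ?case using left_module.smult_r_distr[OF V, of a x y] by simp
  next
    case (4 a b x) then show ?case using left_module.smult_assoc1[OF V, of a b x] by simp
  next
    case (5 x) then show ?case using left_module.smult_one[OF V, of x] by simp
  qed
  then show ?thesis
  proof (intro algebra_over_field.intro algebra_over_field_axioms.intro)
    show "ring ?G" by (rule G.ring_axioms)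
    show "field K" by (rule \<Lambda>.base_field)
  next
    fix c f g assume c: "c \<in> carrier K" and "f \<in> carrier ?G" "g \<in> carrier ?G"
    then have f: "f \<in> linear_maps \<Lambda> E E" and g: "g \<in> linear_maps \<Lambda> E E" by auto
    note sc = \<Lambda>a.scalar_closed[OF c]
    show "c \<odot>\<^bsub>?G\<^esub> f \<otimes>\<^bsub>?G\<^esub> g = c \<odot>\<^bsub>?G\<^esub> (f \<otimes>\<^bsub>?G\<^esub> g)"
      by (simp add: compose_def linear_maps_closed[OF f] linear_maps_smult[OF g sc] cong: restrict_cong)
    show "f \<otimes>\<^bsub>?G\<^esub> (c \<odot>\<^bsub>?G\<^esub> g) = c \<odot>\<^bsub>?G\<^esub> (f \<otimes>\<^bsub>?G\<^esub> g)"
      by (simp add: compose_def linear_maps_closed[OF f] cong: restrict_cong)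
  qed
qed

context generator_module
begin

lemma mod_iso_iff_represented:
  assumes "rep M N \<eta>" "rep M' N' \<eta>'"
  shows "mod_iso \<Lambda> M M' \<longleftrightarrow> mod_iso \<Gamma> N N'"
  unfolding mod_iso_def rmap_image[OF assms, symmetric]
  by (simp only: bex_simps rmap_bij_iff[OF assms] cong: bex_cong)

lemma indecomposable_iff_represented:
  assumes "rep M N \<eta>"
  shows "indecomposable \<Lambda> M \<longleftrightarrow> indecomposable \<Gamma> N"
proof -
  note M = representsD(1)[OF assms] and N = representsD(2)[OF assms]
  note z = rmap_eq_zero_iff[OF assms assms] and i = rmap_eq_id_iff[OF assms]
  have idem: "compose (carrier N) (rmap M N \<eta> \<eta> p) (rmap M N \<eta> \<eta> p) = rmap M N \<eta> \<eta> p \<longleftrightarrow>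
      compose (carrier M) p p = p" if p: "p \<in> linear_maps \<Lambda> M M" for p
    unfolding rmap_compose[OF assms assms assms p p]
    by (rule iffI, rule rmap_inj[OF assms assms linear_maps_compose[OF M p p] p]) simp_all
  have nz: "(\<lambda>x\<in>carrier N. x) = (\<lambda>x\<in>carrier N. \<zero>\<^bsub>N\<^esub>) \<longleftrightarrow> (\<lambda>x\<in>carrier M. x) = (\<lambda>x\<in>carrier M. \<zero>\<^bsub>M\<^esub>)"
    using z[OF linear_maps_id[OF M]] unfolding rmap_id[OF assms] .
  show ?thesis
    unfolding indecomposable_iff_idempotents[OF M] indecomposable_iff_idempotents[OF N]
      rmap_image[OF assms assms, symmetric] nz
    by (simp only: ball_simps idem z i cong: ball_cong)
qed

text \<open>
  Right minimality speaks only of the endomorphisms of the source and of composites with \<open>f\<close>, all of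
  which a fully faithful functor preserves and reflects.
\<close>

lemma right_minimal_iff_represented:
  assumes "rep W P \<eta>" "rep Y Q \<zeta>" "f \<in> linear_maps \<Lambda> W Y"
  shows "right_minimal \<Lambda> W f \<longleftrightarrow> right_minimal \<Gamma> P (rmap W P \<eta> \<zeta> f)"
proof -
  note W = representsD(1)[OF assms(1)]
  have c: "compose (carrier P) (rmap W P \<eta> \<zeta> f) (rmap W P \<eta> \<eta> h) = rmap W P \<eta> \<zeta> f \<longleftrightarrow>
      compose (carrier W) f h = f" if h: "h \<in> linear_maps \<Lambda> W W" for h
    unfolding rmap_compose[OF assms(1,1,2) h assms(3)]
    by (rule iffI, rule rmap_inj[OF assms(1,2) linear_maps_compose[OF W h assms(3)] assms(3)]) simp_all
  show ?thesis
    unfolding right_minimal_def rmap_image[OF assms(1,1), symmetric]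
    by (simp only: ball_simps c rmap_bij_iff[OF assms(1,1)] cong: ball_cong)
qed

text \<open>
  The maps \<open>e \<mapsto> \<pi>(e) y\<close> lift along \<open>f\<close>, so \<open>y\<close> is a sum of values of \<open>f\<close>.
\<close>

lemma postcomp_surj_reflect:
  assumes "left_module \<Lambda> W" "left_module \<Lambda> Y" "f \<in> linear_maps \<Lambda> W Y"
    and "postcomp E f ` linear_maps \<Lambda> E W = linear_maps \<Lambda> E Y"
  shows "f ` carrier W = carrier Y"
proof
  show "f ` carrier W \<subseteq> carrier Y" using linear_maps_closed[OF assms(3)] by blast
  show "carrier Y \<subseteq> f ` carrier W"
  proof
    fix y assume y: "y \<in> carrier Y"
    show "y \<in> f ` carrier W"
    proof (rule generator_detects[OF assms(2) submodule_image[OF assms(1-3)] y])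
      fix \<pi> u assume \<pi>: "\<pi> \<in> linear_maps \<Lambda> E (regular_module \<Lambda>)" and u: "u \<in> carrier E"
      let ?h = "\<lambda>e\<in>carrier E. \<pi> e \<odot>\<^bsub>Y\<^esub> y"
      have "?h \<in> postcomp E f ` linear_maps \<Lambda> E W"
        unfolding assms(4) by (rule trace_map[OF assms(2) \<pi> y])
      then obtain k where k: "k \<in> linear_maps \<Lambda> E W" "?h = compose (carrier E) f k"
        unfolding postcomp_def by blast
      show "?h u \<in> f ` carrier W"
        unfolding k(2) using linear_maps_closed[OF k(1) u] by (simp add: compose_eq u)
    qed
  qed
qed

lemma rmap_surj_iff:
  assumes "rep W P \<eta>" "rep Y Q \<zeta>" "f \<in> linear_maps \<Lambda> W Y"
  shows "rmap W P \<eta> \<zeta> f ` carrier P = carrier Q \<longleftrightarrow> postcomp E f ` linear_maps \<Lambda> E W = linear_maps \<Lambda> E Y"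
proof -
  have "rmap W P \<eta> \<zeta> f ` carrier P = \<zeta> ` postcomp E f ` linear_maps \<Lambda> E W"
    unfolding represents_image_eq[OF assms(1), symmetric] image_image
    by (intro image_cong) (auto simp: rmap_apply[OF assms(1)] postcomp_def)
  moreover have "postcomp E f ` linear_maps \<Lambda> E W \<subseteq> linear_maps \<Lambda> E Y"
    by (auto simp: postcomp_def compose_E[OF assms(3)])
  ultimately show ?thesis
    unfolding represents_image_eq[OF assms(2), symmetric]
    using inj_on_image_eq_iff[OF bij_betw_imp_inj_on[OF representsD(4)[OF assms(2)]]] by simp
qed

lemma linear_maps_into_kernel_image:
  assumes "left_module \<Lambda> W" "left_module \<Lambda> Y" "left_module \<Lambda> Z"
    and "f \<in> linear_maps \<Lambda> W Y" "g \<in> linear_maps \<Lambda> Y Z" "exact_at W Y Z f g"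
  shows "linear_maps \<Lambda> E (image_module W Y f)
    = {h \<in> linear_maps \<Lambda> E Y. postcomp E g h = (\<lambda>e\<in>carrier E. \<zero>\<^bsub>Z\<^esub>)}"
proof -
  have im: "f ` carrier W = {y \<in> carrier Y. g y = \<zero>\<^bsub>Z\<^esub>}" using assms(6) by (simp add: exact_at_iff)
  have "h \<in> linear_maps \<Lambda> E Y \<and> postcomp E g h = (\<lambda>e\<in>carrier E. \<zero>\<^bsub>Z\<^esub>)"
    if h: "h \<in> linear_maps \<Lambda> E (image_module W Y f)" for h
  proof
    have h': "h e \<in> carrier Y \<and> g (h e) = \<zero>\<^bsub>Z\<^esub>" if "e \<in> carrier E" for e
      using linear_maps_closed[OF h that] im by (simp add: image_module_def)
    show "h \<in> linear_maps \<Lambda> E Y"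
      using linear_maps_enlarge[OF h[unfolded image_module_def]] im by blast
    show "postcomp E g h = (\<lambda>e\<in>carrier E. \<zero>\<^bsub>Z\<^esub>)"
      using h' by (auto simp: postcomp_def compose_def intro!: restrict_ext)
  qed
  moreover have "h \<in> linear_maps \<Lambda> E (image_module W Y f)"
    if h: "h \<in> linear_maps \<Lambda> E Y" and z: "postcomp E g h = (\<lambda>e\<in>carrier E. \<zero>\<^bsub>Z\<^esub>)" for h
    unfolding image_module_def
  proof (rule linear_maps_shrink[OF h], rule image_subsetI)
    fix e assume e: "e \<in> carrier E"
    then show "h e \<in> f ` carrier W"
      using fun_cong[OF z, of e] linear_maps_closed[OF h e] unfolding im by (simp add: postcomp_def compose_eq)
  qed
  ultimately show ?thesis by blast
qed

text \<open>
  The image of \<open>f\<close> is the kernel of \<open>g\<close>, so maps \<open>h\<close> from \<open>E\<close> into that image are the maps with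
  \<open>g \<circ> h = 0\<close>.  This links the approximation property of \<open>f\<close> onto its image with the exactness of \<open>Hom(E, -)\<close>.
\<close>

lemma exact_postcomp_iff_surj:
  assumes "left_module \<Lambda> W" "left_module \<Lambda> Y" "left_module \<Lambda> Z"
    and "f \<in> linear_maps \<Lambda> W Y" "g \<in> linear_maps \<Lambda> Y Z" "exact_at W Y Z f g"
  shows "exact_at (Hom \<Lambda> E W) (Hom \<Lambda> E Y) (Hom \<Lambda> E Z) (postcomp E f) (postcomp E g) \<longleftrightarrow>
    postcomp E f ` linear_maps \<Lambda> E W = linear_maps \<Lambda> E (image_module W Y f)"
  unfolding linear_maps_into_kernel_image[OF assms] by (simp add: exact_at_iff)

end

text \<open>
  Modules on both sides have carriers among the functions \<open>nat \<Rightarrow> 'k\<close>.  The embedding of \<open>E\<close> into this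
  type supplies copies there of the modules \<open>Hom(E, W)\<close> and of the members of \<open>add E\<close>.
\<close>

locale embedded_generator = generator_module \<Lambda> E
  for \<Lambda> :: "('k, 'a) module" and E :: "('a, 'e) module" +
  assumes embeddable_E: "embeddable (carrier E) TYPE(nat \<Rightarrow> 'k)"
begin

lemma embeddable_\<Gamma>: "embeddable (carrier \<Gamma>) TYPE(nat \<Rightarrow> 'k)"
  using embeddable_linear_maps[OF fg_E left_E embeddable_E] by simp

lemma in_add_summand: "in_add \<Lambda> E W \<longleftrightarrow> fg_module \<Lambda> W \<and> summand_of_copies \<Lambda> E W"
  by (rule in_add_iff[OF left_E])

lemma projective_summand:
  fixes P :: "('e \<Rightarrow> 'e, nat \<Rightarrow> 'k) module"
  shows "projective \<Gamma> P \<longleftrightarrow> fg_module \<Gamma> P \<and> summand_of_copies \<Gamma> (regular_module \<Gamma>) P"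
  by (rule projective_iff[OF ring_\<Gamma> embeddable_\<Gamma>])

lemma in_add_left: "in_add \<Lambda> E W \<Longrightarrow> left_module \<Lambda> W"
  by (auto simp: in_add_def fg_module_def)

lemma projective_left: "projective \<Gamma> P \<Longrightarrow> left_module \<Gamma> P"
  by (auto simp: projective_def fg_module_def)

lemma represented_exists:
  fixes W :: "('a, nat \<Rightarrow> 'k) module"
  assumes "left_module \<Lambda> W"
  shows "\<exists>(P :: ('e \<Rightarrow> 'e, nat \<Rightarrow> 'k) module) \<eta>. rep W P \<eta>"
proof -
  have "embeddable (carrier W) TYPE(nat \<Rightarrow> 'k)" unfolding embeddable_def by (intro exI[of _ "\<lambda>x. x"]) simp
  then have "embeddable (carrier (F W)) TYPE(nat \<Rightarrow> 'k)"
    using embeddable_linear_maps[OF fg_E assms] by simp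
  then obtain P :: "('e \<Rightarrow> 'e, nat \<Rightarrow> 'k) module" and \<eta> where
    P: "left_module \<Gamma> P" "\<eta> \<in> linear_maps \<Gamma> (F W) P" "bij_betw \<eta> (carrier (F W)) (carrier P)"
    by (rule transport_module[OF left_module_hom_module[OF left_E assms]])
  then show ?thesis using assms by (auto simp: represents_def)
qed

lemma projective_represented:
  fixes P :: "('e \<Rightarrow> 'e, nat \<Rightarrow> 'k) module"
  assumes "in_add \<Lambda> E W" "rep W P \<eta>"
  shows "projective \<Gamma> P"
proof -
  have "summand_of_copies \<Gamma> (regular_module \<Gamma>) P"
    using summand_of_copies_represented[OF assms(2)] assms(1) by (simp add: in_add_summand)
  then show ?thesis
    using summand_of_copies_fg[OF fg_module_regular[OF ring_\<Gamma>] representsD(2)[OF assms(2)]]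
    by (simp add: projective_summand)
qed

lemma projective_representable:
  fixes P :: "('e \<Rightarrow> 'e, nat \<Rightarrow> 'k) module"
  assumes "projective \<Gamma> P"
  shows "\<exists>(W :: ('a, nat \<Rightarrow> 'k) module) \<eta>. in_add \<Lambda> E W \<and> rep W P \<eta>"
proof -
  have P: "left_module \<Gamma> P" "summand_of_copies \<Gamma> (regular_module \<Gamma>) P"
    using assms by (auto simp: projective_summand fg_module_def)
  obtain V :: "('a, nat \<Rightarrow> 'e) module" and n \<eta> where V: "rep V P \<eta>" "summand_of_copies \<Lambda> E V"
    "carrier V \<subseteq> {..<n} \<rightarrow>\<^sub>E carrier E"
    by (rule summand_of_regular_representable[OF P], rule that)
  have LV: "left_module \<Lambda> V" by (rule representsD(1)[OF V(1)])
  have "embeddable (carrier V) TYPE(nat \<Rightarrow> 'k)"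
    using embeddable_inj[OF _ _ embeddable_tuples[OF embeddable_E], of "\<lambda>x. x"] V(3) by simp
  then obtain W :: "('a, nat \<Rightarrow> 'k) module" and f where
    W: "left_module \<Lambda> W" "f \<in> linear_maps \<Lambda> V W" "bij_betw f (carrier V) (carrier W)"
    by (rule transport_module[OF LV])
  have iso: "mod_iso \<Lambda> V W" using W by (auto simp: mod_iso_def)
  obtain g where g: "g \<in> linear_maps \<Lambda> W V" "bij_betw g (carrier W) (carrier V)"
    using mod_iso_sym[OF LV W(1) iso] by (auto simp: mod_iso_def)
  have "summand_of_copies \<Lambda> E W" by (rule summand_of_copies_iso[OF left_E LV W(1) iso V(2)])
  then have "in_add \<Lambda> E W"
    using summand_of_copies_fg[OF fg_E W(1)] by (simp add: in_add_summand)
  then show ?thesis using represents_iso_source[OF V(1) W(1) g] by blast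
qed

text \<open>
  Both notions consist of exactness, surjectivity and right minimality.  An exact
  \<open>add E\<close>-presentation by approximations stays exact under \<open>Hom(E, -)\<close>, and exactness under
  \<open>Hom(E, -)\<close> implies exactness; right minimality is preserved and reflected, and over projectives it means
  that the kernel is superfluous.
\<close>

lemma minimal_presentation_iff_represented:
  fixes X1 X0 M :: "('a, nat \<Rightarrow> 'k) module" and P1 P0 N :: "('e \<Rightarrow> 'e, nat \<Rightarrow> 'k) module"
  assumes r1: "rep X1 P1 \<eta>1" and r0: "rep X0 P0 \<eta>0" and r: "rep M N \<eta>"
    and f1: "f1 \<in> linear_maps \<Lambda> X1 X0" and f0: "f0 \<in> linear_maps \<Lambda> X0 M"
    and a1: "in_add \<Lambda> E X1" and a0: "in_add \<Lambda> E X0"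
  shows "minimal_add_presentation \<Lambda> E X1 X0 M f1 f0 \<longleftrightarrow>
    minimal_projective_presentation \<Gamma> P1 P0 N (rmap X1 P1 \<eta>1 \<eta>0 f1) (rmap X0 P0 \<eta>0 \<eta> f0)"
proof -
  let ?g1 = "rmap X1 P1 \<eta>1 \<eta>0 f1" and ?g0 = "rmap X0 P0 \<eta>0 \<eta> f0"
  note L1 = in_add_left[OF a1] and L0 = in_add_left[OF a0] and LM = representsD(1)[OF r]
  note G1 = representsD(2)[OF r1] and G0 = representsD(2)[OF r0] and GN = representsD(2)[OF r]
  note p1 = projective_represented[OF a1 r1] and p0 = projective_represented[OF a0 r0]
  note g1 = rmap_linear[OF r1 r0 f1] and g0 = rmap_linear[OF r0 r f0]
  note I1 = left_module_image[OF L1 L0 f1]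
  have s1: "summand_of_copies \<Gamma> (regular_module \<Gamma>) P1" and s0: "summand_of_copies \<Gamma> (regular_module \<Gamma>) P0"
    using p1 p0 by (auto simp: projective_summand)
  have ex: "exact_at P1 P0 N ?g1 ?g0 \<longleftrightarrow>
      exact_at (Hom \<Lambda> E X1) (Hom \<Lambda> E X0) (Hom \<Lambda> E M) (postcomp E f1) (postcomp E f0)"
    by (rule exact_at_rmap_iff[OF r1 r0 r f1 f0])
  have cover1: "projective_cover \<Gamma> P1 (image_module P1 P0 ?g1) ?g1 \<longleftrightarrow> right_minimal \<Lambda> X1 f1"
  proof -
    have "image_module P1 P0 ?g1 = image_module P1 P0 ?g1" ..
    have im: "?g1 ` carrier P1 = carrier (image_module P1 P0 ?g1)" by (simp add: image_module_def)
    show ?thesis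
      unfolding projective_cover_def right_minimal_iff_represented[OF r1 r0 f1]
        superfluous_kernel_iff_right_minimal[OF G1 s1 left_module_image[OF G1 G0 g1]
          linear_maps_image_module[OF g1] im]
      using p1 im linear_maps_image_module[OF g1] by blast
  qed
  have cover0: "projective_cover \<Gamma> P0 N ?g0 \<longleftrightarrow> right_minimal \<Lambda> X0 f0 \<and> ?g0 ` carrier P0 = carrier N"
    unfolding projective_cover_def right_minimal_iff_represented[OF r0 r f0]
    using superfluous_kernel_iff_right_minimal[OF G0 s0 GN g0] p0 g0 by blast
  have approx1: "right_add_approx \<Lambda> E X1 (image_module X1 X0 f1) f1 \<longleftrightarrow>
      postcomp E f1 ` linear_maps \<Lambda> E X1 = linear_maps \<Lambda> E (image_module X1 X0 f1)"
    using right_add_approx_surj[OF fg_E embeddable_E, of X1 "image_module X1 X0 f1" f1]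
      right_add_approxI[OF left_E a1 I1 linear_maps_image_module[OF f1]] by blast
  have approx0: "right_add_approx \<Lambda> E X0 M f0 \<longleftrightarrow> postcomp E f0 ` linear_maps \<Lambda> E X0 = linear_maps \<Lambda> E M"
    using right_add_approx_surj[OF fg_E embeddable_E, of X0 M f0]
      right_add_approxI[OF left_E a0 LM f0] by blast
  have surj0: "?g0 ` carrier P0 = carrier N \<longleftrightarrow> postcomp E f0 ` linear_maps \<Lambda> E X0 = linear_maps \<Lambda> E M"
    by (rule rmap_surj_iff[OF r0 r f0])
  show ?thesis
  proof
    assume pres: "minimal_add_presentation \<Lambda> E X1 X0 M f1 f0"
    then have exX: "exact_at X1 X0 M f1 f0" and on: "f0 ` carrier X0 = carrier M"
      and m1: "minimal_right_add_approx \<Lambda> E X1 (image_module X1 X0 f1) f1"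
      and "minimal_right_add_approx \<Lambda> E X0 (image_module X0 M f0) f0"
      by (simp_all add: minimal_add_presentation_def)
    then have m0: "minimal_right_add_approx \<Lambda> E X0 M f0" by (simp add: image_module_def)
    have "exact_at P1 P0 N ?g1 ?g0"
      unfolding ex exact_postcomp_iff_surj[OF L1 L0 LM f1 f0 exX]
      using m1 approx1 by (simp add: minimal_right_add_approx_def)
    then show "minimal_projective_presentation \<Gamma> P1 P0 N ?g1 ?g0"
      using g1 m1 m0 cover1 cover0 surj0 approx0
      by (simp add: minimal_projective_presentation_def minimal_right_add_approx_def)
  next
    assume pres: "minimal_projective_presentation \<Gamma> P1 P0 N ?g1 ?g0"
    then have exP: "exact_at (Hom \<Lambda> E X1) (Hom \<Lambda> E X0) (Hom \<Lambda> E M) (postcomp E f1) (postcomp E f0)"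
      and m1: "right_minimal \<Lambda> X1 f1" and m0: "right_minimal \<Lambda> X0 f0"
      and on: "postcomp E f0 ` linear_maps \<Lambda> E X0 = linear_maps \<Lambda> E M"
      using ex cover1 cover0 surj0 by (auto simp: minimal_projective_presentation_def)
    have exX: "exact_at X1 X0 M f1 f0" by (rule exact_at_reflect[OF L1 L0 LM f1 f0 exP])
    have onX: "f0 ` carrier X0 = carrier M" by (rule postcomp_surj_reflect[OF L0 LM f0 on])
    then have "image_module X0 M f0 = M" by (simp add: image_module_def)
    then show "minimal_add_presentation \<Lambda> E X1 X0 M f1 f0"
      using f1 f0 exX onX m1 m0 approx0 approx1 on exact_postcomp_iff_surj[OF L1 L0 LM f1 f0 exX] exP
      by (simp add: minimal_add_presentation_def minimal_right_add_approx_def)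
  qed
qed

text \<open>
  Take a minimal presentation on either side to the other.  Surjectivity of \<open>Hom(f1, M)\<close> passes
  through the functor, where it is equivalent to the vanishing of \<open>Hom(N, \<tau> N)\<close>.
\<close>

lemma E_rigid_iff_tau_rigid:
  fixes M :: "('a, nat \<Rightarrow> 'k) module" and N :: "('e \<Rightarrow> 'e, nat \<Rightarrow> 'k) module"
  assumes K: "algebra_over_field K \<Gamma>" and r: "rep M N \<eta>"
  shows "E_rigid \<Lambda> E M \<longleftrightarrow> tau_rigid K \<Gamma> N"
proof
  note LM = representsD(1)[OF r] and LN = representsD(2)[OF r]
  assume "E_rigid \<Lambda> E M"
  then obtain X1 X0 :: "('a, nat \<Rightarrow> 'k) module" and f1 f0 where pres: "minimal_add_presentation \<Lambda> E X1 X0 M f1 f0"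
    and surj: "precomp X1 f1 ` linear_maps \<Lambda> X0 M = linear_maps \<Lambda> X1 M"
    by (auto simp: E_rigid_def)
  have f: "f1 \<in> linear_maps \<Lambda> X1 X0" "f0 \<in> linear_maps \<Lambda> X0 M" "in_add \<Lambda> E X1" "in_add \<Lambda> E X0"
    using pres by (auto simp: minimal_add_presentation_def minimal_right_add_approx_def right_add_approx_def)
  obtain P1 :: "('e \<Rightarrow> 'e, nat \<Rightarrow> 'k) module" and \<eta>1 where r1: "rep X1 P1 \<eta>1"
    using represented_exists[OF in_add_left[OF f(3)]] by blast
  obtain P0 :: "('e \<Rightarrow> 'e, nat \<Rightarrow> 'k) module" and \<eta>0 where r0: "rep X0 P0 \<eta>0"
    using represented_exists[OF in_add_left[OF f(4)]] by blast
  let ?g1 = "rmap X1 P1 \<eta>1 \<eta>0 f1" and ?g0 = "rmap X0 P0 \<eta>0 \<eta> f0"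
  have presP: "minimal_projective_presentation \<Gamma> P1 P0 N ?g1 ?g0"
    using minimal_presentation_iff_represented[OF r1 r0 r f] pres by blast
  note p1 = projective_represented[OF f(3) r1] and p0 = projective_represented[OF f(4) r0]
  have g0: "?g0 \<in> linear_maps \<Gamma> P0 N" "?g0 ` carrier P0 = carrier N"
    using presP by (auto simp: minimal_projective_presentation_def projective_cover_def)
  have "fg_module \<Gamma> N"
    using fg_module_image[OF _ LN g0(1)] g0(2) p0 by (simp add: image_module_def projective_summand)
  moreover have "precomp P1 ?g1 ` linear_maps \<Gamma> P0 N = linear_maps \<Gamma> P1 N"
    using precomp_surj_iff[OF r1 r0 r f(1)] surj by blast
  ultimately show "tau_rigid K \<Gamma> N"
    using projective_presentation.Hom_translate_zero_iff[OF projective_presentation.intro[OF K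
          projective_presentation_axioms.intro[OF LN representsD(2)[OF r1] representsD(2)[OF r0]
            rmap_linear[OF r1 r0 f(1)]]]] p1 p0 presP
    unfolding tau_rigid_def is_AR_translate_def projective_summand by blast
next
  note LM = representsD(1)[OF r] and LN = representsD(2)[OF r]
  assume "tau_rigid K \<Gamma> N"
  then obtain P1 P0 :: "('e \<Rightarrow> 'e, nat \<Rightarrow> 'k) module" and g1 g0 where
    presP: "minimal_projective_presentation \<Gamma> P1 P0 N g1 g0"
    and triv: "carrier (Hom \<Gamma> N (K_dual K (op_alg \<Gamma>) (transpose_module \<Gamma> P1 P0 g1))) =
      {\<zero>\<^bsub>Hom \<Gamma> N (K_dual K (op_alg \<Gamma>) (transpose_module \<Gamma> P1 P0 g1))\<^esub>}"
    unfolding tau_rigid_def is_AR_translate_def by blast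
  have g: "g1 \<in> linear_maps \<Gamma> P1 P0" "g0 \<in> linear_maps \<Gamma> P0 N" "projective \<Gamma> P1" "projective \<Gamma> P0"
    using presP by (auto simp: minimal_projective_presentation_def projective_cover_def)
  obtain X1 :: "('a, nat \<Rightarrow> 'k) module" and \<eta>1 where a1: "in_add \<Lambda> E X1" and r1: "rep X1 P1 \<eta>1"
    using projective_representable[OF g(3)] by blast
  obtain X0 :: "('a, nat \<Rightarrow> 'k) module" and \<eta>0 where a0: "in_add \<Lambda> E X0" and r0: "rep X0 P0 \<eta>0"
    using projective_representable[OF g(4)] by blast
  obtain f1 where f1: "f1 \<in> linear_maps \<Lambda> X1 X0" "g1 = rmap X1 P1 \<eta>1 \<eta>0 f1"
    by (rule rmap_full[OF r1 r0 g(1)], rule that)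
  obtain f0 where f0: "f0 \<in> linear_maps \<Lambda> X0 M" "g0 = rmap X0 P0 \<eta>0 \<eta> f0"
    by (rule rmap_full[OF r0 r g(2)], rule that)
  have pres: "minimal_add_presentation \<Lambda> E X1 X0 M f1 f0"
    using minimal_presentation_iff_represented[OF r1 r0 r f1(1) f0(1) a1 a0] presP f1(2) f0(2) by simp
  then have on: "f0 ` carrier X0 = carrier M" by (simp add: minimal_add_presentation_def)
  have "fg_module \<Lambda> M"
    using fg_module_image[OF _ LM f0(1)] on a0 by (simp add: image_module_def in_add_def)
  moreover have "precomp P1 g1 ` linear_maps \<Gamma> P0 N = linear_maps \<Gamma> P1 N"
    using projective_presentation.Hom_translate_zero_iff[OF projective_presentation.intro[OF K
          projective_presentation_axioms.intro[OF LN representsD(2)[OF r1] representsD(2)[OF r0] g(1)]]]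
      triv g(3,4) unfolding projective_summand by blast
  ultimately show "E_rigid \<Lambda> E M"
    using precomp_surj_iff[OF r1 r0 r f1(1)] pres unfolding E_rigid_def f1(2) by blast
qed

text \<open>
  Exactness under \<open>Hom(E, -)\<close> becomes exactness over \<open>\<Gamma>\<close>, and exactness under \<open>Hom(-, E)\<close> becomes exactness under
  \<open>Hom(-, \<Gamma>)\<close>.  Since maps from \<open>E\<close> into the image of \<open>d 0\<close> lift along \<open>d 0\<close>, this image is sent to the
  corresponding image over \<open>\<Gamma>\<close>.
\<close>

lemma E_gorenstein_projective_represented:
  fixes M :: "('a, nat \<Rightarrow> 'k) module" and N :: "('e \<Rightarrow> 'e, nat \<Rightarrow> 'k) module"
  assumes r: "rep M N \<eta>" and gp: "E_gorenstein_projective \<Lambda> E M"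
  shows "gorenstein_projective \<Gamma> N"
proof -
  obtain Q :: "int \<Rightarrow> ('a, nat \<Rightarrow> 'k) module" and d where
    Q: "\<And>i. in_add \<Lambda> E (Q i)" and d: "\<And>i. d i \<in> linear_maps \<Lambda> (Q i) (Q (i + 1))"
    and exQ: "\<And>i. exact_at (Q i) (Q (i + 1)) (Q (i + 2)) (d i) (d (i + 1))"
    and exc: "\<And>i. exact_at (Hom \<Lambda> (Q (i + 2)) E) (Hom \<Lambda> (Q (i + 1)) E) (Hom \<Lambda> (Q i) E)
              (precomp (Q (i + 1)) (d (i + 1))) (precomp (Q i) (d i))"
    and exh: "\<And>i. exact_at (Hom \<Lambda> E (Q i)) (Hom \<Lambda> E (Q (i + 1))) (Hom \<Lambda> E (Q (i + 2)))
              (postcomp E (d i)) (postcomp E (d (i + 1)))"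
    and iso: "mod_iso \<Lambda> M (image_module (Q 0) (Q 1) (d 0))"
    using gp unfolding E_gorenstein_projective_def by blast
  note LQ = in_add_left[OF Q]
  have s2: "i + 1 + 1 = i + 2" and s3: "i + 1 + 2 = i + 2 + 1" for i :: int by auto
  have "\<forall>i. \<exists>p. rep (Q i) (fst p :: ('e \<Rightarrow> 'e, nat \<Rightarrow> 'k) module) (snd p)"
    using represented_exists[OF LQ] by simp
  then obtain p where p: "\<And>i. rep (Q i) (fst (p i) :: ('e \<Rightarrow> 'e, nat \<Rightarrow> 'k) module) (snd (p i))"
    by metis
  define P \<rho> where "P i = fst (p i)" and "\<rho> i = snd (p i)" for i
  have rp: "rep (Q i) (P i) (\<rho> i)" for i using p by (simp add: P_def \<rho>_def)
  define g where "g i = rmap (Q i) (P i) (\<rho> i) (\<rho> (i + 1)) (d i)" for i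
  have d2: "d (i + 1) \<in> linear_maps \<Lambda> (Q (i + 1)) (Q (i + 2))" for i using d[of "i + 1"] unfolding s2 .
  have g2: "g (i + 1) = rmap (Q (i + 1)) (P (i + 1)) (\<rho> (i + 1)) (\<rho> (i + 2)) (d (i + 1))" for i
    unfolding g_def s2 ..
  have gl: "g i \<in> linear_maps \<Gamma> (P i) (P (i + 1))" for i
    unfolding g_def by (rule rmap_linear[OF rp rp d])
  have exP: "exact_at (P i) (P (i + 1)) (P (i + 2)) (g i) (g (i + 1))" for i
    unfolding g2 unfolding g_def exact_at_rmap_iff[OF rp rp rp d d2] by (rule exh)
  have exD: "exact_at (Hom \<Gamma> (P (i + 2)) (regular_module \<Gamma>)) (Hom \<Gamma> (P (i + 1)) (regular_module \<Gamma>))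
      (Hom \<Gamma> (P i) (regular_module \<Gamma>)) (precomp (P (i + 1)) (g (i + 1))) (precomp (P i) (g i))" for i
    unfolding g2 unfolding g_def exact_at_contravariant_iff[OF rp rp rp represents_self d d2] by (rule exc)
  let ?I = "image_module (Q 0) (Q 1) (d 0)" and ?J = "image_module (P 0) (P 1) (g 0)"
  have d0: "d 0 \<in> linear_maps \<Lambda> (Q 0) (Q 1)" using d[of 0] by simp
  have d1: "d 1 \<in> linear_maps \<Lambda> (Q 1) (Q 2)" using d[of 1] by simp
  have lift: "\<exists>k\<in>linear_maps \<Lambda> E (Q 0). h = compose (carrier E) (d 0) k" if "h \<in> linear_maps \<Lambda> E ?I" for h
    using exact_postcomp_iff_surj[OF LQ LQ LQ d0 d1] exQ[of 0] exh[of 0] that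
    by (auto simp: postcomp_def)
  have rIJ: "rep ?I ?J (\<lambda>h\<in>linear_maps \<Lambda> E ?I. \<rho> 1 h)"
    using represents_image[OF rp rp d0 lift] by (simp add: g_def)
  have isoN: "mod_iso \<Gamma> N ?J" using mod_iso_iff_represented[OF r rIJ] iso by blast
  have pr: "projective \<Gamma> (P i)" for i by (rule projective_represented[OF Q rp])
  have "fg_module \<Gamma> ?J"
    using fg_module_image[of \<Gamma> "P 0" "P 1" "g 0"] gl[of 0] pr[of 0] projective_left[OF pr[of 1]]
    by (simp add: projective_summand)
  then have fgN: "fg_module \<Gamma> N"
    using fg_module_iso[OF _ representsD(2)[OF r] mod_iso_sym[OF representsD(2)[OF r] representsD(2)[OF rIJ] isoN]]
    by blast
  \<comment> \<open>The two definitions index the complex differently: the image of \<open>d 0\<close> becomes that of \<open>d (-1)\<close>.\<close>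
  let ?P = "\<lambda>i. P (i + 1)" and ?g = "\<lambda>i. g (i + 1)"
  have A: "?g i \<in> linear_maps \<Gamma> (?P i) (?P (i + 1))" for i by (rule gl)
  have B: "exact_at (?P i) (?P (i + 1)) (?P (i + 2)) (?g i) (?g (i + 1))" for i
    using exP[of "i + 1"] unfolding s3 .
  have C: "exact_at (Hom \<Gamma> (?P (i + 2)) (regular_module \<Gamma>)) (Hom \<Gamma> (?P (i + 1)) (regular_module \<Gamma>))
      (Hom \<Gamma> (?P i) (regular_module \<Gamma>)) (precomp (?P (i + 1)) (?g (i + 1))) (precomp (?P i) (?g i))" for i
    using exD[of "i + 1"] unfolding s3 .
  have D: "mod_iso \<Gamma> N (image_module (?P (-1)) (?P 0) (?g (-1)))" using isoN by simp
  show ?thesis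
    unfolding gorenstein_projective_def
    by (intro conjI exI[of _ ?P] exI[of _ ?g] allI fgN pr A B C D)
qed

text \<open>
  A complex of projectives comes from a complex of modules in \<open>add E\<close> by full faithfulness.  The latter
  is exact under \<open>Hom(E, -)\<close>, hence exact because \<open>E\<close> is a generator.  So every Gorenstein projective
  \<open>\<Gamma>\<close>-module is, up to isomorphism, a value of the functor.
\<close>

lemma gorenstein_projective_representable:
  fixes N :: "('e \<Rightarrow> 'e, nat \<Rightarrow> 'k) module"
  assumes "gorenstein_projective \<Gamma> N"
  shows "\<exists>(M :: ('a, nat \<Rightarrow> 'k) module) \<eta>. rep M N \<eta> \<and> E_gorenstein_projective \<Lambda> E M"
proof -
  obtain P :: "int \<Rightarrow> ('e \<Rightarrow> 'e, nat \<Rightarrow> 'k) module" and g where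
    P: "\<And>i. projective \<Gamma> (P i)" and gl: "\<And>i. g i \<in> linear_maps \<Gamma> (P i) (P (i + 1))"
    and exP: "\<And>i. exact_at (P i) (P (i + 1)) (P (i + 2)) (g i) (g (i + 1))"
    and exD: "\<And>i. exact_at (Hom \<Gamma> (P (i + 2)) (regular_module \<Gamma>)) (Hom \<Gamma> (P (i + 1)) (regular_module \<Gamma>))
              (Hom \<Gamma> (P i) (regular_module \<Gamma>)) (precomp (P (i + 1)) (g (i + 1))) (precomp (P i) (g i))"
    and iso: "mod_iso \<Gamma> N (image_module (P (-1)) (P 0) (g (-1)))"
    using assms unfolding gorenstein_projective_def by blast
  have s2: "i + 1 + 1 = i + 2" for i :: int by auto
  have LN: "left_module \<Gamma> N" using assms by (auto simp: gorenstein_projective_def fg_module_def)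
  have "\<forall>i. \<exists>q. in_add \<Lambda> E (fst q :: ('a, nat \<Rightarrow> 'k) module) \<and> rep (fst q) (P i) (snd q)"
    using projective_representable[OF P] by simp
  then obtain q where q: "\<And>i. in_add \<Lambda> E (fst (q i) :: ('a, nat \<Rightarrow> 'k) module)"
    "\<And>i. rep (fst (q i)) (P i) (snd (q i))"
    by metis
  define Q \<rho> where "Q i = fst (q i)" and "\<rho> i = snd (q i)" for i
  have Q: "in_add \<Lambda> E (Q i)" and rp: "rep (Q i) (P i) (\<rho> i)" for i using q by (simp_all add: Q_def \<rho>_def)
  note LQ = in_add_left[OF Q]
  have "\<forall>i. \<exists>f. f \<in> linear_maps \<Lambda> (Q i) (Q (i + 1)) \<and> g i = rmap (Q i) (P i) (\<rho> i) (\<rho> (i + 1)) f"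
    using rmap_full[OF rp rp gl] by metis
  then obtain d where d: "\<And>i. d i \<in> linear_maps \<Lambda> (Q i) (Q (i + 1))"
    and gd: "\<And>i. g i = rmap (Q i) (P i) (\<rho> i) (\<rho> (i + 1)) (d i)" by metis
  have d2: "d (i + 1) \<in> linear_maps \<Lambda> (Q (i + 1)) (Q (i + 2))" for i using d[of "i + 1"] unfolding s2 .
  have g2: "g (i + 1) = rmap (Q (i + 1)) (P (i + 1)) (\<rho> (i + 1)) (\<rho> (i + 2)) (d (i + 1))" for i
    unfolding gd s2 ..
  have exh: "exact_at (Hom \<Lambda> E (Q i)) (Hom \<Lambda> E (Q (i + 1))) (Hom \<Lambda> E (Q (i + 2)))
      (postcomp E (d i)) (postcomp E (d (i + 1)))" for i
    using exP[of i] unfolding g2 gd[of i] exact_at_rmap_iff[OF rp rp rp d d2] .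
  have exc: "exact_at (Hom \<Lambda> (Q (i + 2)) E) (Hom \<Lambda> (Q (i + 1)) E) (Hom \<Lambda> (Q i) E)
      (precomp (Q (i + 1)) (d (i + 1))) (precomp (Q i) (d i))" for i
    using exD[of i] unfolding g2 gd[of i] exact_at_contravariant_iff[OF rp rp rp represents_self d d2] .
  have exQ: "exact_at (Q i) (Q (i + 1)) (Q (i + 2)) (d i) (d (i + 1))" for i
    by (rule exact_at_reflect[OF LQ LQ LQ d d2 exh])
  let ?I = "image_module (Q (-1)) (Q 0) (d (-1))" and ?J = "image_module (P (-1)) (P 0) (g (-1))"
  have dm: "d (-1) \<in> linear_maps \<Lambda> (Q (-1)) (Q 0)" using d[of "-1"] by simp
  have d0: "d 0 \<in> linear_maps \<Lambda> (Q 0) (Q 1)" using d[of 0] by simp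
  have lift: "\<exists>k\<in>linear_maps \<Lambda> E (Q (-1)). h = compose (carrier E) (d (-1)) k" if "h \<in> linear_maps \<Lambda> E ?I" for h
    using exact_postcomp_iff_surj[OF LQ LQ LQ dm d0] exQ[of "-1"] exh[of "-1"] that
    by (auto simp: postcomp_def)
  have rIJ: "rep ?I ?J (\<lambda>h\<in>linear_maps \<Lambda> E ?I. \<rho> 0 h)"
    using represents_image[OF rp rp dm lift] by (simp add: gd)
  have LI: "left_module \<Lambda> ?I" by (rule representsD(1)[OF rIJ])
  obtain \<gamma> where "\<gamma> \<in> linear_maps \<Gamma> ?J N" "bij_betw \<gamma> (carrier ?J) (carrier N)"
    using mod_iso_sym[OF LN representsD(2)[OF rIJ] iso] by (auto simp: mod_iso_def)
  from represents_iso_target[OF rIJ LN this] obtain \<eta> where rI: "rep ?I N \<eta>" by blast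
  have fgI: "fg_module \<Lambda> ?I"
    by (rule fg_module_image[OF _ LQ dm]) (use Q in \<open>simp add: in_add_def\<close>)
  let ?Q = "\<lambda>i. Q (i - 1)" and ?d = "\<lambda>i. d (i - 1)"
  have s: "i - 1 + 1 = i + 1 - 1" "i - 1 + 2 = i + 2 - 1" for i :: int by auto
  have A: "?d i \<in> linear_maps \<Lambda> (?Q i) (?Q (i + 1))" for i using d[of "i - 1"] unfolding s .
  have B: "exact_at (?Q i) (?Q (i + 1)) (?Q (i + 2)) (?d i) (?d (i + 1))" for i
    using exQ[of "i - 1"] unfolding s .
  have C: "exact_at (Hom \<Lambda> (?Q (i + 2)) E) (Hom \<Lambda> (?Q (i + 1)) E) (Hom \<Lambda> (?Q i) E)
      (precomp (?Q (i + 1)) (?d (i + 1))) (precomp (?Q i) (?d i))" for i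
    using exc[of "i - 1"] unfolding s .
  have D: "exact_at (Hom \<Lambda> E (?Q i)) (Hom \<Lambda> E (?Q (i + 1))) (Hom \<Lambda> E (?Q (i + 2)))
      (postcomp E (?d i)) (postcomp E (?d (i + 1)))" for i
    using exh[of "i - 1"] unfolding s .
  have I: "mod_iso \<Lambda> ?I (image_module (?Q 0) (?Q 1) (?d 0))" using mod_iso_refl[OF LI] by simp
  have "E_gorenstein_projective \<Lambda> E ?I"
    unfolding E_gorenstein_projective_def
    by (intro conjI exI[of _ ?Q] exI[of _ ?d] allI fgI Q A B C D I)
  then show ?thesis using rI by blast
qed

end

theorem theorem1p2:
  fixes K :: "('k, 'z) ring_scheme"
    and \<Lambda> :: "('k, 'a) module"
    and E :: "('a, 'e) module"
  assumes "algebraically_closed K"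
    and "fd_algebra K \<Lambda>"
    and "generator \<Lambda> E"
  shows "\<exists>\<phi>. bij_betw \<phi> (EG \<Lambda> E) (TG K (End_op \<Lambda> E))"
proof -
  interpret \<Lambda>: fd_algebra K \<Lambda> by fact
  have fgE: "fg_module \<Lambda> E" and E: "left_module \<Lambda> E" and gen: "summand_of_copies \<Lambda> E (regular_module \<Lambda>)"
    using assms(3) in_add_iff[of \<Lambda> E] by (auto simp: generator_def fg_module_def)
  have "embeddable (carrier K) TYPE(nat \<Rightarrow> 'k)"
    unfolding embeddable_def by (intro exI[of _ "\<lambda>x _. x"]) (auto simp: inj_on_def fun_eq_iff)
  moreover have "fg_module K \<Lambda>"
    unfolding fg_module_def using \<Lambda>.finite_dim
    by (auto intro!: left_moduleI \<Lambda>.R.ring_axioms \<Lambda>.M.abelian_group_axioms \<Lambda>.smult_l_distr \<Lambda>.smult_r_distr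
        \<Lambda>.smult_assoc1)
  ultimately have "embeddable (carrier \<Lambda>) TYPE(nat \<Rightarrow> 'k)" by (intro embeddable_fg_module)
  then have "embeddable (carrier E) TYPE(nat \<Rightarrow> 'k)" by (rule embeddable_fg_module[OF fgE])
  then interpret embedded_generator \<Lambda> E
    using fgE gen by unfold_locales
  note K = End_op_algebra[OF assms(2) E]
  let ?C = "{M :: ('a, nat \<Rightarrow> 'k) module.
    indecomposable \<Lambda> M \<and> E_gorenstein_projective \<Lambda> E M \<and> E_rigid \<Lambda> E M}"
  let ?D = "{N :: ('e \<Rightarrow> 'e, nat \<Rightarrow> 'k) module.
    indecomposable \<Gamma> N \<and> gorenstein_projective \<Gamma> N \<and> tau_rigid K \<Gamma> N}"
  have "\<exists>\<phi>. bij_betw \<phi> (iso_classes \<Lambda> ?C) (iso_classes \<Gamma> ?D)"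
  proof (rule iso_classes_bij[where Rel = "\<lambda>M N. \<exists>\<eta>. rep M N \<eta>"])
    fix M assume M: "M \<in> ?C"
    then show LM: "left_module \<Lambda> M" by (auto simp: E_rigid_def fg_module_def)
    obtain N :: "('e \<Rightarrow> 'e, nat \<Rightarrow> 'k) module" and \<eta> where r: "rep M N \<eta>"
      using represented_exists[OF LM] by blast
    then have "N \<in> ?D"
      using M indecomposable_iff_represented[OF r] E_gorenstein_projective_represented[OF r]
        E_rigid_iff_tau_rigid[OF K r] by blast
    then show "\<exists>N\<in>?D. \<exists>\<eta>. rep M N \<eta>" using r by blast
  next
    fix N assume N: "N \<in> ?D"
    then show "left_module \<Gamma> N" by (auto simp: tau_rigid_def fg_module_def)
    obtain M :: "('a, nat \<Rightarrow> 'k) module" and \<eta> where r: "rep M N \<eta>" and "E_gorenstein_projective \<Lambda> E M"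
      using gorenstein_projective_representable N by blast
    then have "M \<in> ?C"
      using N indecomposable_iff_represented[OF r] E_rigid_iff_tau_rigid[OF K r] by blast
    then show "\<exists>M\<in>?C. \<exists>\<eta>. rep M N \<eta>" using r by blast
  next
    fix M N M' N' assume "\<exists>\<eta>. rep M N \<eta>" "\<exists>\<eta>. rep M' N' \<eta>"
    then show "mod_iso \<Lambda> M M' \<longleftrightarrow> mod_iso \<Gamma> N N'" using mod_iso_iff_represented by blast
  qed
  then show ?thesis unfolding EG_def TG_def .
qed

end
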